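(* Let $X$ be a Banach sequence lattice. Then for every $n$ and every index set $J\subset\mathbb{N}_0^n$, $$K(B_{X_n},J)\ge\frac16\inf_{m\in\mathbb{N}}\Big(\frac{1}{\big(e\|\mathbf{Q}_{\Lambda(m,n),J(m)}\|\big)^{1/m}}\cdot\frac{1}{\boldsymbol{\lambda}\big(\mathcal{P}_{J(m)^\flat}(X_n)\big)^{1/m}}\Big).$$
   Context: $X$ is a Banach space of complex sequences with the ideal property; $X_n$ is $\mathbb{C}^n$ with $\|z\|=\|\sum_{k\le n}|z_k|e_k\|_X$, $B_{X_n}$ its open unit ball. $\Lambda(m,n)=\{\alpha\in\mathbb{N}_0^n:|\alpha|=m\}$, $J(m)=J\cap\Lambda(m,n)$, and for $I\subset\Lambda(m,n)$, $I^\flat=\{\alpha\in\Lambda(m-1,n):\alpha+e_k\in I\text{ for some }k\}$. $\mathcal{P}_I(X_n)$: polynomials $\sum_{\alpha\in I}c_\alpha z^\alpha$ with sup norm over $B_{X_n}$; for $I\subset I'$, $\mathbf{Q}_{I',I}:\mathcal{P}_{I'}(X_n)\to\mathcal{P}_I(X_n)$ keeps coefficients indexed by $I$ and annihilates the rest. $\boldsymbol{\lambda}$: projection constant. $K(B_{X_n},J)$ is the Bohr radius: the supremum of $r\in(0,1)$ with $\sup_{z\in rB_{X_n}}\sum_{\alpha\in J}|c_\alpha(f)z^\alpha|\le\sup_{B_{X_n}}|f|$ for all bounded holomorphic $f$ on $B_{X_n}$ whose Taylor coefficients $c_\alpha(f)=\partial^\alpha f(0)/\alpha!$ vanish outside $J$.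 *)

theory Defs
  imports "HOL-Analysis.Analysis"
begin

definition unit_seq :: "nat \<Rightarrow> nat \<Rightarrow> complex" where
  "unit_seq k = (\<lambda>j. if j = k then 1 else 0)"

definition banach_seq_lattice :: "(nat \<Rightarrow> complex) set \<Rightarrow> ((nat \<Rightarrow> complex) \<Rightarrow> real) \<Rightarrow> bool" where
  "banach_seq_lattice X N \<longleftrightarrow>
     (\<lambda>_. 0) \<in> X
   \<and> (\<forall>x\<in>X. \<forall>y\<in>X. (\<lambda>k. x k + y k) \<in> X)
   \<and> (\<forall>x\<in>X. \<forall>c. (\<lambda>k. c * x k) \<in> X)
   \<and> (\<forall>x\<in>X. 0 \<le> N x \<and> (N x = 0 \<longleftrightarrow> x = (\<lambda>_. 0)))
   \<and> (\<forall>x\<in>X. \<forall>c. N (\<lambda>k. c * x k) = cmod c * N x)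
   \<and> (\<forall>x\<in>X. \<forall>y\<in>X. N (\<lambda>k. x k + y k) \<le> N x + N y)
   \<and> (\<forall>u. (\<forall>i. u i \<in> X) \<and> (\<forall>e>0. \<exists>M. \<forall>i\<ge>M. \<forall>j\<ge>M. N (\<lambda>k. u i k - u j k) < e)
          \<longrightarrow> (\<exists>x\<in>X. (\<lambda>i. N (\<lambda>k. u i k - x k)) \<longlonglongrightarrow> 0))
   \<and> (\<forall>x\<in>X. \<forall>y. (\<forall>k. cmod (y k) \<le> cmod (x k)) \<longrightarrow> y \<in> X \<and> N y \<le> N x)
   \<and> (\<forall>k. unit_seq k \<in> X)"

text \<open>Vectors of C^n are represented as sequences vanishing at indices >= n
(coordinates 0,...,n-1).\<close>

definition cvec :: "nat \<Rightarrow> (nat \<Rightarrow> complex) set" where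
  "cvec n = {z. \<forall>k\<ge>n. z k = 0}"

definition Xn_norm :: "((nat \<Rightarrow> complex) \<Rightarrow> real) \<Rightarrow> nat \<Rightarrow> (nat \<Rightarrow> complex) \<Rightarrow> real" where
  "Xn_norm N n z = N (\<lambda>k. if k < n then complex_of_real (cmod (z k)) else 0)"

definition XBall :: "((nat \<Rightarrow> complex) \<Rightarrow> real) \<Rightarrow> nat \<Rightarrow> (nat \<Rightarrow> complex) set" where
  "XBall N n = {z \<in> cvec n. Xn_norm N n z < 1}"

definition multi :: "nat \<Rightarrow> (nat \<Rightarrow> nat) set" where
  "multi n = {\<alpha>. \<forall>k\<ge>n. \<alpha> k = 0}"

definition deg :: "nat \<Rightarrow> (nat \<Rightarrow> nat) \<Rightarrow> nat" where
  "deg n \<alpha> = (\<Sum>k<n. \<alpha> k)"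

definition Lambda :: "nat \<Rightarrow> nat \<Rightarrow> (nat \<Rightarrow> nat) set" where
  "Lambda m n = {\<alpha> \<in> multi n. deg n \<alpha> = m}"

definition flat :: "nat \<Rightarrow> nat \<Rightarrow> (nat \<Rightarrow> nat) set \<Rightarrow> (nat \<Rightarrow> nat) set" where
  "flat n m I = {\<beta> \<in> Lambda (m - 1) n. \<exists>k<n. \<beta>(k := Suc (\<beta> k)) \<in> I}"

definition mono :: "nat \<Rightarrow> (nat \<Rightarrow> nat) \<Rightarrow> (nat \<Rightarrow> complex) \<Rightarrow> complex" where
  "mono n \<alpha> z = (\<Prod>k<n. z k ^ \<alpha> k)"

definition l1n :: "nat \<Rightarrow> (nat \<Rightarrow> complex) \<Rightarrow> real" where
  "l1n n h = (\<Sum>k<n. cmod (h k))"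

text \<open>Complex Frechet differentiability at every point of U (U is an open subset of C^n).\<close>
definition holo_on :: "nat \<Rightarrow> ((nat \<Rightarrow> complex) \<Rightarrow> complex) \<Rightarrow> (nat \<Rightarrow> complex) set \<Rightarrow> bool" where
  "holo_on n f U \<longleftrightarrow> (\<forall>z\<in>U. \<exists>a::nat \<Rightarrow> complex. \<forall>\<epsilon>>0. \<exists>\<delta>>0. \<forall>h\<in>cvec n. l1n n h < \<delta> \<longrightarrow>
       cmod (f (\<lambda>k. z k + h k) - f z - (\<Sum>k<n. a k * h k)) \<le> \<epsilon> * l1n n h)"

definition bounded_fun_on :: "((nat \<Rightarrow> complex) \<Rightarrow> complex) \<Rightarrow> (nat \<Rightarrow> complex) set \<Rightarrow> bool" where
  "bounded_fun_on f U \<longleftrightarrow> (\<exists>M. \<forall>z\<in>U. cmod (f z) \<le> M)"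

definition cpartial :: "nat \<Rightarrow> ((nat \<Rightarrow> complex) \<Rightarrow> complex) \<Rightarrow> ((nat \<Rightarrow> complex) \<Rightarrow> complex)" where
  "cpartial k f = (\<lambda>z. deriv (\<lambda>t. f (z(k := z k + t))) 0)"

fun hder :: "nat \<Rightarrow> (nat \<Rightarrow> nat) \<Rightarrow> ((nat \<Rightarrow> complex) \<Rightarrow> complex) \<Rightarrow> ((nat \<Rightarrow> complex) \<Rightarrow> complex)" where
  "hder 0 \<alpha> f = f"
| "hder (Suc k) \<alpha> f = (cpartial k ^^ \<alpha> k) (hder k \<alpha> f)"

definition taylor_coeff :: "nat \<Rightarrow> ((nat \<Rightarrow> complex) \<Rightarrow> complex) \<Rightarrow> (nat \<Rightarrow> nat) \<Rightarrow> complex" where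
  "taylor_coeff n f \<alpha> = hder n \<alpha> f (\<lambda>_. 0) / of_nat (\<Prod>k<n. fact (\<alpha> k))"

definition bohr_radius :: "((nat \<Rightarrow> complex) \<Rightarrow> real) \<Rightarrow> nat \<Rightarrow> (nat \<Rightarrow> nat) set \<Rightarrow> ereal" where
  "bohr_radius N n J = Sup (ereal ` {r::real. 0 < r \<and> r < 1 \<and>
     (\<forall>f. holo_on n f (XBall N n) \<and> bounded_fun_on f (XBall N n)
          \<and> (\<forall>\<alpha>\<in>multi n - J. taylor_coeff n f \<alpha> = 0) \<longrightarrow>
        (SUP z\<in>(\<lambda>w k. complex_of_real r * w k) ` XBall N n.
            (\<Sum>\<^sub>\<infinity>\<alpha>\<in>J. ennreal (cmod (taylor_coeff n f \<alpha> * mono n \<alpha> z))))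
        \<le> ennreal (SUP z\<in>XBall N n. cmod (f z)))})"

definition poly_eval :: "nat \<Rightarrow> (nat \<Rightarrow> nat) set \<Rightarrow> ((nat \<Rightarrow> nat) \<Rightarrow> complex) \<Rightarrow> (nat \<Rightarrow> complex) \<Rightarrow> complex" where
  "poly_eval n I c z = (\<Sum>\<alpha>\<in>I. c \<alpha> * mono n \<alpha> z)"

definition polynorm :: "((nat \<Rightarrow> complex) \<Rightarrow> real) \<Rightarrow> nat \<Rightarrow> (nat \<Rightarrow> nat) set \<Rightarrow> ((nat \<Rightarrow> nat) \<Rightarrow> complex) \<Rightarrow> real" where
  "polynorm N n I c = (SUP z\<in>XBall N n. cmod (poly_eval n I c z))"

text \<open>Operator norm of Q_{I',I} : P_{I'}(X_n) -> P_I(X_n) (for I a subset of I').\<close>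
definition Qnorm :: "((nat \<Rightarrow> complex) \<Rightarrow> real) \<Rightarrow> nat \<Rightarrow> (nat \<Rightarrow> nat) set \<Rightarrow> (nat \<Rightarrow> nat) set \<Rightarrow> real" where
  "Qnorm N n I' I = Sup {polynorm N n I c | c. polynorm N n I' c \<le> 1}"

text \<open>ell_infinity(S), realised as bounded functions vanishing off S, with the sup norm.\<close>
definition linf :: "'a set \<Rightarrow> ('a \<Rightarrow> complex) set" where
  "linf S = {g. (\<forall>z. z \<notin> S \<longrightarrow> g z = 0) \<and> (\<exists>M. \<forall>z\<in>S. cmod (g z) \<le> M)}"

definition supn :: "'a set \<Rightarrow> ('a \<Rightarrow> complex) \<Rightarrow> real" where
  "supn S g = (SUP z\<in>S. cmod (g z))"

definition proj_const :: "'a set \<Rightarrow> ('a \<Rightarrow> complex) set \<Rightarrow> real" where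
  "proj_const S Y = Inf {Sup {supn S (P g) | g. g \<in> linf S \<and> supn S g \<le> 1} | P.
       (\<forall>g\<in>linf S. P g \<in> Y)
     \<and> (\<forall>g\<in>linf S. \<forall>h\<in>linf S. \<forall>a b. P (\<lambda>z. a * g z + b * h z) = (\<lambda>z. a * P g z + b * P h z))
     \<and> (\<forall>y\<in>Y. P y = y)
     \<and> (\<exists>C. \<forall>g\<in>linf S. supn S (P g) \<le> C * supn S g)}"

text \<open>P_I(X_n), isometrically embedded in ell_infinity(B_{X_n}) by restriction to the ball.\<close>
definition polyspace :: "((nat \<Rightarrow> complex) \<Rightarrow> real) \<Rightarrow> nat \<Rightarrow> (nat \<Rightarrow> nat) set \<Rightarrow> ((nat \<Rightarrow> complex) \<Rightarrow> complex) set" where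
  "polyspace N n I = {(\<lambda>z. if z \<in> XBall N n then poly_eval n I c z else 0) | c. True}"

definition poly_proj_const :: "((nat \<Rightarrow> complex) \<Rightarrow> real) \<Rightarrow> nat \<Rightarrow> (nat \<Rightarrow> nat) set \<Rightarrow> real" where
  "poly_proj_const N n I = proj_const (XBall N n) (polyspace N n I)"

definition bohr_lower_bound :: "((nat \<Rightarrow> complex) \<Rightarrow> real) \<Rightarrow> nat \<Rightarrow> (nat \<Rightarrow> nat) set \<Rightarrow> real" where
  "bohr_lower_bound N n J = 1/6 * Inf ((\<lambda>m::nat.
      (1 / (exp 1 * Qnorm N n (Lambda m n) (J \<inter> Lambda m n)) powr (1 / real m))
    * (1 / poly_proj_const N n (flat n m (J \<inter> Lambda m n)) powr (1 / real m)))
    ` {m. 1 \<le> m \<and> J \<inter> Lambda m n \<noteq> {}})"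

end

theory Submission
  imports Defs "HOL-Complex_Analysis.Complex_Analysis" "HOL-Computational_Algebra.Fundamental_Theorem_Algebra"
begin

text \<open>
  Write \<open>\<chi>\<^sub>m\<close> for the unconditional constant of the monomials in \<open>P\<^sub>J\<^sub>(\<^sub>m\<^sub>)(X\<^sub>n)\<close>. Bohr's argument applied to
  the slices \<open>s \<mapsto> f(s w)\<close> shows that every \<open>r\<close> with \<open>(3 r)\<^sup>m \<chi>\<^sub>m \<le> 1\<close> for all \<open>m\<close> is admissible, so it suffices
  that \<open>\<chi>\<^sub>m \<le> e 2\<^sup>m \<parallel>Q\<parallel> \<lambda>\<close>. The map \<open>p \<mapsto> (\<partial>\<^sub>k p / m)\<^sub>k\<close> embeds \<open>P\<^sub>I(X\<^sub>n)\<close> into the lattice of bounded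
  functions from the ball to the dual of \<open>X\<^sub>n\<close>, with norm at most \<open>e\<close> by Cauchy's inequality; a projection
  onto \<open>P\<^sub>I\<^sub>\<flat>(X\<^sub>n)\<close> in each coordinate, multiplication by \<open>z\<^sub>k\<close>, summation over \<open>k\<close> and \<open>Q\<close> give a left inverse of norm at
  most \<open>\<parallel>Q\<parallel> \<lambda>\<close>. In a lattice the diagonal of an operator is controlled by averages over rotations of the
  torus through \<open>\<parallel>f\<parallel>\<^sub>2 \<le> 2\<^sup>m\<^sup>/\<^sup>2 \<parallel>f\<parallel>\<^sub>1\<close> for \<open>m\<close>-homogeneous \<open>f\<close>, used twice. That inequality comes from Carleman's
  \<open>\<Sum>|a\<^sub>k|\<^sup>2/(k+1) \<le> \<parallel>f\<parallel>\<^sub>1\<^sup>2\<close> in one variable. All torus integrals are replaced by averages over roots of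
  unity, at the cost of a factor arbitrarily close to 1.
\<close>

section \<open>Carleman's inequality over roots of unity\<close>

text \<open>A projection on \<open>linf\<close> of the ball is merely a bounded linear map and need
  not be given by an integral, so it can be moved past finite sums only. This shapes the proof:
  functions on the ball are replaced by step functions with finitely many cells, and integrals by
  averages, until every interchange concerns finite sums. The number of roots of unity is then fixed
  while the coefficients stay arbitrary, so Carleman's inequality is needed uniformly over all
  polynomials of a given degree. Its weight \<open>1/(k+1)\<close> is what Cauchy-Schwarz costs at
  the coefficient of order \<open>k\<close> of a square; zero-free functions are squares, and
  Blaschke factors reduce everything to that case. The weights multiply over the variables, and
  \<open>k + 1 \<le> 2 ^ k\<close> turns their product into \<open>2 ^ m\<close>, without dependence
  on \<open>n\<close>. The left inverse has the norm of a single projection and not \<open>n\<close>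
  times it, because the projection acts on the scalar function
  \<open>w \<mapsto> \<Sum>k<n. u k * G k w\<close> with \<open>u\<close> frozen, and only
  afterwards is \<open>u\<close> taken as the point of evaluation.\<close>

definition unit_roots :: "nat \<Rightarrow> complex set" where
  "unit_roots M = {w. w ^ M = 1}"

lemma finite_unit_roots [simp]: "M > 0 \<Longrightarrow> finite (unit_roots M)"
  unfolding unit_roots_def by (rule finite_roots_unity) auto

lemma card_unit_roots [simp]: "M > 0 \<Longrightarrow> card (unit_roots M) = M"
  unfolding unit_roots_def by (rule card_roots_unity_eq)

lemma norm_unit_roots: "M > 0 \<Longrightarrow> w \<in> unit_roots M \<Longrightarrow> cmod w = 1"
  unfolding unit_roots_def using power_eq_1_iff[of w M] by auto

lemma sum_unit_roots:
  assumes "M > 0"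
  shows "sum F (unit_roots M) = (\<Sum>j<M. F (cis (2 * pi * real j / real M)))"
  unfolding unit_roots_def
  using Complex.bij_betw_roots_unity[OF assms] by (rule sum.reindex_bij_betw[symmetric])

text \<open>Multiplication by a primitive root permutes \<open>unit_roots M\<close> and multiplies
  the sum by a number other than 1.\<close>

lemma unit_roots_power_sum:
  assumes M: "M > 0" and j: "\<not> M dvd j"
  shows "(\<Sum>w\<in>unit_roots M. w ^ j) = 0"
proof -
  define z where "z = cis (2 * pi * real 1 / real M)"
  have zM: "z \<in> unit_roots M"
    using M unfolding z_def unit_roots_def
    by (simp add: Complex.DeMoivre)
  have z1: "z ^ j \<noteq> 1"
  proof
    assume "z ^ j = 1"
    then have "cis (2 * pi * real j / real M) = 1" by (simp add: z_def Complex.DeMoivre mult_ac)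
    then have "cos (2 * pi * real j / real M) = 1" by (metis cis.sel(1) one_complex.sel(1))
    then obtain i :: int where "2 * pi * real j / real M = of_int i * 2 * pi"
      by (auto simp: cos_one_2pi_int)
    then have "real j = of_int i * real M" using M by (simp add: field_simps)
    then have "int j = i * int M" by (metis of_int_eq_iff of_int_mult of_int_of_nat_eq)
    then have "int M dvd int j" by simp
    then show False using j by simp
  qed
  have "bij_betw ((*) z) (unit_roots M) (unit_roots M)"
  proof (rule bij_betwI[where g = "(*) (inverse z)"])
    show "(*) z \<in> unit_roots M \<rightarrow> unit_roots M" "(*) (inverse z) \<in> unit_roots M \<rightarrow> unit_roots M"
      using zM by (auto simp: unit_roots_def power_mult_distrib power_inverse)
  qed (use norm_unit_roots[OF M zM] in \<open>auto simp: field_simps\<close>)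
  then have "(\<Sum>w\<in>unit_roots M. w ^ j) = (\<Sum>w\<in>unit_roots M. (z * w) ^ j)"
    by (rule sum.reindex_bij_betw[symmetric])
  also have "\<dots> = z ^ j * (\<Sum>w\<in>unit_roots M. w ^ j)"
    by (simp add: power_mult_distrib sum_distrib_left)
  finally show ?thesis using z1 by simp
qed

lemma unit_roots_orthogonal:
  assumes "i < M" "j < M"
  shows "(\<Sum>w\<in>unit_roots M. w ^ i * cnj w ^ j) = (if i = j then of_nat M else 0)"
proof -
  have M: "M > 0" using assms by simp
  \<comment> \<open>Conjugates become positive powers; the product is
    \<open>w ^ (i + (M - 1) * j)\<close>, with exponent congruent to \<open>i - j\<close> modulo
    \<open>M\<close>.\<close>
  have cn: "cnj w = w ^ (M - 1)" if "w \<in> unit_roots M" for w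
  proof -
    have n: "w * cnj w = 1" using norm_unit_roots[OF M that] complex_norm_square[of w] by simp
    have "w * w ^ (M - 1) = 1" using that M by (simp add: unit_roots_def flip: power_Suc)
    with n have "w * cnj w = w * w ^ (M - 1)" "w \<noteq> 0" by auto
    then show ?thesis by (simp only: mult_cancel_left) simp
  qed
  have "(\<Sum>w\<in>unit_roots M. w ^ i * cnj w ^ j) = (\<Sum>w\<in>unit_roots M. w ^ (i + (M - 1) * j))"
    by (intro sum.cong refl) (simp add: cn power_add power_mult)
  also have "\<dots> = (if i = j then of_nat M else 0)"
  proof (cases "i = j")
    case True
    then have e: "i + (M - 1) * j = M * i" using M by (cases M) auto
    have "w ^ (M * i) = 1" if "w \<in> unit_roots M" for w
      using that by (simp add: unit_roots_def power_mult)
    then show ?thesis using True M unfolding e by simp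
  next
    case False
    have "\<not> M dvd i + (M - 1) * j"
    proof
      assume "M dvd i + (M - 1) * j"
      then have "int M dvd int i + (int M - 1) * int j"
        using M by (simp add: of_nat_diff flip: int_dvd_int_iff)
      then have "int M dvd (int i + (int M - 1) * int j) - int M * int j"
        by (rule dvd_diff) simp
      then have "int M dvd int i - int j" by (simp add: algebra_simps)
      moreover have "\<bar>int i - int j\<bar> < int M" using assms by simp
      ultimately have "int i - int j = 0" using zdvd_imp_le[of "int M" "\<bar>int i - int j\<bar>"] by force
      then show False using False by simp
    qed
    then show ?thesis using False unit_roots_power_sum[OF M] by simp
  qed
  finally show ?thesis .
qed

text \<open>Discrete Fourier inversion; \<open>K < M\<close> keeps distinct exponents distinct
  modulo \<open>M\<close>.\<close>

lemma unit_roots_coeff: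
  assumes "k \<le> K" "K < M"
  shows "(\<Sum>w\<in>unit_roots M. cnj w ^ k * (\<Sum>i\<le>K. a i * w ^ i)) = of_nat M * a k"
proof -
  have "(\<Sum>w\<in>unit_roots M. cnj w ^ k * (\<Sum>i\<le>K. a i * w ^ i))
      = (\<Sum>i\<le>K. a i * (\<Sum>w\<in>unit_roots M. w ^ i * cnj w ^ k))"
    by (simp only: sum_distrib_left, subst sum.swap) (simp only: mult_ac)
  also have "\<dots> = (\<Sum>i\<le>K. a i * (if i = k then of_nat M else 0))"
    using assms by (intro sum.cong refl arg_cong2[where f="(*)"] unit_roots_orthogonal) auto
  also have "\<dots> = of_nat M * a k" using assms by (simp add: if_distrib sum.delta cong: if_cong)
  finally show ?thesis .
qed

lemma unit_roots_parseval:
  assumes "K < M"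
  shows "(\<Sum>w\<in>unit_roots M. (cmod (\<Sum>i\<le>K. a i * w ^ i))\<^sup>2) = real M * (\<Sum>i\<le>K. (cmod (a i))\<^sup>2)"
proof -
  have "of_real (\<Sum>w\<in>unit_roots M. (cmod (\<Sum>i\<le>K. a i * w ^ i))\<^sup>2)
     = (\<Sum>w\<in>unit_roots M. cnj (\<Sum>k\<le>K. a k * w ^ k) * (\<Sum>i\<le>K. a i * w ^ i))"
    by (simp only: of_real_sum complex_norm_square mult.commute)
  also have "\<dots> = (\<Sum>w\<in>unit_roots M. \<Sum>k\<le>K. cnj (a k) * (cnj w ^ k * (\<Sum>i\<le>K. a i * w ^ i)))"
    by (simp only: cnj_sum complex_cnj_mult complex_cnj_power sum_distrib_right mult.assoc)
  also have "\<dots> = (\<Sum>k\<le>K. cnj (a k) * (\<Sum>w\<in>unit_roots M. cnj w ^ k * (\<Sum>i\<le>K. a i * w ^ i)))"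
    by (subst sum.swap) (simp only: sum_distrib_left)
  also have "\<dots> = (\<Sum>k\<le>K. cnj (a k) * (of_nat M * a k))"
    using assms by (intro sum.cong refl arg_cong2[where f="(*)"] unit_roots_coeff) auto
  also have "\<dots> = of_real (real M * (\<Sum>i\<le>K. (cmod (a i))\<^sup>2))"
    by (simp add: of_real_sum complex_norm_square sum_distrib_left mult_ac flip: of_real_power)
  finally show ?thesis by (simp only: of_real_eq_iff)
qed

text \<open>Cauchy's coefficient estimate on the unit circle, sampled at only \<open>M\<close>
  points.\<close>

lemma unit_roots_coeff_le:
  assumes "k \<le> K" "K < M" and le: "\<And>w. w \<in> unit_roots M \<Longrightarrow> cmod (\<Sum>i\<le>K. a i * w ^ i) \<le> e"
  shows "cmod (a k) \<le> e"
proof -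
  have M: "M > 0" using assms by simp
  have "real M * cmod (a k) = cmod (\<Sum>w\<in>unit_roots M. cnj w ^ k * (\<Sum>i\<le>K. a i * w ^ i))"
    by (simp add: unit_roots_coeff[OF assms(1,2)] norm_mult)
  also have "\<dots> \<le> (\<Sum>w\<in>unit_roots M. e)"
    by (intro sum_norm_le) (use le in \<open>simp add: norm_mult norm_power norm_unit_roots[OF M]\<close>)
  also have "\<dots> = real M * e" using M by simp
  finally show ?thesis using M by simp
qed

text \<open>The weights \<open>1/(k+1)\<close> are those of the Bergman norm on the disc.\<close>

definition bergman :: "nat \<Rightarrow> (nat \<Rightarrow> complex) \<Rightarrow> real" where
  "bergman N a = L2_set (\<lambda>k. cmod (a k) / sqrt (real k + 1)) {..N}"

lemma bergman_nonneg [simp]: "0 \<le> bergman N a"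
  by (simp add: bergman_def)

lemma bergman_triangle: "bergman N (\<lambda>k. a k + b k) \<le> bergman N a + bergman N b"
proof -
  have "bergman N (\<lambda>k. a k + b k)
      \<le> L2_set (\<lambda>k. cmod (a k) / sqrt (real k + 1) + cmod (b k) / sqrt (real k + 1)) {..N}"
    unfolding bergman_def
    by (rule L2_set_mono) (auto simp: norm_triangle_ineq divide_right_mono simp flip: add_divide_distrib)
  also have "\<dots> \<le> bergman N a + bergman N b"
    unfolding bergman_def by (rule L2_set_triangle_ineq)
  finally show ?thesis .
qed

lemma bergman_le:
  assumes "\<And>k. k \<le> N \<Longrightarrow> cmod (a k) \<le> e"
  shows "bergman N a \<le> (real N + 1) * e"
proof -
  have "bergman N a \<le> (\<Sum>k\<le>N. cmod (a k) / sqrt (real k + 1))"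
    unfolding bergman_def by (rule L2_set_le_sum) auto
  also have "\<dots> \<le> (\<Sum>k\<le>N. e)"
  proof (rule sum_mono)
    fix k assume "k \<in> {..N}"
    then have "cmod (a k) \<le> e" using assms by simp
    moreover have "cmod (a k) / sqrt (real k + 1) \<le> cmod (a k) / 1"
      by (rule divide_left_mono) auto
    ultimately show "cmod (a k) / sqrt (real k + 1) \<le> e" by simp
  qed
  finally show ?thesis by (simp add: algebra_simps)
qed

text \<open>A crude equivalence of norms at fixed \<open>N\<close>. It lets
  \<open>carleman_discrete\<close> bound the oscillation of a polynomial by its own Bergman
  norm.\<close>

lemma bergman_ge:
  assumes "k \<le> N"
  shows "cmod (a k) \<le> (real N + 1) * bergman N a"
proof -
  have "cmod (a k) / sqrt (real k + 1) \<le> bergman N a"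
    unfolding bergman_def using assms
    by (intro member_le_L2_set[where f = "\<lambda>k. cmod (a k) / sqrt (real k + 1)", simplified]) auto
  then have "cmod (a k) \<le> sqrt (real k + 1) * bergman N a" by (simp add: field_simps)
  also have "\<dots> \<le> (real N + 1) * bergman N a"
  proof (rule mult_right_mono)
    have "sqrt (real k + 1) \<le> sqrt ((real k + 1)\<^sup>2)"
      by (rule real_sqrt_le_mono) (simp add: power2_eq_square)
    also have "\<dots> \<le> real N + 1" using assms by simp
    finally show "sqrt (real k + 1) \<le> real N + 1" .
  qed simp
  finally show ?thesis .
qed

lemma bergman_square: "(bergman N a)\<^sup>2 = (\<Sum>k\<le>N. (cmod (a k))\<^sup>2 / (real k + 1))"
  unfolding bergman_def L2_set_def
  by (simp add: sum_nonneg power_divide)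

text \<open>Moving a zero out of the disc by the Blaschke factor does not change the modulus on the
  circle and increases the Bergman norm.\<close>

lemma bergman_reflect:
  fixes h :: "complex poly"
  assumes "cmod z < 1"
  shows "bergman N (coeff ([:-z, 1:] * h)) \<le> bergman N (coeff ([:1, -cnj z:] * h))"
proof -
  \<comment> \<open>\<open>x\<close> lists the coefficients of \<open>h\<close> times the variable,
    that is, those of \<open>h\<close> shifted by one.\<close>
  define x where "x k = (case k of 0 \<Rightarrow> 0 | Suc i \<Rightarrow> coeff h i)" for k
  have c1: "coeff ([:-z, 1:] * h) k = x k - z * coeff h k" for k
    by (cases k) (auto simp: x_def)
  have c2: "coeff ([:1, -cnj z:] * h) k = coeff h k - cnj z * x k" for k
    by (cases k) (auto simp: x_def)
  \<comment> \<open>The cross terms of the two squares coincide, so only \<open>x\<close> and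
    \<open>coeff h\<close> remain to be compared; the shift moves each coefficient to a smaller
    weight.\<close>
  have id: "(cmod (u - z * v))\<^sup>2 - (cmod (v - cnj z * u))\<^sup>2 = (1 - (cmod z)\<^sup>2) * ((cmod u)\<^sup>2 - (cmod v)\<^sup>2)"
    for u v
    unfolding cmod_power2 by (simp add: power2_eq_square algebra_simps)
  have x_Suc: "(\<Sum>k\<le>N. (cmod (x k))\<^sup>2 / (real k + 1)) = (\<Sum>k<N. (cmod (coeff h k))\<^sup>2 / (real k + 2))"
  proof -
    have "(\<Sum>k\<le>N. (cmod (x k))\<^sup>2 / (real k + 1)) = (\<Sum>k<N. (cmod (x (Suc k)))\<^sup>2 / (real (Suc k) + 1))"
      by (subst sum.atMost_shift) (simp add: x_def)
    then show ?thesis by (simp add: x_def add_ac)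
  qed
  have "(\<Sum>k\<le>N. (cmod (x k))\<^sup>2 / (real k + 1)) \<le> (\<Sum>k<N. (cmod (coeff h k))\<^sup>2 / (real k + 1))"
    unfolding x_Suc by (intro sum_mono divide_left_mono) auto
  also have "\<dots> \<le> (\<Sum>k\<le>N. (cmod (coeff h k))\<^sup>2 / (real k + 1))"
    by (rule sum_mono2) auto
  finally have le: "(\<Sum>k\<le>N. (cmod (x k))\<^sup>2 / (real k + 1)) - (\<Sum>k\<le>N. (cmod (coeff h k))\<^sup>2 / (real k + 1)) \<le> 0"
    by simp
  have "(bergman N (coeff ([:-z, 1:] * h)))\<^sup>2 - (bergman N (coeff ([:1, -cnj z:] * h)))\<^sup>2
     = (\<Sum>k\<le>N. ((cmod (x k - z * coeff h k))\<^sup>2 - (cmod (coeff h k - cnj z * x k))\<^sup>2) / (real k + 1))"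
    unfolding bergman_square c1 c2 by (simp add: diff_divide_distrib sum_subtractf)
  also have "\<dots> = (1 - (cmod z)\<^sup>2) * ((\<Sum>k\<le>N. (cmod (x k))\<^sup>2 / (real k + 1)) - (\<Sum>k\<le>N. (cmod (coeff h k))\<^sup>2 / (real k + 1)))"
    unfolding id by (simp add: diff_divide_distrib sum_subtractf sum_distrib_left right_diff_distrib)
  also have "\<dots> \<le> 0"
    using le assms by (intro mult_nonneg_nonpos) (auto simp: power_le_one)
  finally have "(bergman N (coeff ([:-z, 1:] * h)))\<^sup>2 \<le> (bergman N (coeff ([:1, -cnj z:] * h)))\<^sup>2"
    by (simp only: diff_le_0_iff_le)
  then show ?thesis by (rule power2_le_imp_le) (rule bergman_nonneg)
qed

text \<open>\<open>h\<close> holds the factors still to be treated and \<open>k\<close> those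
  already free of zeros in the disc. Each root of \<open>h\<close> is handed over to
  \<open>k\<close>, unchanged if it lies outside the open disc and reflected by
  \<open>bergman_reflect\<close> otherwise. The resulting \<open>q\<close> bounds the Bergman norm
  at the same modulus on the circle and admits square roots.\<close>

lemma zero_free_majorant:
  fixes h k :: "complex poly"
  assumes "h \<noteq> 0" and "\<forall>z. cmod z < 1 \<longrightarrow> poly k z \<noteq> 0"
  shows "\<exists>q. (\<forall>z. cmod z < 1 \<longrightarrow> poly q z \<noteq> 0) \<and> (\<forall>w. cmod w = 1 \<longrightarrow> cmod (poly q w) = cmod (poly (h * k) w))
      \<and> bergman N (coeff (h * k)) \<le> bergman N (coeff q)"
  using assms
proof (induction "degree h" arbitrary: h k)
  case 0
  then obtain c where h: "h = [:c:]" "c \<noteq> 0" by (metis degree_eq_zeroE pCons_eq_0_iff)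
  show ?case by (rule exI[of _ "h * k"]) (use 0 h in auto)
next
  case (Suc d)
  then have "\<not> (\<exists>a l. a \<noteq> 0 \<and> l = 0 \<and> h = pCons a l)" by auto
  then obtain z where "poly h z = 0" using fundamental_theorem_of_algebra_alt by blast
  then obtain h' where h': "h = [:-z, 1:] * h'" by (metis dvdE poly_eq_0_iff_dvd)
  have nz: "h' \<noteq> 0" using h' Suc by auto
  have d: "d = degree h'" using h' nz Suc.hyps(2) degree_mult_eq[of "[:-z,1:]" h'] by simp
  show ?case
  proof (cases "cmod z < 1")
    case False
    then have "\<forall>v. cmod v < 1 \<longrightarrow> poly ([:-z, 1:] * k) v \<noteq> 0" using Suc.prems by auto
    from Suc.hyps(1)[OF d nz this] show ?thesis unfolding h' by (simp only: mult_ac)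
  next
    case True
    have "1 - cnj z * v \<noteq> 0" if "cmod v < 1" for v
    proof
      assume "1 - cnj z * v = 0"
      then have "1 = cmod z * cmod v"
        by (metis complex_mod_cnj norm_mult norm_one right_minus_eq)
      moreover have "cmod z * cmod v < 1 * 1"
        using True that by (intro mult_strict_mono') auto
      ultimately show False by simp
    qed
    then have "\<forall>v. cmod v < 1 \<longrightarrow> poly ([:1, -cnj z:] * k) v \<noteq> 0" using Suc.prems by (auto simp: mult.commute)
    from Suc.hyps(1)[OF d nz this] obtain q where q: "\<forall>z. cmod z < 1 \<longrightarrow> poly q z \<noteq> 0"
      "\<forall>w. cmod w = 1 \<longrightarrow> cmod (poly q w) = cmod (poly (h' * ([:1, -cnj z:] * k)) w)"
      "bergman N (coeff (h' * ([:1, -cnj z:] * k))) \<le> bergman N (coeff q)" by blast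
    have mod: "cmod (1 - cnj z * w) = cmod (w - z)" if "cmod w = 1" for w
    proof -
      have "cmod (w - z) = cmod (cnj w) * cmod (w - z)" using that by simp
      also have "\<dots> = cmod (cnj w * w - cnj w * z)" by (simp only: norm_mult right_diff_distrib[symmetric])
      also have "cnj w * w = 1" using that complex_norm_square[of w] by (simp add: mult.commute)
      also have "cmod (1 - cnj w * z) = cmod (cnj (1 - cnj w * z))" by (simp only: complex_mod_cnj)
      finally show ?thesis by (simp add: mult.commute)
    qed
    have m: "\<forall>w. cmod w = 1 \<longrightarrow> cmod (poly q w) = cmod (poly (h * k) w)"
    proof (intro allI impI)
      fix w assume w: "cmod w = 1"
      have "cmod (poly q w) = cmod (poly h' w) * (cmod (1 - cnj z * w) * cmod (poly k w))"
        using q(2) w unfolding poly_mult norm_mult by (simp add: mult.commute)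
      also have "cmod (1 - cnj z * w) = cmod (w - z)" using mod w by simp
      finally show "cmod (poly q w) = cmod (poly (h * k) w)"
        unfolding h' poly_mult norm_mult by simp
    qed
    have "bergman N (coeff (h * k)) \<le> bergman N (coeff q)"
      using q(3) bergman_reflect[OF True, of N "h' * k"] unfolding h'
      by (metis (no_types, opaque_lifting) mult.assoc mult.left_commute order.trans)
    with q(1) m show ?thesis by blast
  qed
qed

text \<open>Carleman's inequality for a square: its coefficient of order \<open>k\<close> is a sum
  of \<open>k + 1\<close> products, so Cauchy-Schwarz costs the factor \<open>k + 1\<close>, which
  the weight cancels exactly. What is left is part of the expanded square of
  \<open>\<Sum>i\<le>N. (cmod (g i))\<^sup>2\<close>.\<close>

lemma bergman_square_le:
  "bergman N (\<lambda>k. \<Sum>i\<le>k. g i * g (k - i)) \<le> (\<Sum>i\<le>N. (cmod (g i))\<^sup>2)"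
proof -
  define y where "y i = (cmod (g i))\<^sup>2" for i
  have 1: "(cmod (\<Sum>i\<le>k. g i * g (k - i)))\<^sup>2 / (real k + 1) \<le> (\<Sum>i\<le>k. y i * y (k - i))" for k
  proof -
    have "(cmod (\<Sum>i\<le>k. g i * g (k - i)))\<^sup>2 \<le> (\<Sum>i\<le>k. 1 * cmod (g i * g (k - i)))\<^sup>2"
      by (intro power_mono) (auto intro: norm_sum)
    also have "\<dots> \<le> (\<Sum>i\<le>k. 1\<^sup>2) * (\<Sum>i\<le>k. (cmod (g i * g (k - i)))\<^sup>2)"
      by (rule Cauchy_Schwarz_ineq_sum)
    also have "\<dots> = (real k + 1) * (\<Sum>i\<le>k. y i * y (k - i))"
      by (simp add: y_def norm_mult power_mult_distrib add.commute)
    finally show ?thesis by (simp add: field_simps)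
  qed
  have "(bergman N (\<lambda>k. \<Sum>i\<le>k. g i * g (k - i)))\<^sup>2 \<le> (\<Sum>k\<le>N. \<Sum>i\<le>k. y i * y (k - i))"
    unfolding bergman_square by (intro sum_mono 1)
  also have "\<dots> = (\<Sum>(i, j)\<in>{(i, j). i + j \<le> N}. y i * y j)"
    by (rule sum.triangle_reindex_eq[symmetric])
  also have "\<dots> \<le> (\<Sum>(i, j)\<in>{..N} \<times> {..N}. y i * y j)"
    by (rule sum_mono2) (auto simp: y_def)
  also have "\<dots> = (\<Sum>i\<le>N. y i)\<^sup>2"
    by (simp add: sum.cartesian_product[symmetric] sum_product power2_eq_square)
  finally have "(bergman N (\<lambda>k. \<Sum>i\<le>k. g i * g (k - i)))\<^sup>2 \<le> (\<Sum>i\<le>N. y i)\<^sup>2" .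
  then show ?thesis unfolding y_def by (rule power2_le_imp_le) (auto intro: sum_nonneg)
qed

text \<open>Zeros on the circle itself are possible, so \<open>q\<close> is first dilated:
  \<open>poly q (of_real r * z)\<close> has no zero on a disc of radius \<open>1 / r > 1\<close>,
  hence a holomorphic square root there, and Taylor sums of that root are uniformly close on the
  closed unit disc.\<close>

lemma zero_free_approx_square:
  fixes q :: "complex poly"
  assumes nz: "\<And>z. cmod z < 1 \<Longrightarrow> poly q z \<noteq> 0" and e: "e > 0"
  obtains p :: "complex poly" where "\<And>w. cmod w = 1 \<Longrightarrow> cmod (poly q w - (poly p w)\<^sup>2) \<le> e"
proof -
  have "uniformly_continuous_on (cball 0 1) (poly q)"
    by (intro compact_uniformly_continuous continuous_intros) auto
  then obtain d where d: "d > 0" "\<And>x y. x \<in> cball 0 1 \<Longrightarrow> y \<in> cball 0 1 \<Longrightarrow> dist y x < d \<Longrightarrow> dist (poly q y) (poly q x) < e / 2"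
    using e unfolding uniformly_continuous_on_def by (meson half_gt_zero)
  \<comment> \<open>\<open>1 - r < d\<close> keeps the dilated polynomial within
    \<open>e / 2\<close> of \<open>q\<close> on the circle; the value \<open>1/2\<close> only keeps
    \<open>r\<close> positive.\<close>
  define r where "r = max (1/2) (1 - d / 2)"
  have r: "0 < r" "r < 1" "1 - r < d" using d(1) by (auto simp: r_def)
  have rq: "cmod (poly q w - poly q (of_real r * w)) \<le> e / 2" if "cmod w = 1" for w :: complex
  proof -
    have "dist w (of_real r * w) = cmod ((1 - of_real r) * w)" by (simp add: dist_norm algebra_simps)
    also have "\<dots> = cmod (of_real (1 - r))" using that by (simp add: norm_mult)
    also have "\<dots> = \<bar>1 - r\<bar>" by (rule norm_of_real)
    finally have "dist w (of_real r * w) < d" using r by simp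
    then have "dist (poly q w) (poly q (of_real r * w)) < e / 2"
      using that r by (intro d(2)) (auto simp: norm_mult)
    then show ?thesis by (simp add: dist_norm)
  qed
  have "poly q (of_real r * z) \<noteq> 0" if "z \<in> ball 0 (1 / r)" for z
    using that r by (intro nz) (auto simp: norm_mult field_simps)
  moreover have "(\<lambda>z. poly q (of_real r * z)) holomorphic_on ball 0 (1 / r)"
    by (intro holomorphic_intros)
  ultimately obtain g where g: "g holomorphic_on ball 0 (1 / r)" "\<And>z. z \<in> ball 0 (1 / r) \<Longrightarrow> poly q (of_real r * z) = g z ^ 2"
    using contractible_imp_holomorphic_sqrt[of "\<lambda>z. poly q (of_real r * z)" "ball 0 (1 / r)"]
    by (metis convex_ball convex_imp_contractible)
  define a where "a n = (deriv ^^ n) g 0 / fact n" for n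
  have sums: "(\<lambda>n. a n * w ^ n) sums g w" if "w \<in> ball 0 (1 / r)" for w
    using holomorphic_power_series[OF g(1) that] by (simp add: a_def)
  \<comment> \<open>A radius strictly between 1 and \<open>1 / r\<close>: convergence at
    \<open>R\<close> gives uniform convergence on the closed unit disc.\<close>
  define R where "R = (1 + 1 / r) / 2"
  have R: "1 < R" "R < 1 / r" using r by (auto simp: R_def field_simps)
  have "summable (\<lambda>n. a n * of_real R ^ n)"
    using sums[of "of_real R"] R by (auto simp: sums_iff)
  then have "uniform_limit (cball 0 1) (\<lambda>n x. \<Sum>i<n. a i * (x - 0) ^ i) (\<lambda>x. suminf (\<lambda>i. a i * (x - 0) ^ i)) sequentially"
    using R by (intro powser_uniform_limit less_le_trans[OF _ conv_radius_geI]) auto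
  moreover have "suminf (\<lambda>i. a i * x ^ i) = g x" if "x \<in> cball 0 1" for x
    using sums[of x] that R by (auto simp: sums_iff)
  ultimately have ul: "uniform_limit (cball 0 1) (\<lambda>n x. \<Sum>i<n. a i * x ^ i) g sequentially"
    by (subst uniform_limit_cong'[where g = "\<lambda>n x. \<Sum>i<n. a i * (x - 0) ^ i" and i = "\<lambda>x. suminf (\<lambda>i. a i * (x - 0) ^ i)"]) auto
  have "bounded (g ` cball 0 1)"
    using g(1) R by (intro compact_imp_bounded compact_continuous_image holomorphic_on_imp_continuous_on)
      (auto intro: holomorphic_on_subset)
  then obtain B where B: "B > 0" "\<And>x. x \<in> cball 0 1 \<Longrightarrow> cmod (g x) \<le> B"
    unfolding bounded_pos by auto
  \<comment> \<open>The difference of the squares factors into \<open>g w - poly p w\<close> and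
    \<open>g w + poly p w\<close>; the latter is at most \<open>2 * B + 1\<close> as soon as
    \<open>e' \<le> 1\<close>.\<close>
  define e' where "e' = min 1 (e / (2 * (2 * B + 1)))"
  have e': "e' > 0" "e' \<le> 1" using e B(1) by (auto simp: e'_def)
  have "e' * (2 * B + 1) \<le> e / (2 * (2 * B + 1)) * (2 * B + 1)"
    unfolding e'_def using B(1) by (intro mult_right_mono) auto
  also have "\<dots> = e / 2" using B(1) by (simp add: field_simps)
  finally have e'2: "e' * (2 * B + 1) \<le> e / 2" .
  obtain K where K: "\<And>x. x \<in> cball 0 1 \<Longrightarrow> dist (\<Sum>i<K. a i * x ^ i) (g x) < e'"
    using uniform_limitD[OF ul e'(1)] unfolding eventually_sequentially by blast
  define p where "p = (\<Sum>i<K. monom (a i) i)"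
  have p: "poly p w = (\<Sum>i<K. a i * w ^ i)" for w
    by (simp add: p_def poly_sum poly_monom)
  show thesis
  proof
    fix w :: complex assume w: "cmod w = 1"
    have pg: "cmod (g w - poly p w) \<le> e'" using K[of w] w by (simp add: p dist_norm norm_minus_commute)
    have "cmod (poly q (of_real r * w) - (poly p w)\<^sup>2) = cmod (g w - poly p w) * cmod (g w + poly p w)"
      using g(2)[of w] w R by (simp add: power2_eq_square algebra_simps flip: norm_mult)
    also have "\<dots> \<le> e' * (2 * B + 1)"
    proof (intro mult_mono pg)
      have "cmod (g w + poly p w) = cmod (2 * g w - (g w - poly p w))" by simp
      also have "\<dots> \<le> 2 * cmod (g w) + cmod (g w - poly p w)" by (metis norm_mult norm_numeral norm_triangle_ineq4)
      finally show "cmod (g w + poly p w) \<le> 2 * B + 1" using pg e' B(2)[of w] w by simp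
    qed (use e' in auto)
    finally have "cmod (poly q (of_real r * w) - (poly p w)\<^sup>2) \<le> e / 2" using e'2 by simp
    then show "cmod (poly q w - (poly p w)\<^sup>2) \<le> e"
      using rq[OF w] norm_triangle_ineq[of "poly q w - poly q (of_real r * w)" "poly q (of_real r * w) - (poly p w)\<^sup>2"] by simp
  qed
qed

lemma poly_coeff_sum:
  fixes p :: "complex poly"
  assumes "degree p \<le> K"
  shows "poly p w = (\<Sum>i\<le>K. coeff p i * w ^ i)"
proof -
  have "(\<Sum>i\<le>K. coeff p i * w ^ i) = (\<Sum>i\<le>degree p. coeff p i * w ^ i)"
    using assms by (intro sum.mono_neutral_right) (auto simp: coeff_eq_0)
  then show ?thesis by (simp add: poly_altdef)
qed

text \<open>If \<open>q\<close> is close to \<open>p ^ 2\<close>, then its Bergman norm is nearly at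
  most the sum of squared coefficients of \<open>p\<close>, which by Parseval is the mean of the
  squared modulus of \<open>p\<close>, hence nearly the mean of the modulus of \<open>q\<close>. The
  general case passes to the zero-free majorant. Here \<open>M0\<close> still depends on
  \<open>q\<close>.\<close>

lemma bergman_le_average:
  fixes q :: "complex poly"
  assumes e: "e > 0"
  shows "\<exists>M0>0. \<forall>M\<ge>M0. bergman N (coeff q) \<le> (\<Sum>w\<in>unit_roots M. cmod (poly q w)) / real M + e"
proof -
  have zf: "\<exists>M0>0. \<forall>M\<ge>M0. bergman N (coeff q) \<le> (\<Sum>w\<in>unit_roots M. cmod (poly q w)) / real M + e"
    if nz: "\<And>z. cmod z < 1 \<Longrightarrow> poly q z \<noteq> 0" for q :: "complex poly"
  proof -
    \<comment> \<open>Of the \<open>N + 2\<close> portions, \<open>N + 1\<close> pay for the Bergman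
      norm of \<open>q - p ^ 2\<close> and one for the average.\<close>
    define e' where "e' = e / (real N + 2)"
    have e': "e' > 0" "(real N + 2) * e' = e" using e by (auto simp: e'_def)
    obtain p :: "complex poly" where p: "\<And>w. cmod w = 1 \<Longrightarrow> cmod (poly q w - (poly p w)\<^sup>2) \<le> e'"
      using zero_free_approx_square[OF nz e'(1)] by metis
    define K where "K = max N (max (degree q) (degree (p ^ 2)))"
    have p2: "p ^ 2 = p * p" by (simp add: power2_eq_square)
    have dp: "degree p \<le> K"
      by (cases "p = 0") (auto simp: K_def p2 degree_mult_eq)
    have "bergman N (coeff q) \<le> (\<Sum>w\<in>unit_roots M. cmod (poly q w)) / real M + e" if M: "M \<ge> Suc K" for M
    proof -
      have M0: "M > 0" using M by simp
      have deg: "degree (q - p ^ 2) \<le> K"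
        using degree_diff_le_max[of q "p ^ 2"] by (simp add: K_def)
      have "cmod (coeff (q - p ^ 2) k) \<le> e'" if "k \<le> N" for k
      proof (rule unit_roots_coeff_le)
        show "k \<le> K" "K < M" using that M by (auto simp: K_def)
        show "cmod (\<Sum>i\<le>K. coeff (q - p ^ 2) i * w ^ i) \<le> e'" if "w \<in> unit_roots M" for w
          using p[OF norm_unit_roots[OF M0 that]] unfolding poly_coeff_sum[OF deg, symmetric] by simp
      qed
      then have b1: "bergman N (coeff (q - p ^ 2)) \<le> (real N + 1) * e'" by (rule bergman_le)
      have "bergman N (coeff (p ^ 2)) \<le> (\<Sum>i\<le>N. (cmod (coeff p i))\<^sup>2)"
        using bergman_square_le[of N "coeff p"] by (simp add: p2 coeff_mult[abs_def])
      also have "\<dots> \<le> (\<Sum>i\<le>K. (cmod (coeff p i))\<^sup>2)"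
        by (rule sum_mono2) (auto simp: K_def)
      also have "\<dots> = (\<Sum>w\<in>unit_roots M. (cmod (poly p w))\<^sup>2) / real M"
        unfolding poly_coeff_sum[OF dp] using unit_roots_parseval[of K M "coeff p"] M by simp
      also have "\<dots> \<le> (\<Sum>w\<in>unit_roots M. cmod (poly q w) + e') / real M"
      proof (intro divide_right_mono sum_mono)
        fix w assume "w \<in> unit_roots M"
        then have "cmod (poly q w - (poly p w)\<^sup>2) \<le> e'" using p norm_unit_roots[OF M0] by blast
        then show "(cmod (poly p w))\<^sup>2 \<le> cmod (poly q w) + e'"
          using norm_triangle_ineq2[of "(poly p w)\<^sup>2" "poly q w"] by (simp add: norm_power norm_minus_commute)
      qed simp
      also have "\<dots> = (\<Sum>w\<in>unit_roots M. cmod (poly q w)) / real M + e'"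
        using M0 by (simp add: sum.distrib add_divide_distrib)
      finally have b2: "bergman N (coeff (p ^ 2)) \<le> (\<Sum>w\<in>unit_roots M. cmod (poly q w)) / real M + e'" .
      have "bergman N (coeff q) \<le> bergman N (coeff (q - p ^ 2)) + bergman N (coeff (p ^ 2))"
        using bergman_triangle[of N "coeff (q - p ^ 2)" "coeff (p ^ 2)"] by simp
      with b1 b2 have "bergman N (coeff q) \<le> (\<Sum>w\<in>unit_roots M. cmod (poly q w)) / real M + (real N + 2) * e'"
        by (simp add: algebra_simps)
      then show ?thesis by (simp add: e')
    qed
    then show ?thesis by blast
  qed
  show ?thesis
  proof (cases "q = 0")
    case True
    then have "bergman N (coeff q) = 0" by (simp add: bergman_def L2_set_def)
    then show ?thesis using e by (auto intro!: exI[of _ 1] add_nonneg_nonneg divide_nonneg_nonneg sum_nonneg)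
  next
    case False
    obtain q' where q': "\<forall>z. cmod z < 1 \<longrightarrow> poly q' z \<noteq> 0"
      "\<forall>w. cmod w = 1 \<longrightarrow> cmod (poly q' w) = cmod (poly q w)" "bergman N (coeff q) \<le> bergman N (coeff q')"
      using zero_free_majorant[OF False, of 1 N] by auto
    obtain M0 where M0: "M0 > 0" "\<forall>M\<ge>M0. bergman N (coeff q') \<le> (\<Sum>w\<in>unit_roots M. cmod (poly q' w)) / real M + e"
      using zf[of q'] q'(1) by blast
    have "bergman N (coeff q) \<le> (\<Sum>w\<in>unit_roots M. cmod (poly q w)) / real M + e" if "M \<ge> M0" for M
    proof -
      have "(\<Sum>w\<in>unit_roots M. cmod (poly q' w)) = (\<Sum>w\<in>unit_roots M. cmod (poly q w))"
        using q'(2) norm_unit_roots[of M] that M0(1) by (intro sum.cong) auto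
      then show ?thesis using M0(2) that q'(3) by (metis order.trans)
    qed
    then show ?thesis using M0(1) by blast
  qed
qed

section \<open>A number of nodes that serves all polynomials of a given degree\<close>

lemma norm_cis_minus_one_le: "cmod (cis x - 1) \<le> \<bar>x\<bar>"
proof -
  have "(cmod (cis x - 1))\<^sup>2 = (cos x - 1)\<^sup>2 + (sin x)\<^sup>2" by (simp add: cmod_power2)
  also have "\<dots> = 2 - 2 * cos x" using sin_cos_squared_add[of x] by (simp add: power2_diff)
  also have "\<dots> = (2 * sin (x / 2))\<^sup>2" using cos_double_sin[of "x / 2"] by (simp add: power_mult_distrib)
  also have "\<dots> \<le> \<bar>x\<bar>\<^sup>2"
    using abs_sin_x_le_abs_x[of "x / 2"] by (subst abs_le_square_iff[symmetric]) (simp add: abs_mult)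
  finally show ?thesis by (rule power2_le_imp_le) simp
qed

text \<open>Passing from \<open>M\<close> to \<open>M * L\<close> nodes and letting \<open>L\<close> grow makes \<open>M\<close> independent of the polynomial.\<close>

lemma unit_roots_average_refine:
  assumes M: "M > 0" and L: "L > 0" and lip: "\<And>z w. cmod z = 1 \<Longrightarrow> cmod w = 1 \<Longrightarrow> \<bar>F z - F w\<bar> \<le> c * cmod (z - w)"
    and c: "c \<ge> 0"
  shows "(\<Sum>w\<in>unit_roots (M * L). F w) / real (M * L) \<le> (\<Sum>w\<in>unit_roots M. F w) / real M + 2 * pi * c / real M"
proof -
  have pos: "M * L > 0" using M L by simp
  have "(\<Sum>w\<in>unit_roots (M * L). F w) = (\<Sum>j<M * L. F (cis (2 * pi * real j / real (M * L))))"
    by (rule sum_unit_roots[OF pos])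
  \<comment> \<open>The \<open>M * L\<close> nodes form \<open>M\<close> arcs of \<open>L\<close>
    nodes each; every node is compared with the one at which its arc starts, and these starting
    nodes are \<open>unit_roots M\<close>.\<close>
  also have "\<dots> = (\<Sum>m<M. \<Sum>j\<in>{m * L..<m * L + L}. F (cis (2 * pi * real j / real (M * L))))"
    by (rule sum.nat_group[symmetric])
  also have "\<dots> \<le> (\<Sum>m<M. \<Sum>j\<in>{m * L..<m * L + L}. F (cis (2 * pi * real m / real M)) + 2 * pi * c / real M)"
  proof (intro sum_mono)
    fix m j assume "m \<in> {..<M}" and j: "j \<in> {m * L..<m * L + L}"
    define x where "x = 2 * pi * real j / real (M * L)"
    define y where "y = 2 * pi * real m / real M"
    have "x - y = 2 * pi / real M * ((real j - real (m * L)) / real L)"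
      using M L by (simp add: x_def y_def field_simps)
    also have "\<bar>\<dots>\<bar> \<le> 2 * pi / real M * 1"
    proof -
      have "\<bar>(real j - real (m * L)) / real L\<bar> \<le> 1" using j L by (simp add: field_simps flip: of_nat_mult)
      then have "2 * pi / real M * \<bar>(real j - real (m * L)) / real L\<bar> \<le> 2 * pi / real M * 1"
        using M by (intro mult_left_mono) auto
      then show ?thesis using M by (simp add: abs_mult)
    qed
    finally have xy: "\<bar>x - y\<bar> \<le> 2 * pi / real M" by simp
    have "cmod (cis x - cis y) \<le> \<bar>x - y\<bar>"
    proof -
      have "cmod (cis x - cis y) = cmod (cis y) * cmod (cis (x - y) - 1)"
        by (simp only: norm_mult[symmetric] right_diff_distrib cis_mult) simp
      also have "\<dots> \<le> \<bar>x - y\<bar>" using norm_cis_minus_one_le[of "x - y"] by simp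
      finally show ?thesis .
    qed
    then have "c * cmod (cis x - cis y) \<le> c * (2 * pi / real M)" using xy c by (intro mult_left_mono) auto
    then show "F (cis (2 * pi * real j / real (M * L))) \<le> F (cis (2 * pi * real m / real M)) + 2 * pi * c / real M"
      using lip[of "cis x" "cis y"] unfolding x_def y_def by (simp add: mult_ac)
  qed
  also have "\<dots> = real L * ((\<Sum>w\<in>unit_roots M. F w) + 2 * pi * c)"
    using M by (simp add: sum_unit_roots[OF M] sum.distrib sum_distrib_left algebra_simps)
  finally show ?thesis using M L by (simp add: field_simps)
qed

text \<open>The modulus of the polynomial is Lipschitz on the circle with constant
  \<open>\<kappa> * b\<close>, proportional to the very Bergman norm \<open>b\<close> to be bounded.
  For large \<open>M\<close> the sampling error is therefore at most \<open>(1 - 1 / C) * b\<close>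
  and is absorbed into the left-hand side.\<close>

lemma carleman_discrete:
  assumes C: "C > 1"
  shows "\<exists>M>K. \<forall>a. bergman d a \<le> C * ((\<Sum>w\<in>unit_roots M. cmod (\<Sum>i\<le>d. a i * w ^ i)) / real M)"
proof -
  \<comment> \<open>One factor \<open>d + 1\<close> counts the terms, the other comes from
    \<open>bergman_ge\<close>, and \<open>d\<close> is the Lipschitz constant of the powers.\<close>
  define \<kappa> where "\<kappa> = (real d + 1) * (real d + 1) * real d"
  have \<kappa>: "\<kappa> \<ge> 0" by (simp add: \<kappa>_def)
  obtain M where M: "M > K" "real M \<ge> 2 * pi * \<kappa> * C / (C - 1)"
  proof -
    obtain m :: nat where "real m \<ge> 2 * pi * \<kappa> * C / (C - 1)" using real_arch_simple by blast
    then show thesis using that[of "max m (Suc K)"] by (auto simp: max_def)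
  qed
  have M0: "M > 0" using M by simp
  show ?thesis
  proof (intro exI[of _ M] conjI allI M(1))
    fix a :: "nat \<Rightarrow> complex"
    define b where "b = bergman d a"
    define f where "f w = (\<Sum>i\<le>d. a i * w ^ i)" for w
    define p where "p = (\<Sum>i\<le>d. monom (a i) i)"
    define A where "A = (\<Sum>w\<in>unit_roots M. cmod (f w)) / real M"
    have pf: "poly p = f" by (rule ext) (simp add: p_def f_def poly_sum poly_monom)
    have cp: "coeff p k = a k" if "k \<le> d" for k
      using that by (simp add: p_def coeff_sum)
    have bp: "bergman d (coeff p) = b"
      unfolding b_def bergman_def by (rule L2_set_cong) (auto simp: cp)
    have lip: "\<bar>cmod (f z) - cmod (f w)\<bar> \<le> (\<kappa> * b) * cmod (z - w)" if "cmod z = 1" "cmod w = 1" for z w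
    proof -
      have "\<bar>cmod (f z) - cmod (f w)\<bar> \<le> cmod (f z - f w)" by (rule norm_triangle_ineq3)
      also have "f z - f w = (\<Sum>i\<le>d. a i * (z ^ i - w ^ i))" by (simp add: f_def sum_subtractf right_diff_distrib)
      also have "cmod \<dots> \<le> (\<Sum>i\<le>d. ((real d + 1) * b) * (real d * cmod (z - w)))"
      proof (intro sum_norm_le)
        fix i assume i: "i \<in> {..d}"
        have "cmod (z ^ i - w ^ i) \<le> real i * cmod (z - w)" using that by (intro norm_power_diff) auto
        also have "\<dots> \<le> real d * cmod (z - w)" using i by (intro mult_right_mono) auto
        finally show "cmod (a i * (z ^ i - w ^ i)) \<le> ((real d + 1) * b) * (real d * cmod (z - w))"
          unfolding norm_mult b_def using i by (intro mult_mono bergman_ge) auto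
      qed
      also have "\<dots> = (\<kappa> * b) * cmod (z - w)" by (simp add: \<kappa>_def algebra_simps)
      finally show ?thesis .
    qed
    have "b \<le> A + 2 * pi * (\<kappa> * b) / real M"
    proof (rule field_le_epsilon)
      fix e :: real assume "e > 0"
      from bergman_le_average[OF this, of d p] obtain M' where M': "M' > 0"
        "\<forall>M\<ge>M'. b \<le> (\<Sum>w\<in>unit_roots M. cmod (f w)) / real M + e" unfolding pf bp by blast
      have "M * M' \<ge> M'" using M0 by simp
      then have "b \<le> (\<Sum>w\<in>unit_roots (M * M'). cmod (f w)) / real (M * M') + e" using M'(2) by blast
      also have "\<dots> \<le> A + 2 * pi * (\<kappa> * b) / real M + e"
        unfolding A_def using \<kappa> by (intro add_mono order.refl unit_roots_average_refine M0 M'(1) lip) (auto simp: b_def)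
      finally show "b \<le> A + 2 * pi * (\<kappa> * b) / real M + e" .
    qed
    moreover have "2 * pi * (\<kappa> * b) / real M \<le> (1 - 1 / C) * b"
    proof -
      have "2 * pi * \<kappa> / real M \<le> 1 - 1 / C" using M(2) M0 C by (simp add: field_simps)
      then have "2 * pi * \<kappa> / real M * b \<le> (1 - 1 / C) * b" by (rule mult_right_mono) (simp add: b_def)
      then show ?thesis by (simp add: mult_ac)
    qed
    ultimately have "b / C \<le> A" by (simp add: algebra_simps)
    then show "bergman d a \<le> C * ((\<Sum>w\<in>unit_roots M. cmod (\<Sum>i\<le>d. a i * w ^ i)) / real M)"
      using C unfolding A_def f_def b_def by (simp add: field_simps)
  qed
qed

section \<open>Hypercontractivity on the discrete torus\<close>

lemma cnj_sgn_mult: "cnj (sgn v) * v = of_real (cmod v)" for v :: complex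
  by (cases "v = 0") (auto simp: sgn_eq complex_norm_square[symmetric] power2_eq_square mult.commute)

section \<open>Monomials, multi-indices and sums over the discrete torus\<close>

lemma deg_upd:
  assumes "k < n"
  shows "deg n (\<alpha>(k := a)) + \<alpha> k = deg n \<alpha> + a"
proof -
  have "(\<Sum>j\<in>{..<n} - {k}. (\<alpha>(k := a)) j) = (\<Sum>j\<in>{..<n} - {k}. \<alpha> j)" by (rule sum.cong) auto
  then show ?thesis using assms by (simp add: deg_def sum.remove[of "{..<n}" k])
qed

lemma mono_upd:
  assumes "k < n"
  shows "mono n (\<alpha>(k := a)) u = u k ^ a * (\<Prod>j\<in>{..<n} - {k}. u j ^ \<alpha> j)"
proof -
  have "(\<Prod>j\<in>{..<n} - {k}. u j ^ (\<alpha>(k := a)) j) = (\<Prod>j\<in>{..<n} - {k}. u j ^ \<alpha> j)" by (rule prod.cong) auto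
  then show ?thesis using assms by (simp add: mono_def prod.remove[of "{..<n}" k])
qed

text \<open>Points are extensional and take the value \<open>undefined\<close> from index
  \<open>n\<close> on. This is harmless, since they enter only through \<open>mono n\<close> or as
  factors of a vector of \<open>cvec n\<close>.\<close>

definition torus :: "nat \<Rightarrow> nat \<Rightarrow> (nat \<Rightarrow> complex) set" where
  "torus M n = ({..<n} \<rightarrow>\<^sub>E unit_roots M)"

lemma finite_torus [simp]: "M > 0 \<Longrightarrow> finite (torus M n)"
  by (simp add: torus_def finite_PiE)

lemma card_torus [simp]: "M > 0 \<Longrightarrow> card (torus M n) = M ^ n"
  by (simp add: torus_def card_PiE)

lemma norm_torus: "M > 0 \<Longrightarrow> t \<in> torus M n \<Longrightarrow> k < n \<Longrightarrow> cmod (t k) = 1"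
  using norm_unit_roots[of M "t k"] by (auto simp: torus_def PiE_iff)

lemma sum_torus_Suc:
  "sum F (torus M (Suc n)) = (\<Sum>t\<in>torus M n. \<Sum>w\<in>unit_roots M. F (t(n := w)))"
proof -
  have "sum F (torus M (Suc n)) = sum F ((\<lambda>(y, g). g(n := y)) ` (unit_roots M \<times> torus M n))"
    unfolding torus_def lessThan_Suc PiE_insert_eq ..
  also have "\<dots> = (\<Sum>(w, t)\<in>unit_roots M \<times> torus M n. F (t(n := w)))"
    unfolding torus_def
    by (subst sum.reindex) (auto simp: case_prod_unfold intro: inj_combinator[of n "{..<n}" "\<lambda>_. unit_roots M", simplified])
  also have "\<dots> = (\<Sum>t\<in>torus M n. \<Sum>w\<in>unit_roots M. F (t(n := w)))"
    by (subst sum.swap) (simp add: sum.cartesian_product)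
  finally show ?thesis .
qed

lemma mono_orthogonal:
  assumes "\<And>k. k < n \<Longrightarrow> \<alpha> k < M" "\<And>k. k < n \<Longrightarrow> \<beta> k < M" "\<alpha> \<in> multi n" "\<beta> \<in> multi n"
  shows "(\<Sum>t\<in>torus M n. mono n \<alpha> t * cnj (mono n \<beta> t)) = (if \<alpha> = \<beta> then of_nat (M ^ n) else 0)"
proof -
  have "(\<Sum>t\<in>torus M n. mono n \<alpha> t * cnj (mono n \<beta> t))
      = (\<Sum>t\<in>torus M n. \<Prod>k<n. t k ^ \<alpha> k * cnj (t k) ^ \<beta> k)"
    by (simp add: mono_def prod.distrib)
  also have "\<dots> = (\<Prod>k<n. \<Sum>w\<in>unit_roots M. w ^ \<alpha> k * cnj w ^ \<beta> k)"
    unfolding torus_def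
  proof (rule prod_sum_PiE[symmetric])
    show "finite (unit_roots M)" if "x \<in> {..<n}" for x using assms(1)[of x] that by simp
  qed simp
  also have "\<dots> = (\<Prod>k<n. if \<alpha> k = \<beta> k then of_nat M else 0)"
    using assms by (intro prod.cong refl unit_roots_orthogonal) auto
  also have "\<dots> = (if \<alpha> = \<beta> then of_nat (M ^ n) else 0)"
  proof (cases "\<alpha> = \<beta>")
    case False
    then obtain k where k: "\<alpha> k \<noteq> \<beta> k" by auto
    then have "k < n" using assms(3,4) unfolding multi_def by (metis (mono_tags) linorder_not_less mem_Collect_eq)
    then have "(\<Prod>k<n. if \<alpha> k = \<beta> k then of_nat M else (0::complex)) = 0"
      using k by (intro prod_zero) auto
    then show ?thesis using False by simp
  qed simp
  finally show ?thesis .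
qed

text \<open>Unlike \<open>Lambda m n\<close>, a box is a product over the coordinates, so an
  induction on the number of variables can split off the last one.\<close>

definition ibox :: "nat \<Rightarrow> nat \<Rightarrow> (nat \<Rightarrow> nat) set" where
  "ibox d n = {\<alpha> \<in> multi n. \<forall>k<n. \<alpha> k \<le> d}"

lemma ibox_Suc: "ibox d (Suc n) = (\<lambda>(k, \<alpha>). \<alpha>(n := k)) ` ({..d} \<times> ibox d n)"
proof (intro equalityI subsetI)
  fix \<alpha> assume a: "\<alpha> \<in> ibox d (Suc n)"
  have "\<alpha> = (\<lambda>(k, \<alpha>). \<alpha>(n := k)) (\<alpha> n, \<alpha>(n := 0))" by auto
  moreover have "(\<alpha> n, \<alpha>(n := 0)) \<in> {..d} \<times> ibox d n"
    using a by (auto simp: ibox_def multi_def)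
  ultimately show "\<alpha> \<in> (\<lambda>(k, \<alpha>). \<alpha>(n := k)) ` ({..d} \<times> ibox d n)" by (rule image_eqI)
qed (auto simp: ibox_def multi_def less_Suc_eq)

lemma inj_on_ibox_Suc: "inj_on (\<lambda>(k, \<alpha>). \<alpha>(n := k)) ({..d} \<times> ibox d n)"
proof (rule inj_onI, clarify)
  fix k \<alpha> j \<beta> assume "\<alpha> \<in> ibox d n" "\<beta> \<in> ibox d n" and eq: "\<alpha>(n := k) = \<beta>(n := j)"
  then have z: "\<alpha> n = 0" "\<beta> n = 0" by (auto simp: ibox_def multi_def)
  have "k = j" using fun_cong[OF eq, of n] by simp
  moreover have "\<alpha> i = \<beta> i" for i using fun_cong[OF eq, of i] z by (cases "i = n") auto
  ultimately show "k = j \<and> \<alpha> = \<beta>" by auto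
qed

lemma finite_ibox [simp]: "finite (ibox d n)"
proof (induction n)
  case 0
  have "ibox d 0 \<subseteq> {\<lambda>_. 0}" by (auto simp: ibox_def multi_def)
  then show ?case by (rule finite_subset) simp
qed (simp add: ibox_Suc)

lemma sum_ibox_Suc: "sum F (ibox d (Suc n)) = (\<Sum>k\<le>d. \<Sum>\<alpha>\<in>ibox d n. F (\<alpha>(n := k)))"
  unfolding ibox_Suc sum.reindex[OF inj_on_ibox_Suc]
  by (simp add: sum.cartesian_product case_prod_unfold)

lemma Lambda_subset_ibox: "Lambda m n \<subseteq> ibox m n"
proof
  fix \<alpha> assume a: "\<alpha> \<in> Lambda m n"
  have "\<alpha> k \<le> m" if "k < n" for k
    using member_le_sum[of k "{..<n}" \<alpha>] a that by (simp add: Lambda_def deg_def)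
  then show "\<alpha> \<in> ibox m n" using a by (simp add: ibox_def Lambda_def)
qed

lemma finite_Lambda [simp]: "finite (Lambda m n)"
  using Lambda_subset_ibox finite_ibox by (rule finite_subset)

lemma mono_Suc_upd: "mono (Suc n) (\<alpha>(n := k)) (t(n := w)) = mono n \<alpha> t * w ^ k"
proof -
  have "(\<Prod>i<n. (t(n := w)) i ^ (\<alpha>(n := k)) i) = (\<Prod>i<n. t i ^ \<alpha> i)"
    by (rule prod.cong) auto
  then show ?thesis by (simp add: mono_def)
qed

definition bergman_weight :: "nat \<Rightarrow> (nat \<Rightarrow> nat) \<Rightarrow> real" where
  "bergman_weight n \<alpha> = (\<Prod>k<n. real (\<alpha> k) + 1)"

lemma bergman_weight_pos: "bergman_weight n \<alpha> > 0"
  unfolding bergman_weight_def by (intro prod_pos) auto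

lemma bergman_weight_Suc_upd: "bergman_weight (Suc n) (\<alpha>(n := k)) = bergman_weight n \<alpha> * (real k + 1)"
  unfolding bergman_weight_def by (simp add: lessThan_Suc mult.commute cong: prod.cong_simp)

text \<open>Each factor satisfies \<open>j + 1 \<le> 2 ^ j\<close>, with equality for
  \<open>j = 0\<close> and \<open>j = 1\<close>; hence equality holds when all exponents are at most
  1.\<close>

lemma bergman_weight_le:
  assumes "\<alpha> \<in> Lambda m n"
  shows "bergman_weight n \<alpha> \<le> 2 ^ m"
proof -
  have "real j + 1 \<le> 2 ^ j" for j :: nat
    by (induction j) auto
  then have "bergman_weight n \<alpha> \<le> (\<Prod>k<n. 2 ^ \<alpha> k)"
    unfolding bergman_weight_def by (intro prod_mono) auto
  also have "\<dots> = 2 ^ (\<Sum>k<n. \<alpha> k)" by (rule power_sum[symmetric])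
  finally show ?thesis using assms by (simp add: Lambda_def deg_def)
qed

text \<open>Minkowski's inequality for finite sums. In \<open>carleman_torus\<close> it moves the
  weighted norm over the last exponent inside the average over the earlier variables.\<close>

lemma L2_set_sum_le:
  assumes "finite T" and "\<And>t k. t \<in> T \<Longrightarrow> k \<in> K \<Longrightarrow> 0 \<le> g t k"
  shows "L2_set (\<lambda>k. \<Sum>t\<in>T. g t k) K \<le> (\<Sum>t\<in>T. L2_set (g t) K)"
  using assms
proof (induction T rule: finite_induct)
  case empty
  then show ?case by (simp add: L2_set_def)
next
  case (insert x T)
  have "L2_set (\<lambda>k. \<Sum>t\<in>insert x T. g t k) K = L2_set (\<lambda>k. g x k + (\<Sum>t\<in>T. g t k)) K"
    using insert by simp
  also have "\<dots> \<le> L2_set (g x) K + L2_set (\<lambda>k. \<Sum>t\<in>T. g t k) K" by (rule L2_set_triangle_ineq)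
  also have "\<dots> \<le> L2_set (g x) K + (\<Sum>t\<in>T. L2_set (g t) K)" using insert by simp
  finally show ?case using insert by simp
qed

text \<open>Induction on the variables: for each power \<open>k\<close> of the last variable the
  hypothesis bounds the norm over the other exponents by an average of \<open>f k t\<close>; after
  Minkowski's inequality, \<open>H\<close> treats the last variable for every fixed
  \<open>t\<close>. Each variable contributes one factor \<open>C\<close>.\<close>

lemma carleman_torus:
  assumes M: "M > 0" and C: "C \<ge> 0"
    and H: "\<And>a. bergman d a \<le> C * ((\<Sum>w\<in>unit_roots M. cmod (\<Sum>i\<le>d. a i * w ^ i)) / real M)"
  shows "L2_set (\<lambda>\<alpha>. cmod (a \<alpha>) / sqrt (bergman_weight n \<alpha>)) (ibox d n)
    \<le> C ^ n * ((\<Sum>t\<in>torus M n. cmod (\<Sum>\<alpha>\<in>ibox d n. a \<alpha> * mono n \<alpha> t)) / real (M ^ n))"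
proof (induction n arbitrary: a)
  case 0
  have "ibox d 0 = {\<lambda>_. 0}" by (auto simp: ibox_def multi_def)
  then show ?case by (simp add: L2_set_def bergman_weight_def torus_def mono_def)
next
  case (Suc n)
  define f where "f k t = (\<Sum>\<alpha>\<in>ibox d n. a (\<alpha>(n := k)) * mono n \<alpha> t)" for k t
  have "L2_set (\<lambda>\<alpha>. cmod (a \<alpha>) / sqrt (bergman_weight (Suc n) \<alpha>)) (ibox d (Suc n))
      = L2_set (\<lambda>k. L2_set (\<lambda>\<alpha>. cmod (a (\<alpha>(n := k))) / sqrt (bergman_weight n \<alpha>)) (ibox d n) / sqrt (real k + 1)) {..d}"
    unfolding L2_set_def sum_ibox_Suc bergman_weight_Suc_upd
    by (rule arg_cong[where f = sqrt], rule sum.cong)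
      (auto simp: power_divide power_mult_distrib sum_nonneg real_sqrt_mult sum_divide_distrib abs_of_pos bergman_weight_pos less_imp_le)
  also have "\<dots> \<le> L2_set (\<lambda>k. C ^ n / real (M ^ n) * (\<Sum>t\<in>torus M n. cmod (f k t) / sqrt (real k + 1))) {..d}"
  proof (rule L2_set_mono)
    fix k
    show "L2_set (\<lambda>\<alpha>. cmod (a (\<alpha>(n := k))) / sqrt (bergman_weight n \<alpha>)) (ibox d n) / sqrt (real k + 1)
       \<le> C ^ n / real (M ^ n) * (\<Sum>t\<in>torus M n. cmod (f k t) / sqrt (real k + 1))"
      using divide_right_mono[OF Suc.IH[of "\<lambda>\<alpha>. a (\<alpha>(n := k))"] real_sqrt_ge_zero, of "real k + 1"]
      unfolding f_def sum_divide_distrib[symmetric] by simp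
  qed simp
  also have "\<dots> = C ^ n / real (M ^ n) * L2_set (\<lambda>k. \<Sum>t\<in>torus M n. cmod (f k t) / sqrt (real k + 1)) {..d}"
    using C by (intro L2_set_right_distrib[symmetric]) auto
  also have "\<dots> \<le> C ^ n / real (M ^ n) * (\<Sum>t\<in>torus M n. bergman d (\<lambda>k. f k t))"
    unfolding bergman_def using C M by (intro mult_left_mono L2_set_sum_le) auto
  also have "\<dots> \<le> C ^ n / real (M ^ n) * (\<Sum>t\<in>torus M n. C * ((\<Sum>w\<in>unit_roots M. cmod (\<Sum>k\<le>d. f k t * w ^ k)) / real M))"
    using C by (intro mult_left_mono sum_mono H) auto
  also have "\<dots> = C ^ Suc n * ((\<Sum>t\<in>torus M n. \<Sum>w\<in>unit_roots M. cmod (\<Sum>k\<le>d. f k t * w ^ k)) / real (M ^ Suc n))"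
    by (simp add: sum_distrib_left sum_divide_distrib mult_ac)
  also have "(\<Sum>t\<in>torus M n. \<Sum>w\<in>unit_roots M. cmod (\<Sum>k\<le>d. f k t * w ^ k))
     = (\<Sum>t\<in>torus M (Suc n). cmod (\<Sum>\<alpha>\<in>ibox d (Suc n). a \<alpha> * mono (Suc n) \<alpha> t))"
    unfolding sum_torus_Suc sum_ibox_Suc mono_Suc_upd f_def by (simp add: sum_distrib_right mult.assoc)
  finally show ?case .
qed

text \<open>The two factors \<open>sqrt 2 ^ m\<close> of hypercontractivity make up the \<open>2 ^ m\<close> behind the constant \<open>1/6\<close>.\<close>

lemma homogeneous_pairing_le:
  assumes M: "M > 0" and C: "C \<ge> 0"
    and H: "\<And>a. bergman m a \<le> C * ((\<Sum>w\<in>unit_roots M. cmod (\<Sum>i\<le>m. a i * w ^ i)) / real M)"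
    and I: "I \<subseteq> Lambda m n"
  shows "(\<Sum>\<alpha>\<in>I. cmod (a \<alpha>) * cmod (b \<alpha>))
    \<le> 2 ^ m * C ^ (2 * n) * ((\<Sum>t\<in>torus M n. cmod (poly_eval n I a t)) / real (M ^ n))
        * ((\<Sum>t\<in>torus M n. cmod (poly_eval n I b t)) / real (M ^ n))"
proof -
  define A where "A a = (\<Sum>t\<in>torus M n. cmod (poly_eval n I a t)) / real (M ^ n)" for a
  have A0: "A a \<ge> 0" for a unfolding A_def by (intro divide_nonneg_nonneg sum_nonneg) auto
  have Ib: "I \<subseteq> ibox m n" using I Lambda_subset_ibox by blast
  have hc: "L2_set (\<lambda>\<alpha>. cmod (a \<alpha>)) I \<le> sqrt (2 ^ m) * C ^ n * A a" for a
  proof -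
    define a' where "a' \<alpha> = (if \<alpha> \<in> I then a \<alpha> else 0)" for \<alpha>
    have "L2_set (\<lambda>\<alpha>. cmod (a \<alpha>)) I \<le> L2_set (\<lambda>\<alpha>. sqrt (2 ^ m) * (cmod (a \<alpha>) / sqrt (bergman_weight n \<alpha>))) I"
    proof (rule L2_set_mono)
      fix \<alpha> assume "\<alpha> \<in> I"
      then have "sqrt (bergman_weight n \<alpha>) \<le> sqrt (2 ^ m)" using bergman_weight_le I by auto
      then have "cmod (a \<alpha>) * sqrt (bergman_weight n \<alpha>) \<le> cmod (a \<alpha>) * sqrt (2 ^ m)"
        by (rule mult_left_mono) simp
      then show "cmod (a \<alpha>) \<le> sqrt (2 ^ m) * (cmod (a \<alpha>) / sqrt (bergman_weight n \<alpha>))"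
        using bergman_weight_pos[of n \<alpha>] by (simp add: field_simps)
    qed simp
    also have "\<dots> = sqrt (2 ^ m) * L2_set (\<lambda>\<alpha>. cmod (a \<alpha>) / sqrt (bergman_weight n \<alpha>)) I"
      by (rule L2_set_right_distrib[symmetric]) simp
    also have "L2_set (\<lambda>\<alpha>. cmod (a \<alpha>) / sqrt (bergman_weight n \<alpha>)) I
        = L2_set (\<lambda>\<alpha>. cmod (a' \<alpha>) / sqrt (bergman_weight n \<alpha>)) (ibox m n)"
      unfolding L2_set_def a'_def using Ib
      by (intro arg_cong[where f = sqrt] sum.mono_neutral_cong_left) auto
    also have "\<dots> \<le> C ^ n * ((\<Sum>t\<in>torus M n. cmod (\<Sum>\<alpha>\<in>ibox m n. a' \<alpha> * mono n \<alpha> t)) / real (M ^ n))"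
      by (rule carleman_torus[OF M C H])
    also have "(\<lambda>t. \<Sum>\<alpha>\<in>ibox m n. a' \<alpha> * mono n \<alpha> t) = poly_eval n I a"
      unfolding poly_eval_def a'_def using Ib
      by (intro ext sum.mono_neutral_cong_right) auto
    finally show ?thesis by (simp add: A_def)
  qed
  have "(\<Sum>\<alpha>\<in>I. cmod (a \<alpha>) * cmod (b \<alpha>)) \<le> L2_set (\<lambda>\<alpha>. cmod (a \<alpha>)) I * L2_set (\<lambda>\<alpha>. cmod (b \<alpha>)) I"
    using L2_set_mult_ineq[of "\<lambda>\<alpha>. cmod (a \<alpha>)" "\<lambda>\<alpha>. cmod (b \<alpha>)" I] by simp
  also have "\<dots> \<le> (sqrt (2 ^ m) * C ^ n * A a) * (sqrt (2 ^ m) * C ^ n * A b)"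
    using C A0 by (intro mult_mono hc) auto
  also have "\<dots> = (sqrt (2 ^ m) * sqrt (2 ^ m)) * (C ^ n * C ^ n) * A a * A b" by (simp only: mult_ac)
  also have "\<dots> = 2 ^ m * C ^ (2 * n) * A a * A b" by (simp add: mult_2 power_add)
  finally show ?thesis by (simp add: A_def)
qed

section \<open>Polynomials on the unit ball of \<open>X\<^sub>n\<close>\<close>

text \<open>The truncated subtraction is harmless: where \<open>\<alpha> k = 0\<close> the factor
  \<open>of_nat (\<alpha> k)\<close> removes the term.\<close>

definition poly_partial :: "nat \<Rightarrow> (nat \<Rightarrow> nat) set \<Rightarrow> ((nat \<Rightarrow> nat) \<Rightarrow> complex) \<Rightarrow> nat \<Rightarrow> (nat \<Rightarrow> complex) \<Rightarrow> complex" where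
  "poly_partial n I c k w = (\<Sum>\<alpha>\<in>I. c \<alpha> * of_nat (\<alpha> k) * mono n (\<alpha>(k := \<alpha> k - 1)) w)"

locale seq_lattice =
  fixes X :: "(nat \<Rightarrow> complex) set" and N :: "(nat \<Rightarrow> complex) \<Rightarrow> real" and n :: nat
  assumes lattice: "banach_seq_lattice X N"
begin

abbreviation B :: "(nat \<Rightarrow> complex) set" where "B \<equiv> XBall N n"

section \<open>Norm estimates inherited from the sequence lattice\<close>

lemma
  shows zero_in_X: "(\<lambda>_. 0) \<in> X"
    and add_in_X: "x \<in> X \<Longrightarrow> y \<in> X \<Longrightarrow> (\<lambda>k. x k + y k) \<in> X"
    and scale_in_X: "x \<in> X \<Longrightarrow> (\<lambda>k. c * x k) \<in> X"
    and N_nonneg: "x \<in> X \<Longrightarrow> 0 \<le> N x"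
    and N_eq_0: "x \<in> X \<Longrightarrow> N x = 0 \<longleftrightarrow> x = (\<lambda>_. 0)"
    and N_scale: "x \<in> X \<Longrightarrow> N (\<lambda>k. c * x k) = cmod c * N x"
    and N_triangle: "x \<in> X \<Longrightarrow> y \<in> X \<Longrightarrow> N (\<lambda>k. x k + y k) \<le> N x + N y"
    and N_solid: "x \<in> X \<Longrightarrow> (\<And>k. cmod (y k) \<le> cmod (x k)) \<Longrightarrow> N y \<le> N x"
    and unit_seq_in_X: "unit_seq k \<in> X"
  using lattice unfolding banach_seq_lattice_def by blast+

lemma N_unit_seq_pos: "N (unit_seq k) > 0"
proof -
  have "unit_seq k \<noteq> (\<lambda>_. 0)" by (auto simp: unit_seq_def fun_eq_iff)
  then show ?thesis using N_eq_0[OF unit_seq_in_X] N_nonneg[OF unit_seq_in_X] by (metis less_eq_real_def)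
qed

lemma truncation:
  "(\<lambda>k. if k < j then z k else 0) \<in> X \<and> N (\<lambda>k. if k < j then z k else 0) \<le> (\<Sum>k<j. cmod (z k) * N (unit_seq k))"
proof (induction j)
  case 0
  then show ?case using zero_in_X N_eq_0[OF zero_in_X] by simp
next
  case (Suc j)
  have eq: "(\<lambda>k. if k < Suc j then z k else 0) = (\<lambda>k. (if k < j then z k else 0) + z j * unit_seq j k)"
    by (auto simp: fun_eq_iff unit_seq_def less_Suc_eq)
  have u: "(\<lambda>k. z j * unit_seq j k) \<in> X" by (rule scale_in_X[OF unit_seq_in_X])
  have "N (\<lambda>k. if k < Suc j then z k else 0) \<le> N (\<lambda>k. if k < j then z k else 0) + cmod (z j) * N (unit_seq j)"
    unfolding eq using N_triangle[OF conjunct1[OF Suc] u] N_scale[OF unit_seq_in_X, of "z j" j] by simp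
  then show ?case using Suc add_in_X[OF conjunct1[OF Suc] u] unfolding eq by auto
qed

abbreviation absn :: "(nat \<Rightarrow> complex) \<Rightarrow> nat \<Rightarrow> complex" where
  "absn z \<equiv> (\<lambda>k. if k < n then complex_of_real (cmod (z k)) else 0)"

lemma absn_in_X: "absn z \<in> X"
  using truncation[of n "\<lambda>k. complex_of_real (cmod (z k))"] by blast

lemma Xn_norm_le_sum: "Xn_norm N n z \<le> (\<Sum>k<n. cmod (z k) * N (unit_seq k))"
  using truncation[of n "\<lambda>k. complex_of_real (cmod (z k))"] by (simp add: Xn_norm_def)

lemma Xn_norm_scale: "Xn_norm N n (\<lambda>k. c * z k) = cmod c * Xn_norm N n z"
proof -
  have "absn (\<lambda>k. c * z k) = (\<lambda>k. of_real (cmod c) * absn z k)"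
    by (auto simp: fun_eq_iff norm_mult)
  then show ?thesis unfolding Xn_norm_def using N_scale[OF absn_in_X, of "of_real (cmod c)" z] by simp
qed

lemma Xn_norm_mono:
  assumes "\<And>k. k < n \<Longrightarrow> cmod (y k) \<le> cmod (z k)"
  shows "Xn_norm N n y \<le> Xn_norm N n z"
  unfolding Xn_norm_def by (rule N_solid[OF absn_in_X]) (use assms in auto)

lemma Xn_norm_triangle: "Xn_norm N n (\<lambda>k. y k + z k) \<le> Xn_norm N n y + Xn_norm N n z"
proof -
  have "Xn_norm N n (\<lambda>k. y k + z k) \<le> N (\<lambda>k. absn y k + absn z k)"
    unfolding Xn_norm_def
    by (rule N_solid[OF add_in_X[OF absn_in_X absn_in_X]])
      (auto simp: norm_triangle_ineq simp flip: of_real_add)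
  also have "\<dots> \<le> Xn_norm N n y + Xn_norm N n z"
    unfolding Xn_norm_def by (rule N_triangle[OF absn_in_X absn_in_X])
  finally show ?thesis .
qed

lemma coordinate_le: "k < n \<Longrightarrow> cmod (z k) \<le> Xn_norm N n z / N (unit_seq k)"
proof -
  assume k: "k < n"
  have "cmod (z k) * N (unit_seq k) = N (\<lambda>j. of_real (cmod (z k)) * unit_seq k j)"
    using N_scale[OF unit_seq_in_X, of "of_real (cmod (z k))" k] by simp
  also have "\<dots> \<le> Xn_norm N n z"
    unfolding Xn_norm_def by (rule N_solid[OF absn_in_X]) (use k in \<open>auto simp: unit_seq_def\<close>)
  finally show ?thesis using N_unit_seq_pos[of k] by (simp add: field_simps)
qed

lemma ball_coordinate_le:
  obtains R where "R \<ge> 1" "\<And>z k. z \<in> B \<Longrightarrow> cmod (z k) \<le> R"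
proof
  define R where "R = 1 + (\<Sum>k<n. 1 / N (unit_seq k))"
  have nn: "0 \<le> 1 / N (unit_seq k)" for k using N_unit_seq_pos[of k] by simp
  show "R \<ge> 1" unfolding R_def using nn by (simp add: sum_nonneg)
  fix z k assume z: "z \<in> B"
  show "cmod (z k) \<le> R"
  proof (cases "k < n")
    case True
    have "cmod (z k) \<le> Xn_norm N n z / N (unit_seq k)" by (rule coordinate_le[OF True])
    also have "\<dots> \<le> 1 / N (unit_seq k)"
      using z N_unit_seq_pos[of k] by (intro divide_right_mono) (auto simp: XBall_def)
    also have "\<dots> \<le> (\<Sum>k<n. 1 / N (unit_seq k))"
      using True nn by (intro member_le_sum) auto
    finally show ?thesis by (simp add: R_def)
  next
    case False
    then have "z k = 0" using z by (simp add: XBall_def cvec_def)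
    then show ?thesis using \<open>R \<ge> 1\<close> by simp
  qed
qed

lemma polydisc_in_ball:
  obtains \<rho> where "\<rho> > 0" "\<And>z. z \<in> cvec n \<Longrightarrow> (\<And>k. k < n \<Longrightarrow> cmod (z k) \<le> \<rho>) \<Longrightarrow> z \<in> B"
proof
  define S where "S = (\<Sum>k<n. N (unit_seq k))"
  have S: "S \<ge> 0" unfolding S_def using N_unit_seq_pos by (intro sum_nonneg) (simp add: less_imp_le)
  show "1 / (2 * (S + 1)) > 0" using S by simp
  fix z assume z: "z \<in> cvec n" and le: "\<And>k. k < n \<Longrightarrow> cmod (z k) \<le> 1 / (2 * (S + 1))"
  have "Xn_norm N n z \<le> (\<Sum>k<n. cmod (z k) * N (unit_seq k))" by (rule Xn_norm_le_sum)
  also have "\<dots> \<le> (\<Sum>k<n. 1 / (2 * (S + 1)) * N (unit_seq k))"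
    using le N_unit_seq_pos by (intro sum_mono mult_right_mono) (auto simp: less_imp_le)
  also have "\<dots> = 1 / (2 * (S + 1)) * S" unfolding S_def by (simp add: sum_distrib_left)
  also have "\<dots> < 1" using S by (simp add: field_simps)
  finally show "z \<in> B" using z by (simp add: XBall_def)
qed

lemma ball_solid: "z \<in> B \<Longrightarrow> y \<in> cvec n \<Longrightarrow> (\<And>k. k < n \<Longrightarrow> cmod (y k) \<le> cmod (z k)) \<Longrightarrow> y \<in> B"
  using Xn_norm_mono[of y z] by (auto simp: XBall_def)

lemma zero_in_ball: "(\<lambda>_. 0) \<in> B"
proof -
  obtain \<rho> where "\<rho> > 0" "\<And>z. z \<in> cvec n \<Longrightarrow> (\<And>k. k < n \<Longrightarrow> cmod (z k) \<le> \<rho>) \<Longrightarrow> z \<in> B"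
    using polydisc_in_ball by metis
  then show ?thesis by (simp add: cvec_def)
qed

lemma rotate_in_ball: "M > 0 \<Longrightarrow> t \<in> torus M n \<Longrightarrow> z \<in> B \<Longrightarrow> (\<lambda>k. t k * z k) \<in> B"
  by (rule ball_solid[of z]) (auto simp: XBall_def cvec_def norm_mult norm_torus)

section \<open>Supremum norms of polynomials and the norm of the coefficient projection\<close>

lemma mono_le_power:
  assumes "\<And>k. k < n \<Longrightarrow> cmod (z k) \<le> R"
  shows "cmod (mono n \<alpha> z) \<le> R ^ deg n \<alpha>"
proof -
  have "cmod (mono n \<alpha> z) = (\<Prod>k<n. cmod (z k) ^ \<alpha> k)" by (simp add: mono_def prod_norm[symmetric] norm_power)
  also have "\<dots> \<le> (\<Prod>k<n. R ^ \<alpha> k)" using assms by (intro prod_mono) (auto intro: power_mono)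
  also have "\<dots> = R ^ deg n \<alpha>" by (simp add: deg_def power_sum)
  finally show ?thesis .
qed

lemma poly_eval_bounded:
  assumes "finite I"
  obtains K where "\<And>z. z \<in> B \<Longrightarrow> cmod (poly_eval n I c z) \<le> K"
proof -
  obtain R where R: "R \<ge> 1" "\<And>z k. z \<in> B \<Longrightarrow> cmod (z k) \<le> R" using ball_coordinate_le by metis
  show thesis
  proof
    fix z assume z: "z \<in> B"
    show "cmod (poly_eval n I c z) \<le> (\<Sum>\<alpha>\<in>I. cmod (c \<alpha>) * R ^ deg n \<alpha>)"
      unfolding poly_eval_def
      by (rule sum_norm_le) (use R(2)[OF z] in \<open>auto simp: norm_mult intro!: mult_left_mono mono_le_power\<close>)
  qed
qed

lemma poly_eval_le_polynorm:
  assumes "finite I" "z \<in> B"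
  shows "cmod (poly_eval n I c z) \<le> polynorm N n I c"
proof -
  obtain K where "\<And>z. z \<in> B \<Longrightarrow> cmod (poly_eval n I c z) \<le> K" using poly_eval_bounded[OF assms(1)] by metis
  then have "bdd_above ((\<lambda>z. cmod (poly_eval n I c z)) ` B)" by (auto intro!: bdd_aboveI[of _ K])
  then show ?thesis unfolding polynorm_def using assms(2) by (intro cSUP_upper)
qed

lemma polynorm_least:
  assumes "\<And>z. z \<in> B \<Longrightarrow> cmod (poly_eval n I c z) \<le> K"
  shows "polynorm N n I c \<le> K"
  unfolding polynorm_def using zero_in_ball assms by (intro cSUP_least) auto

lemma polynorm_nonneg: "finite I \<Longrightarrow> 0 \<le> polynorm N n I c"
  using poly_eval_le_polynorm[of I "\<lambda>_. 0" c] zero_in_ball norm_ge_zero order.trans by blast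

lemma polynorm_scale:
  assumes "finite I"
  shows "polynorm N n I (\<lambda>\<alpha>. s * c \<alpha>) \<le> cmod s * polynorm N n I c"
proof (rule polynorm_least)
  fix z assume z: "z \<in> B"
  have "poly_eval n I (\<lambda>\<alpha>. s * c \<alpha>) z = s * poly_eval n I c z"
    by (simp add: poly_eval_def sum_distrib_left mult.assoc)
  then show "cmod (poly_eval n I (\<lambda>\<alpha>. s * c \<alpha>) z) \<le> cmod s * polynorm N n I c"
    using poly_eval_le_polynorm[OF assms z, of c] by (simp add: norm_mult mult_left_mono)
qed

lemma mono_mult: "mono n \<alpha> (\<lambda>k. s k * z k) = mono n \<alpha> s * mono n \<alpha> z"
  by (simp add: mono_def power_mult_distrib prod.distrib)

lemma mono_scale: "\<alpha> \<in> Lambda m n \<Longrightarrow> mono n \<alpha> (\<lambda>k. s * z k) = s ^ m * mono n \<alpha> z"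
  unfolding mono_mult[of \<alpha> "\<lambda>_. s"] by (auto simp: mono_def Lambda_def deg_def power_sum)

lemma norm_mono_torus: "M > 0 \<Longrightarrow> t \<in> torus M n \<Longrightarrow> cmod (mono n \<alpha> t) = 1"
  by (simp add: mono_def prod_norm[symmetric] norm_power norm_torus)

text \<open>Rotating the coordinates multiplies each monomial by a character of the torus, so
  orthogonality isolates one term; \<open>M > m\<close> keeps all exponents below
  \<open>M\<close>.\<close>

lemma torus_coeff:
  assumes I: "I \<subseteq> Lambda m n" and \<alpha>: "\<alpha> \<in> I" and M: "M > m"
  shows "(\<Sum>t\<in>torus M n. cnj (mono n \<alpha> t) * poly_eval n I c (\<lambda>k. t k * z k)) = of_nat (M ^ n) * (c \<alpha> * mono n \<alpha> z)"
proof -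
  have fI: "finite I" using I by (rule finite_subset) simp
  have lt: "\<beta> k < M" if "\<beta> \<in> I" "k < n" for \<beta> k
    using that I Lambda_subset_ibox[of m n] M by (force simp: ibox_def)
  have mul: "\<beta> \<in> multi n" if "\<beta> \<in> I" for \<beta> using that I by (auto simp: Lambda_def)
  have "(\<Sum>t\<in>torus M n. cnj (mono n \<alpha> t) * poly_eval n I c (\<lambda>k. t k * z k))
      = (\<Sum>t\<in>torus M n. \<Sum>\<beta>\<in>I. (c \<beta> * mono n \<beta> z) * (mono n \<beta> t * cnj (mono n \<alpha> t)))"
    unfolding poly_eval_def mono_mult by (simp add: sum_distrib_left mult_ac)
  also have "\<dots> = (\<Sum>\<beta>\<in>I. (c \<beta> * mono n \<beta> z) * (\<Sum>t\<in>torus M n. mono n \<beta> t * cnj (mono n \<alpha> t)))"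
    by (subst sum.swap) (simp add: sum_distrib_left)
  also have "\<dots> = (\<Sum>\<beta>\<in>I. (c \<beta> * mono n \<beta> z) * (if \<beta> = \<alpha> then of_nat (M ^ n) else 0))"
    using \<alpha> lt mul by (intro sum.cong refl arg_cong2[where f = "(*)"] mono_orthogonal) auto
  also have "\<dots> = of_nat (M ^ n) * (c \<alpha> * mono n \<alpha> z)"
    using \<alpha> fI by (simp add: if_distrib sum.delta cong: if_cong)
  finally show ?thesis .
qed

lemma coeff_mono_le_polynorm:
  assumes I: "I \<subseteq> Lambda m n" and \<alpha>: "\<alpha> \<in> I" and z: "z \<in> B"
  shows "cmod (c \<alpha> * mono n \<alpha> z) \<le> polynorm N n I c"
proof -
  have fI: "finite I" using I by (rule finite_subset) simp
  have "real (Suc m ^ n) * cmod (c \<alpha> * mono n \<alpha> z)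
      = cmod (\<Sum>t\<in>torus (Suc m) n. cnj (mono n \<alpha> t) * poly_eval n I c (\<lambda>k. t k * z k))"
    by (subst torus_coeff[OF I \<alpha>]) (auto simp: norm_mult norm_power simp del: of_nat_Suc)
  also have "\<dots> \<le> (\<Sum>t\<in>torus (Suc m) n. polynorm N n I c)"
    by (rule sum_norm_le)
      (auto simp: norm_mult norm_mono_torus[of "Suc m"] intro!: poly_eval_le_polynorm fI rotate_in_ball[of "Suc m"] z)
  also have "\<dots> = real (Suc m ^ n) * polynorm N n I c" by simp
  finally show ?thesis by (simp del: of_nat_Suc of_nat_power)
qed

lemma coeff_le_polynorm:
  obtains \<rho> where "\<rho> > 0" "\<And>I \<alpha> c m. I \<subseteq> Lambda m n \<Longrightarrow> \<alpha> \<in> I \<Longrightarrow> cmod (c \<alpha>) * \<rho> ^ m \<le> polynorm N n I c"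
proof -
  obtain \<rho> where \<rho>: "\<rho> > 0" "\<And>z. z \<in> cvec n \<Longrightarrow> (\<And>k. k < n \<Longrightarrow> cmod (z k) \<le> \<rho>) \<Longrightarrow> z \<in> B"
    using polydisc_in_ball by metis
  show thesis
  proof (rule that[OF \<rho>(1)])
    fix I \<alpha> c m assume I: "I \<subseteq> Lambda m n" and \<alpha>: "\<alpha> \<in> I"
    define z where "z k = (if k < n then complex_of_real \<rho> else 0)" for k
    have "z \<in> B" using \<rho> by (intro \<rho>(2)) (auto simp: z_def cvec_def)
    from coeff_mono_le_polynorm[OF I \<alpha> this, of c]
    have "cmod (c \<alpha>) * cmod (mono n \<alpha> z) \<le> polynorm N n I c" by (simp add: norm_mult)
    moreover have "cmod (mono n \<alpha> z) = \<rho> ^ m"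
    proof -
      have "mono n \<alpha> z = (\<Prod>k<n. of_real \<rho> ^ \<alpha> k)" unfolding mono_def by (rule prod.cong) (auto simp: z_def)
      also have "\<dots> = of_real \<rho> ^ m" using I \<alpha> by (auto simp: Lambda_def deg_def power_sum)
      finally show ?thesis using \<rho>(1) by (simp add: norm_power)
    qed
    ultimately show "cmod (c \<alpha>) * \<rho> ^ m \<le> polynorm N n I c" by simp
  qed
qed

lemma sum_coeff_mono_le_card:
  assumes I: "I \<subseteq> Lambda m n" and z: "z \<in> B"
  shows "(\<Sum>\<alpha>\<in>I. cmod (c \<alpha> * mono n \<alpha> z)) \<le> real (card I) * polynorm N n I c"
  using sum_bounded_above[of I "\<lambda>\<alpha>. cmod (c \<alpha> * mono n \<alpha> z)" "polynorm N n I c"]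
    coeff_mono_le_polynorm[OF I _ z] by simp

text \<open>A crude bound whose purpose is to make the real supremum in \<open>Qnorm\<close> one
  over a bounded set.\<close>

lemma polynorm_subset_le_card:
  assumes "I \<subseteq> Lambda m n"
  shows "polynorm N n I c \<le> real (card I) * polynorm N n (Lambda m n) c"
proof (rule polynorm_least)
  fix z assume z: "z \<in> B"
  have "cmod (poly_eval n I c z) \<le> (\<Sum>\<alpha>\<in>I. polynorm N n (Lambda m n) c)"
    unfolding poly_eval_def
    by (rule sum_norm_le, rule coeff_mono_le_polynorm[OF order.refl _ z]) (use assms in auto)
  then show "cmod (poly_eval n I c z) \<le> real (card I) * polynorm N n (Lambda m n) c" by simp
qed

lemma bdd_above_Qnorm:
  assumes "I \<subseteq> Lambda m n"
  shows "bdd_above {polynorm N n I c | c. polynorm N n (Lambda m n) c \<le> 1}"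
proof (rule bdd_aboveI)
  fix x assume "x \<in> {polynorm N n I c | c. polynorm N n (Lambda m n) c \<le> 1}"
  then obtain c where c: "x = polynorm N n I c" "polynorm N n (Lambda m n) c \<le> 1" by auto
  have "x \<le> real (card I) * polynorm N n (Lambda m n) c" unfolding c by (rule polynorm_subset_le_card[OF assms])
  also have "\<dots> \<le> real (card I) * 1" using c by (intro mult_left_mono) auto
  finally show "x \<le> real (card I)" by simp
qed

lemma polynorm_le_Qnorm:
  assumes I: "I \<subseteq> Lambda m n"
  shows "polynorm N n I c \<le> Qnorm N n (Lambda m n) I * polynorm N n (Lambda m n) c"
proof -
  define s where "s = polynorm N n (Lambda m n) c"
  have fI: "finite I" using I by (rule finite_subset) simp
  have s0: "s \<ge> 0" by (simp add: s_def polynorm_nonneg)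
  show ?thesis
  proof (cases "s = 0")
    \<comment> \<open>A polynomial of norm 0 cannot be normalised; the crude bound already gives the
      claim.\<close>
    case True
    then show ?thesis using polynorm_subset_le_card[OF I, of c] by (simp add: s_def)
  next
    case False
    define c' where "c' \<alpha> = of_real (1 / s) * c \<alpha>" for \<alpha>
    have "polynorm N n (Lambda m n) c' \<le> cmod (of_real (1 / s)) * s"
      unfolding c'_def s_def by (rule polynorm_scale) simp
    also have "\<dots> = 1" using False s0 by (simp add: norm_divide)
    finally have "polynorm N n I c' \<le> Qnorm N n (Lambda m n) I"
      unfolding Qnorm_def by (intro cSup_upper bdd_above_Qnorm[OF I]) auto
    moreover have "polynorm N n I c \<le> s * polynorm N n I c'"
    proof -
      have "c = (\<lambda>\<alpha>. of_real s * c' \<alpha>)" using False by (auto simp: c'_def)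
      then show ?thesis using polynorm_scale[OF fI, of "of_real s" c'] s0 by simp
    qed
    ultimately show ?thesis using s0 unfolding s_def[symmetric]
      by (metis mult.commute mult_left_mono order.trans)
  qed
qed

lemma polynorm_pos:
  assumes "I \<subseteq> Lambda m n" "\<alpha> \<in> I" "c \<alpha> \<noteq> 0"
  shows "polynorm N n I c > 0"
proof -
  obtain \<rho> where "\<rho> > 0" "cmod (c \<alpha>) * \<rho> ^ m \<le> polynorm N n I c"
    using coeff_le_polynorm assms by metis
  moreover have "cmod (c \<alpha>) * \<rho> ^ m > 0" using assms(3) \<open>\<rho> > 0\<close> by simp
  ultimately show ?thesis by simp
qed

text \<open>A single monomial of \<open>I\<close> is kept by the coefficient projection and has
  positive norm.\<close>

lemma Qnorm_ge_1:
  assumes I: "I \<subseteq> Lambda m n" and ne: "I \<noteq> {}"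
  shows "Qnorm N n (Lambda m n) I \<ge> 1"
proof -
  obtain \<alpha> where \<alpha>: "\<alpha> \<in> I" using ne by auto
  define c :: "(nat \<Rightarrow> nat) \<Rightarrow> complex" where "c \<beta> = (if \<beta> = \<alpha> then 1 else 0)" for \<beta>
  have "poly_eval n I c = poly_eval n (Lambda m n) c"
    unfolding poly_eval_def using I \<alpha> by (intro ext sum.mono_neutral_left) (auto simp: c_def)
  then have "polynorm N n I c = polynorm N n (Lambda m n) c" by (simp add: polynorm_def)
  moreover have "polynorm N n I c > 0" using I \<alpha> by (rule polynorm_pos) (simp add: c_def)
  ultimately show ?thesis using polynorm_le_Qnorm[OF I, of c] by simp
qed

text \<open>Along a complex line the polynomial has one variable and degree at most
  \<open>m\<close>; its linear coefficient is the directional derivative, which is thereby open to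
  one-variable coefficient estimates.\<close>

lemma poly_eval_line_deriv:
  assumes I: "I \<subseteq> Lambda m n"
  obtains b where "\<And>s. poly_eval n I c (\<lambda>k. w k + s * u k) = (\<Sum>i\<le>m. b i * s ^ i)"
    and "b 1 = (\<Sum>k<n. u k * poly_partial n I c k w)"
proof -
  define q where "q \<alpha> = (\<Prod>k<n. [:w k, u k:] ^ \<alpha> k)" for \<alpha>
  define p where "p = (\<Sum>\<alpha>\<in>I. smult (c \<alpha>) (q \<alpha>))"
  have fI: "finite I" using I by (rule finite_subset) simp
  have q: "poly (q \<alpha>) s = mono n \<alpha> (\<lambda>k. w k + s * u k)" for \<alpha> s
    by (simp add: q_def mono_def poly_prod poly_power)
  have "degree (q \<alpha>) \<le> m" if "\<alpha> \<in> I" for \<alpha>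
  proof -
    have "degree (q \<alpha>) \<le> sum (degree \<circ> (\<lambda>k. [:w k, u k:] ^ \<alpha> k)) {..<n}"
      unfolding q_def by (rule degree_prod_sum_le) simp
    also have "\<dots> \<le> (\<Sum>k<n. \<alpha> k)"
    proof (rule sum_mono)
      fix k
      have "degree ([:w k, u k:] ^ \<alpha> k) \<le> degree [:w k, u k:] * \<alpha> k" by (rule degree_power_le)
      also have "\<dots> \<le> 1 * \<alpha> k" by (intro mult_right_mono) auto
      finally show "(degree \<circ> (\<lambda>k. [:w k, u k:] ^ \<alpha> k)) k \<le> \<alpha> k" by simp
    qed
    finally show ?thesis using that I by (auto simp: Lambda_def deg_def)
  qed
  then have dp: "degree p \<le> m"
    unfolding p_def by (intro degree_sum_le fI) (meson degree_smult_le order.trans)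
  have pe: "poly p s = poly_eval n I c (\<lambda>k. w k + s * u k)" for s
    by (simp add: p_def poly_eval_def poly_sum q)
  have pq: "poly (pderiv (q \<alpha>)) 0 = (\<Sum>k<n. u k * (of_nat (\<alpha> k) * mono n (\<alpha>(k := \<alpha> k - 1)) w))" for \<alpha>
  proof -
    have "poly (pderiv (q \<alpha>)) 0
        = (\<Sum>k<n. (\<Prod>j\<in>{..<n} - {k}. w j ^ \<alpha> j) * (of_nat (\<alpha> k) * w k ^ (\<alpha> k - 1) * u k))"
      unfolding q_def pderiv_prod poly_sum
      by (rule sum.cong) (auto simp: poly_prod poly_power pderiv_power pderiv_pCons mult_ac)
    also have "\<dots> = (\<Sum>k<n. u k * (of_nat (\<alpha> k) * mono n (\<alpha>(k := \<alpha> k - 1)) w))"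
    proof (rule sum.cong[OF refl])
      fix k assume k: "k \<in> {..<n}"
      have e: "mono n (\<alpha>(k := \<alpha> k - 1)) w = w k ^ (\<alpha> k - 1) * (\<Prod>j\<in>{..<n} - {k}. w j ^ \<alpha> j)"
        using k by (intro mono_upd) simp
      show "(\<Prod>j\<in>{..<n} - {k}. w j ^ \<alpha> j) * (of_nat (\<alpha> k) * w k ^ (\<alpha> k - 1) * u k)
          = u k * (of_nat (\<alpha> k) * mono n (\<alpha>(k := \<alpha> k - 1)) w)" unfolding e by (simp only: mult_ac)
    qed
    finally show ?thesis .
  qed
  have "coeff p 1 = poly (pderiv p) 0" by (simp add: poly_0_coeff_0 coeff_pderiv)
  also have "\<dots> = (\<Sum>\<alpha>\<in>I. c \<alpha> * (\<Sum>k<n. u k * (of_nat (\<alpha> k) * mono n (\<alpha>(k := \<alpha> k - 1)) w)))"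
    unfolding pq[symmetric] p_def using higher_pderiv_sum[of 1 "\<lambda>\<alpha>. smult (c \<alpha>) (q \<alpha>)" I]
    by (simp add: pderiv_smult poly_sum)
  also have "\<dots> = (\<Sum>k<n. u k * poly_partial n I c k w)"
    unfolding poly_partial_def sum_distrib_left by (subst sum.swap) (simp add: mult_ac)
  finally have "coeff p 1 = (\<Sum>k<n. u k * poly_partial n I c k w)" .
  then show thesis using that[of "coeff p"] unfolding pe[symmetric] poly_coeff_sum[OF dp] by blast
qed

lemma poly_eval_homogeneous_le:
  assumes I: "I \<subseteq> Lambda m n" and s: "s > 0" and z: "z \<in> cvec n" "Xn_norm N n z < s"
  shows "cmod (poly_eval n I c z) \<le> s ^ m * polynorm N n I c"
proof -
  define y where "y k = of_real (1 / s) * z k" for k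
  have fI: "finite I" using I by (rule finite_subset) simp
  have "Xn_norm N n y = Xn_norm N n z / s" unfolding y_def Xn_norm_scale using s by (simp add: norm_divide)
  then have "y \<in> B" using s z by (auto simp: XBall_def cvec_def y_def)
  then have le: "cmod (poly_eval n I c y) \<le> polynorm N n I c" by (rule poly_eval_le_polynorm[OF fI])
  have zy: "z = (\<lambda>k. of_real s * y k)" using s by (auto simp: y_def)
  have "poly_eval n I c z = of_real s ^ m * poly_eval n I c y"
    unfolding poly_eval_def sum_distrib_left
  proof (rule sum.cong[OF refl])
    fix \<alpha> assume "\<alpha> \<in> I"
    then have "mono n \<alpha> z = of_real s ^ m * mono n \<alpha> y" unfolding zy using I by (intro mono_scale) auto
    then show "c \<alpha> * mono n \<alpha> z = of_real s ^ m * (c \<alpha> * mono n \<alpha> y)" by simp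
  qed
  then show ?thesis using le s by (simp add: norm_mult norm_power mult_left_mono)
qed

text \<open>Cauchy's estimate on the circle of radius \<open>1 / m\<close> in the line through
  \<open>w\<close> in direction \<open>u\<close>. That circle stays in the ball enlarged by
  \<open>1 + 1 / m\<close>, where homogeneity costs \<open>(1 + 1 / m) ^ m \<le> exp 1\<close>;
  dividing by the radius yields the factor \<open>m\<close>. This is the origin of the
  \<open>e\<close> in the theorem.\<close>

lemma deriv_le_polynorm:
  assumes I: "I \<subseteq> Lambda m n" and m: "m \<ge> 1" and w: "w \<in> B" and u: "u \<in> B"
  shows "cmod (\<Sum>k<n. u k * poly_partial n I c k w)
    \<le> real m * exp 1 * polynorm N n I c"
proof -
  obtain b where b: "\<And>s. poly_eval n I c (\<lambda>k. w k + s * u k) = (\<Sum>i\<le>m. b i * s ^ i)"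
    and b1: "b 1 = (\<Sum>k<n. u k * poly_partial n I c k w)"
    using poly_eval_line_deriv[OF I, of c w u] by blast
  have fI: "finite I" using I by (rule finite_subset) simp
  define r where "r = 1 / real m"
  have r: "r > 0" using m by (simp add: r_def)
  have "cmod (b 1 * of_real r ^ 1) \<le> (1 + r) ^ m * polynorm N n I c"
  proof (rule unit_roots_coeff_le[of 1 m "Suc m"])
    fix v assume v: "v \<in> unit_roots (Suc m)"
    have nv: "cmod v = 1" using norm_unit_roots[OF _ v] by simp
    have "(\<Sum>i\<le>m. b i * of_real r ^ i * v ^ i) = (\<Sum>i\<le>m. b i * (of_real r * v) ^ i)"
      by (simp add: power_mult_distrib mult_ac)
    also have "\<dots> = poly_eval n I c (\<lambda>k. w k + (of_real r * v) * u k)" by (simp add: b)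
    also have "cmod \<dots> \<le> (1 + r) ^ m * polynorm N n I c"
    proof (rule poly_eval_homogeneous_le[OF I])
      have "Xn_norm N n (\<lambda>k. w k + (of_real r * v) * u k) \<le> Xn_norm N n w + r * Xn_norm N n u"
        using Xn_norm_triangle[of w "\<lambda>k. (of_real r * v) * u k"] Xn_norm_scale[of "of_real r * v" u] nv r
        by (simp add: norm_mult)
      also have "\<dots> < 1 + r * 1"
        using w u r by (intro add_less_le_mono mult_left_mono) (auto simp: XBall_def)
      finally show "Xn_norm N n (\<lambda>k. w k + (of_real r * v) * u k) < 1 + r" by simp
    qed (use r w u in \<open>auto simp: cvec_def XBall_def\<close>)
    finally show "cmod (\<Sum>i\<le>m. b i * of_real r ^ i * v ^ i) \<le> (1 + r) ^ m * polynorm N n I c" .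
  qed (use m in auto)
  also have "\<dots> \<le> exp 1 * polynorm N n I c"
  proof (intro mult_right_mono polynorm_nonneg fI)
    have "(1 + r) ^ m \<le> exp r ^ m" using r by (intro power_mono exp_ge_add_one_self) auto
    also have "\<dots> = exp 1" using m by (simp add: r_def flip: exp_of_nat_mult)
    finally show "(1 + r) ^ m \<le> exp 1" .
  qed
  finally show ?thesis unfolding b1[symmetric] using m r by (simp add: r_def norm_divide field_simps)
qed

text \<open>The phases of the coordinates of \<open>u\<close> can be chosen freely.\<close>

lemma sum_abs_deriv_le_polynorm:
  assumes I: "I \<subseteq> Lambda m n" and m: "m \<ge> 1" and w: "w \<in> B" and u: "u \<in> B"
  shows "(\<Sum>k<n. cmod (u k) * cmod (poly_partial n I c k w))
    \<le> real m * exp 1 * polynorm N n I c"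
proof -
  define g where "g k = poly_partial n I c k w" for k
  define v where "v k = of_real (cmod (u k)) * cnj (sgn (g k))" for k
  have v: "v \<in> B"
  proof (rule ball_solid[OF u])
    show "v \<in> cvec n" using u by (auto simp: v_def XBall_def cvec_def)
    show "cmod (v k) \<le> cmod (u k)" for k by (simp add: v_def norm_mult norm_sgn)
  qed
  have "v k * g k = of_real (cmod (u k) * cmod (g k))" for k
    by (simp add: v_def mult.assoc cnj_sgn_mult)
  then have "(\<Sum>k<n. v k * g k) = of_real (\<Sum>k<n. cmod (u k) * cmod (g k))"
    by (simp only: of_real_sum)
  then have "cmod (\<Sum>k<n. v k * g k) = (\<Sum>k<n. cmod (u k) * cmod (g k))"
    by (simp only: norm_of_real) (simp add: sum_nonneg)
  then show ?thesis using deriv_le_polynorm[OF I m w v, of c] unfolding g_def by simp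
qed

end

section \<open>Projection constants\<close>

lemma flat_subset_Lambda: "flat n m I \<subseteq> Lambda (m - 1) n"
  by (auto simp: flat_def)

lemma finite_flat [simp]: "finite (flat n m I)"
  using flat_subset_Lambda by (rule finite_subset) simp

lemma pred_in_flat:
  assumes I: "I \<subseteq> Lambda m n" and \<alpha>: "\<alpha> \<in> I" and k: "k < n" "\<alpha> k > 0"
  shows "\<alpha>(k := \<alpha> k - 1) \<in> flat n m I"
proof -
  define \<beta> where "\<beta> = \<alpha>(k := \<alpha> k - 1)"
  have a: "deg n \<alpha> = m" "\<alpha> \<in> multi n" using I \<alpha> by (auto simp: Lambda_def)
  have "deg n \<beta> = m - 1" using deg_upd[OF k(1), of \<alpha> "\<alpha> k - 1"] k a by (simp add: \<beta>_def)
  moreover have "\<beta> \<in> multi n" "\<beta>(k := Suc (\<beta> k)) = \<alpha>" using a k by (auto simp: \<beta>_def multi_def)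
  ultimately have "\<beta> \<in> flat n m I" using \<alpha> k by (auto simp: flat_def Lambda_def)
  then show ?thesis by (simp add: \<beta>_def)
qed

lemma flat_nonempty:
  assumes I: "I \<subseteq> Lambda m n" and ne: "I \<noteq> {}" and m: "m \<ge> 1"
  shows "flat n m I \<noteq> {}"
proof -
  obtain \<alpha> where \<alpha>: "\<alpha> \<in> I" using ne by auto
  then have "(\<Sum>k<n. \<alpha> k) = m" using I by (auto simp: Lambda_def deg_def)
  then obtain k where k: "k < n" "\<alpha> k > 0" using m by (metis (no_types) gr0I lessThan_iff not_one_le_zero sum.neutral)
  then show ?thesis using pred_in_flat[OF I \<alpha>] by blast
qed

definition projection_onto :: "'a set \<Rightarrow> ('a \<Rightarrow> complex) set \<Rightarrow> (('a \<Rightarrow> complex) \<Rightarrow> 'a \<Rightarrow> complex) \<Rightarrow> bool" where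
  "projection_onto S Y P \<longleftrightarrow> (\<forall>g\<in>linf S. P g \<in> Y)
     \<and> (\<forall>g\<in>linf S. \<forall>h\<in>linf S. \<forall>a b. P (\<lambda>z. a * g z + b * h z) = (\<lambda>z. a * P g z + b * P h z))
     \<and> (\<forall>y\<in>Y. P y = y)
     \<and> (\<exists>C. \<forall>g\<in>linf S. supn S (P g) \<le> C * supn S g)"

lemma proj_const_alt:
  "proj_const S Y = Inf {Sup {supn S (P g) | g. g \<in> linf S \<and> supn S g \<le> 1} | P. projection_onto S Y P}"
  unfolding proj_const_def projection_onto_def ..

lemma linf_lincomb:
  assumes "g \<in> linf S" "h \<in> linf S"
  shows "(\<lambda>z. a * g z + b * h z) \<in> linf S"
proof -
  obtain K1 K2 where K: "\<And>z. z \<in> S \<Longrightarrow> cmod (g z) \<le> K1" "\<And>z. z \<in> S \<Longrightarrow> cmod (h z) \<le> K2"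
    using assms unfolding linf_def by blast
  have "cmod (a * g z + b * h z) \<le> cmod a * K1 + cmod b * K2" if "z \<in> S" for z
    using K[OF that] norm_triangle_ineq[of "a * g z" "b * h z"]
    by (smt (verit) mult_left_mono norm_ge_zero norm_mult)
  then show ?thesis using assms by (auto simp: linf_def)
qed

lemma linf_zero [simp]: "(\<lambda>_. 0) \<in> linf S"
  by (auto simp: linf_def)

lemma linf_scale: "g \<in> linf S \<Longrightarrow> (\<lambda>z. a * g z) \<in> linf S"
  using linf_lincomb[of g S g a 0] by simp

lemma linf_sum:
  assumes "finite W" "\<And>a. a \<in> W \<Longrightarrow> f a \<in> linf S"
  shows "(\<lambda>z. \<Sum>a\<in>W. s a * f a z) \<in> linf S"
  using assms
proof (induction W rule: finite_induct)
  case (insert x W)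
  then show ?case using linf_lincomb[of "f x" S "\<lambda>z. \<Sum>a\<in>W. s a * f a z" "s x" 1] by simp
qed simp

lemma supn_upper: "g \<in> linf S \<Longrightarrow> z \<in> S \<Longrightarrow> cmod (g z) \<le> supn S g"
  unfolding supn_def by (intro cSUP_upper) (auto simp: linf_def bdd_above_def)

lemma supn_least: "S \<noteq> {} \<Longrightarrow> (\<And>z. z \<in> S \<Longrightarrow> cmod (g z) \<le> K) \<Longrightarrow> supn S g \<le> K"
  unfolding supn_def by (rule cSUP_least)

lemma supn_nonneg: "S \<noteq> {} \<Longrightarrow> g \<in> linf S \<Longrightarrow> 0 \<le> supn S g"
  using supn_upper[of g S] norm_ge_zero order.trans by blast

lemma supn_scale:
  assumes "S \<noteq> {}" "g \<in> linf S"
  shows "supn S (\<lambda>z. a * g z) \<le> cmod a * supn S g"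
  using supn_upper[OF assms(2)] by (intro supn_least assms(1)) (auto simp: norm_mult mult_left_mono)

lemma linear_functional_sum:
  fixes E :: "('a \<Rightarrow> complex) \<Rightarrow> complex"
  assumes lin: "\<And>g h a b. g \<in> linf S \<Longrightarrow> h \<in> linf S \<Longrightarrow> E (\<lambda>z. a * g z + b * h z) = a * E g + b * E h"
    and "finite W" "\<And>a. a \<in> W \<Longrightarrow> f a \<in> linf S"
  shows "E (\<lambda>z. \<Sum>a\<in>W. s a * f a z) = (\<Sum>a\<in>W. s a * E (f a))"
  using assms(2,3)
proof (induction W rule: finite_induct)
  case empty
  then show ?case using lin[of "\<lambda>_. 0" "\<lambda>_. 0" 0 0] by simp
next
  case (insert x W)
  then show ?case using lin[of "f x" "\<lambda>z. \<Sum>a\<in>W. s a * f a z" "s x" 1] linf_sum[of W f S s] by simp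
qed

text \<open>Passes from the supremum over the unit ball in \<open>proj_const\<close> to an
  inequality for every \<open>g\<close>. The qualitative constant \<open>C\<close> of the projection
  makes that supremum one over a bounded set and settles the case
  \<open>supn S g = 0\<close>.\<close>

lemma projection_norm_le:
  assumes S: "S \<noteq> {}" and P: "projection_onto S Y P" and Y: "Y \<subseteq> linf S"
    and L: "Sup {supn S (P g) | g. g \<in> linf S \<and> supn S g \<le> 1} \<le> L" and g: "g \<in> linf S"
  shows "supn S (P g) \<le> L * supn S g"
proof -
  obtain C where C: "\<And>g. g \<in> linf S \<Longrightarrow> supn S (P g) \<le> C * supn S g"
    using P unfolding projection_onto_def by blast
  define s where "s = supn S g"
  have s0: "s \<ge> 0" using supn_nonneg[OF S g] by (simp add: s_def)
  show ?thesis
  proof (cases "s = 0")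
    case True
    then show ?thesis using C[OF g] by (simp add: s_def)
  next
    case False
    define h where "h z = of_real (1 / s) * g z" for z
    have h: "h \<in> linf S" unfolding h_def by (rule linf_scale[OF g])
    have "supn S h \<le> cmod (of_real (1 / s)) * s" unfolding h_def s_def by (rule supn_scale[OF S g])
    also have "\<dots> = 1" using False s0 by (simp add: norm_divide)
    finally have h1: "supn S h \<le> 1" .
    have "bdd_above {supn S (P g) | g. g \<in> linf S \<and> supn S g \<le> 1}"
    proof (rule bdd_aboveI)
      fix x assume "x \<in> {supn S (P g) | g. g \<in> linf S \<and> supn S g \<le> 1}"
      then obtain f where f: "x = supn S (P f)" "f \<in> linf S" "supn S f \<le> 1" by auto
      have "x \<le> C * supn S f" using f C by simp
      also have "\<dots> \<le> \<bar>C\<bar> * 1" using f supn_nonneg[OF S f(2)] by (intro mult_mono) auto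
      finally show "x \<le> \<bar>C\<bar>" by simp
    qed
    then have "supn S (P h) \<le> Sup {supn S (P g) | g. g \<in> linf S \<and> supn S g \<le> 1}"
      using h h1 by (intro cSup_upper) auto
    then have Ph: "supn S (P h) \<le> L" using L by simp
    have "P h = (\<lambda>z. of_real (1 / s) * P g z)"
    proof -
      have "P (\<lambda>z. of_real (1 / s) * g z + 0 * g z) = (\<lambda>z. of_real (1 / s) * P g z + 0 * P g z)"
        using P g unfolding projection_onto_def by blast
      then show ?thesis by (simp add: h_def[abs_def])
    qed
    then have eq: "P g = (\<lambda>z. of_real s * P h z)" using False by auto
    have "P h \<in> linf S" using P h Y by (auto simp: projection_onto_def)
    then have "supn S (P g) \<le> s * supn S (P h)" unfolding eq using supn_scale[OF S, of "P h" "of_real s"] s0 by simp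
    also have "\<dots> \<le> s * L" using Ph s0 by (rule mult_left_mono)
    finally show ?thesis by (simp add: s_def mult.commute)
  qed
qed

context seq_lattice
begin

lemma ball_nonempty: "B \<noteq> {}"
  using zero_in_ball by auto

lemma polyspace_in_linf: "finite I \<Longrightarrow> polyspace N n I \<subseteq> linf B"
proof
  fix y assume fI: "finite I" and "y \<in> polyspace N n I"
  then obtain c where c: "y = (\<lambda>z. if z \<in> B then poly_eval n I c z else 0)" by (auto simp: polyspace_def)
  show "y \<in> linf B" unfolding c linf_def using poly_eval_le_polynorm[OF fI] by auto
qed

text \<open>A coefficient is a finite combination of values on the torus orbit of one point with all
  coordinates equal to \<open>\<rho>\<close>. Such combinations make sense for arbitrary functions,
  are linear, and are bounded on \<open>linf B\<close>.\<close>

lemma coefficient_functional: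
  "\<exists>\<Phi> K. K \<ge> 0 \<and> (\<forall>\<beta> g h a b. \<Phi> \<beta> (\<lambda>z. a * g z + b * h z) = a * \<Phi> \<beta> g + b * \<Phi> \<beta> h)
    \<and> (\<forall>\<beta>. \<forall>g\<in>linf B. cmod (\<Phi> \<beta> g) \<le> K * supn B g)
    \<and> (\<forall>I \<beta> c. I \<subseteq> Lambda m n \<longrightarrow> \<beta> \<in> I \<longrightarrow> \<Phi> \<beta> (\<lambda>z. if z \<in> B then poly_eval n I c z else 0) = c \<beta>)"
proof -
  obtain \<rho> where \<rho>: "\<rho> > 0" "\<And>z. z \<in> cvec n \<Longrightarrow> (\<And>k. k < n \<Longrightarrow> cmod (z k) \<le> \<rho>) \<Longrightarrow> z \<in> B"
    using polydisc_in_ball by metis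
  define z where "z k = (if k < n then complex_of_real \<rho> else 0)" for k
  have zB: "z \<in> B" using \<rho> by (intro \<rho>(2)) (auto simp: z_def cvec_def)
  have rot: "(\<lambda>k. t k * z k) \<in> B" if "t \<in> torus (Suc m) n" for t by (rule rotate_in_ball[OF _ that zB]) simp
  define T where "T = torus (Suc m) n"
  define D where "D = of_nat (Suc m ^ n) * complex_of_real \<rho> ^ m"
  have D: "D \<noteq> 0" using \<rho> by (simp add: D_def del: of_nat_Suc)
  define \<Phi> where "\<Phi> \<beta> g = (\<Sum>t\<in>T. cnj (mono n \<beta> t) * g (\<lambda>k. t k * z k)) / D" for \<beta> and g :: "(nat \<Rightarrow> complex) \<Rightarrow> complex"
  show ?thesis
  proof (rule exI[of _ \<Phi>], rule exI[of _ "real (card T) / cmod D"], intro conjI allI ballI impI)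
    show "0 \<le> real (card T) / cmod D" by simp
    show "\<Phi> \<beta> (\<lambda>z. a * g z + b * h z) = a * \<Phi> \<beta> g + b * \<Phi> \<beta> h" for \<beta> g h a b
      by (simp add: \<Phi>_def sum_distrib_left sum.distrib algebra_simps add_divide_distrib)
    show "cmod (\<Phi> \<beta> g) \<le> real (card T) / cmod D * supn B g" if g: "g \<in> linf B" for \<beta> g
    proof -
      have "cmod (\<Sum>t\<in>T. cnj (mono n \<beta> t) * g (\<lambda>k. t k * z k)) \<le> (\<Sum>t\<in>T. supn B g)"
        by (rule sum_norm_le) (auto simp: norm_mult norm_mono_torus[of "Suc m"] T_def intro!: supn_upper g rot)
      then show ?thesis by (simp add: \<Phi>_def norm_divide divide_right_mono)
    qed
    show "\<Phi> \<beta> (\<lambda>z. if z \<in> B then poly_eval n I c z else 0) = c \<beta>" if I: "I \<subseteq> Lambda m n" and \<beta>: "\<beta> \<in> I" for I \<beta> c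
    proof -
      have "(\<Sum>t\<in>T. cnj (mono n \<beta> t) * (if (\<lambda>k. t k * z k) \<in> B then poly_eval n I c (\<lambda>k. t k * z k) else 0))
          = (\<Sum>t\<in>T. cnj (mono n \<beta> t) * poly_eval n I c (\<lambda>k. t k * z k))"
        using rot by (intro sum.cong) (auto simp: T_def)
      also have "\<dots> = of_nat (Suc m ^ n) * (c \<beta> * mono n \<beta> z)"
        unfolding T_def by (rule torus_coeff[OF I \<beta>]) simp
      also have "mono n \<beta> z = of_real \<rho> ^ m"
      proof -
        have "mono n \<beta> z = (\<Prod>k<n. of_real \<rho> ^ \<beta> k)" unfolding mono_def by (rule prod.cong) (auto simp: z_def)
        also have "\<dots> = of_real \<rho> ^ m" using I \<beta> by (auto simp: Lambda_def deg_def power_sum)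
        finally show ?thesis .
      qed
      also have "of_nat (Suc m ^ n) * (c \<beta> * of_real \<rho> ^ m) = D * c \<beta>" by (simp only: D_def mult_ac)
      finally show ?thesis unfolding \<Phi>_def using D by simp
    qed
  qed
qed

text \<open>The infimum in \<open>proj_const\<close> is informative only over a nonempty set. The
  projection reads off the coefficients with \<open>\<Phi>\<close> and reassembles the
  polynomial.\<close>

lemma projection_exists:
  assumes I: "I \<subseteq> Lambda m n"
  obtains P where "projection_onto B (polyspace N n I) P"
proof -
  obtain \<Phi> :: "(nat \<Rightarrow> nat) \<Rightarrow> ((nat \<Rightarrow> complex) \<Rightarrow> complex) \<Rightarrow> complex" and K where \<Phi>: "K \<ge> 0"
    "\<forall>\<beta> g h a b. \<Phi> \<beta> (\<lambda>z. a * g z + b * h z) = a * \<Phi> \<beta> g + b * \<Phi> \<beta> h"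
    "\<forall>\<beta>. \<forall>g\<in>linf B. cmod (\<Phi> \<beta> g) \<le> K * supn B g"
    "\<forall>I \<beta> c. I \<subseteq> Lambda m n \<longrightarrow> \<beta> \<in> I \<longrightarrow> \<Phi> \<beta> (\<lambda>z. if z \<in> B then poly_eval n I c z else 0) = c \<beta>"
    using coefficient_functional[of m] by (elim exE conjE) (rule that)
  obtain R where R: "R \<ge> 1" "\<And>z k. z \<in> B \<Longrightarrow> cmod (z k) \<le> R" using ball_coordinate_le by metis
  define P where "P g = (\<lambda>z. if z \<in> B then poly_eval n I (\<lambda>\<beta>. \<Phi> \<beta> g) z else 0)" for g
  have "projection_onto B (polyspace N n I) P"
    unfolding projection_onto_def
  proof (intro conjI ballI allI)
    fix g h a b
    show "P g \<in> polyspace N n I" by (auto simp: P_def polyspace_def)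
    show "P (\<lambda>z. a * g z + b * h z) = (\<lambda>z. a * P g z + b * P h z)"
      by (auto simp: P_def \<Phi>(2) poly_eval_def sum_distrib_left sum.distrib algebra_simps)
  next
    fix y assume "y \<in> polyspace N n I"
    then obtain c where c: "y = (\<lambda>z. if z \<in> B then poly_eval n I c z else 0)" by (auto simp: polyspace_def)
    have "poly_eval n I (\<lambda>\<beta>. \<Phi> \<beta> y) = poly_eval n I c"
    proof (rule ext)
      have "\<Phi> \<beta> y = c \<beta>" if "\<beta> \<in> I" for \<beta> unfolding c using \<Phi>(4)[rule_format, OF I that] .
      then show "poly_eval n I (\<lambda>\<beta>. \<Phi> \<beta> y) z = poly_eval n I c z" for z
        unfolding poly_eval_def by (intro sum.cong) auto
    qed
    then have "P y = (\<lambda>z. if z \<in> B then poly_eval n I c z else 0)" by (simp only: P_def)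
    then show "P y = y" by (simp only: c)
  next
    show "\<exists>C. \<forall>g\<in>linf B. supn B (P g) \<le> C * supn B g"
    proof (intro exI ballI)
      fix g assume g: "g \<in> linf B"
      show "supn B (P g) \<le> (\<Sum>\<beta>\<in>I. K * R ^ m) * supn B g"
      proof (rule supn_least[OF ball_nonempty])
        fix z assume z: "z \<in> B"
        have "cmod (P g z) \<le> (\<Sum>\<beta>\<in>I. (K * supn B g) * R ^ m)"
          unfolding P_def poly_eval_def if_P[OF z]
        proof (rule sum_norm_le)
          fix \<beta> assume "\<beta> \<in> I"
          then have "cmod (mono n \<beta> z) \<le> R ^ m" using mono_le_power[of z R \<beta>] R(2)[OF z] I by (auto simp: Lambda_def)
          then show "cmod (\<Phi> \<beta> g * mono n \<beta> z) \<le> K * supn B g * R ^ m"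
            unfolding norm_mult using \<Phi>(1) \<Phi>(3) g supn_nonneg[OF ball_nonempty g] by (intro mult_mono) auto
        qed
        then show "cmod (P g z) \<le> (\<Sum>\<beta>\<in>I. K * R ^ m) * supn B g"
          by (simp add: sum_distrib_left sum_distrib_right mult_ac)
      qed
    qed
  qed
  then show thesis by (rule that)
qed

lemma near_optimal_projection:
  assumes I: "I \<subseteq> Lambda m n" and L: "poly_proj_const N n I < L"
  obtains P where "projection_onto B (polyspace N n I) P" "\<And>g. g \<in> linf B \<Longrightarrow> supn B (P g) \<le> L * supn B g"
proof -
  have fI: "finite I" using I by (rule finite_subset) simp
  let ?A = "{Sup {supn B (P g) | g. g \<in> linf B \<and> supn B g \<le> 1} | P. projection_onto B (polyspace N n I) P}"
  have ne: "?A \<noteq> {}" using projection_exists[OF I] by blast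
  have lt: "Inf ?A < L" using L unfolding poly_proj_const_def proj_const_alt .
  obtain x where "x \<in> ?A" "x < L" using cInf_lessD[OF ne lt] by (elim bexE) (rule that)
  then obtain P where P: "projection_onto B (polyspace N n I) P" "Sup {supn B (P g) | g. g \<in> linf B \<and> supn B g \<le> 1} < L"
    by auto
  show thesis
  proof (rule that[OF P(1)])
    show "supn B (P g) \<le> L * supn B g" if "g \<in> linf B" for g
      using projection_norm_le[OF ball_nonempty P(1) polyspace_in_linf[OF fI] less_imp_le[OF P(2)] that] .
  qed
qed

text \<open>A projection fixes a polynomial of positive norm, so no bound \<open>L < 1\<close> is
  possible. The resulting positivity is used when \<open>m\<close>-th roots are undone in the final
  theorem.\<close>

lemma poly_proj_const_ge_1:
  assumes I: "I \<subseteq> Lambda m n" and ne: "I \<noteq> {}"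
  shows "poly_proj_const N n I \<ge> 1"
proof (rule ccontr)
  assume "\<not> poly_proj_const N n I \<ge> 1"
  then obtain L where L: "poly_proj_const N n I < L" "L < 1" using dense by (metis linorder_not_le)
  obtain P where P: "projection_onto B (polyspace N n I) P" "\<And>g. g \<in> linf B \<Longrightarrow> supn B (P g) \<le> L * supn B g"
    using near_optimal_projection[OF I L(1)] by blast
  have fI: "finite I" using I by (rule finite_subset) simp
  obtain \<alpha> where \<alpha>: "\<alpha> \<in> I" using ne by auto
  define y where "y = (\<lambda>z. if z \<in> B then poly_eval n I (\<lambda>_. 1) z else 0)"
  have y: "y \<in> polyspace N n I" by (auto simp: y_def polyspace_def)
  have "supn B y = polynorm N n I (\<lambda>_. 1)"
    unfolding supn_def polynorm_def y_def by (rule arg_cong[where f = Sup], rule image_cong) auto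
  then have "supn B y > 0" using polynorm_pos[OF I \<alpha>, of "\<lambda>_. 1"] by simp
  moreover have "supn B y \<le> L * supn B y"
    using P(2)[of y] P(1) y polyspace_in_linf[OF fI] by (auto simp: projection_onto_def)
  ultimately show False using L(2) by simp
qed

text \<open>Finitely many bounded functions map the ball into a bounded set that finitely many small
  cells cover; \<open>\<tau>\<close> picks one representative for each pattern of cells. Composing
  with \<open>\<tau>\<close> gives step functions, on which a merely linear functional can be
  expanded. No continuity is involved.\<close>

lemma ball_discretization:
  fixes F :: "'i \<Rightarrow> (nat \<Rightarrow> complex) \<Rightarrow> complex"
  assumes A: "finite A" and bd: "\<forall>i\<in>A. \<forall>w\<in>B. cmod (F i w) \<le> K" and e: "e > 0"
  obtains \<tau> where "finite (\<tau> ` B)" "\<And>w. w \<in> B \<Longrightarrow> \<tau> w \<in> B"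
    "\<And>i w. i \<in> A \<Longrightarrow> w \<in> B \<Longrightarrow> cmod (F i w - F i (\<tau> w)) \<le> e"
proof -
  \<comment> \<open>Cells have side \<open>e / 2\<close>, since the errors of the real and imaginary
    parts add up.\<close>
  define cell where "cell x = \<lfloor>2 * x / e\<rfloor>" for x :: real
  have cell: "\<bar>x - y\<bar> \<le> e / 2" if "cell x = cell y" for x y
  proof -
    have "\<bar>2 * x / e - 2 * y / e\<bar> \<le> 1" using that unfolding cell_def by linarith
    then have "\<bar>2 * (x - y) / e\<bar> \<le> 1" by (simp add: diff_divide_distrib right_diff_distrib)
    then have "\<bar>2 * (x - y)\<bar> \<le> e" using e by (simp add: abs_divide del: abs_mult)
    then have "2 * \<bar>x - y\<bar> \<le> e" by (simp only: abs_mult abs_numeral)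
    then show ?thesis by simp
  qed
  define key where "key w = restrict (\<lambda>i. (cell (Re (F i w)), cell (Im (F i w)))) A" for w
  have "key ` B \<subseteq> A \<rightarrow>\<^sub>E {cell (- K)..cell K} \<times> {cell (- K)..cell K}"
  proof clarify
    fix w assume w: "w \<in> B"
    have mono: "cell x \<le> cell y" if "x \<le> y" for x y
      unfolding cell_def using that e by (intro floor_mono divide_right_mono) auto
    have "- K \<le> Re (F i w) \<and> Re (F i w) \<le> K \<and> - K \<le> Im (F i w) \<and> Im (F i w) \<le> K" if "i \<in> A" for i
      using bd[rule_format, OF that w] abs_Re_le_cmod[of "F i w"] abs_Im_le_cmod[of "F i w"] by linarith
    then show "key w \<in> A \<rightarrow>\<^sub>E {cell (- K)..cell K} \<times> {cell (- K)..cell K}"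
      unfolding key_def by (auto intro!: mono)
  qed
  then have fk: "finite (key ` B)" by (rule finite_subset) (use A in \<open>auto intro: finite_PiE\<close>)
  define \<tau> where "\<tau> w = (SOME w'. w' \<in> B \<and> key w' = key w)" for w
  have \<tau>: "\<tau> w \<in> B \<and> key (\<tau> w) = key w" if "w \<in> B" for w
    unfolding \<tau>_def using that by (intro someI[of "\<lambda>w'. w' \<in> B \<and> key w' = key w" w]) auto
  show thesis
  proof
    have "\<tau> ` B = (\<lambda>\<kappa>. SOME w'. w' \<in> B \<and> key w' = \<kappa>) ` key ` B"
      by (simp add: \<tau>_def image_image)
    then show "finite (\<tau> ` B)" using fk by simp
    show "\<tau> w \<in> B" if "w \<in> B" for w using \<tau> that by blast
    fix i w assume i: "i \<in> A" and w: "w \<in> B"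
    have "key w i = key (\<tau> w) i" using \<tau>[OF w] by simp
    then have "cell (Re (F i w)) = cell (Re (F i (\<tau> w)))" "cell (Im (F i w)) = cell (Im (F i (\<tau> w)))"
      using i by (auto simp: key_def)
    from cell[OF this(1)] cell[OF this(2)]
    show "cmod (F i w - F i (\<tau> w)) \<le> e"
      using cmod_le[of "F i w - F i (\<tau> w)"] by simp
  qed
qed

end

section \<open>The unconditional constant of the monomials\<close>

context seq_lattice
begin

text \<open>\<open>E \<alpha> k g\<close> is the coefficient at \<open>\<alpha>\<close> of \<open>z\<^sub>k (P g)(z)\<close>.\<close>

lemma shifted_coefficient_functional:
  assumes I: "I \<subseteq> Lambda m n" and m: "m \<ge> 1"
    and P: "projection_onto B (polyspace N n (flat n m I)) P"
    and L: "\<forall>g\<in>linf B. supn B (P g) \<le> L * supn B g"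
  shows "\<exists>E K. K \<ge> 0
    \<and> (\<forall>\<alpha> k. \<forall>g\<in>linf B. \<forall>h\<in>linf B. \<forall>a b. E \<alpha> k (\<lambda>z. a * g z + b * h z) = a * E \<alpha> k g + b * E \<alpha> k h)
    \<and> (\<forall>\<alpha> k. \<forall>g\<in>linf B. cmod (E \<alpha> k g) \<le> K * supn B g)
    \<and> (\<forall>\<alpha>\<in>I. \<forall>k<n. E \<alpha> k (\<lambda>w. if w \<in> B then mono n (\<alpha>(k := \<alpha> k - 1)) w else 0) = (if \<alpha> k = 0 then 0 else 1))
    \<and> (\<forall>G u. (\<forall>k<n. G k \<in> linf B) \<longrightarrow> u \<in> B \<longrightarrow>
         poly_eval n (Lambda m n) (\<lambda>\<alpha>. \<Sum>k<n. E \<alpha> k (G k)) u = P (\<lambda>w. \<Sum>k<n. u k * G k w) u)"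
proof -
  define I' where "I' = flat n m I"
  have I': "I' \<subseteq> Lambda (m - 1) n" unfolding I'_def by (rule flat_subset_Lambda)
  have fI': "finite I'" by (simp add: I'_def)
  obtain \<Phi> :: "(nat \<Rightarrow> nat) \<Rightarrow> ((nat \<Rightarrow> complex) \<Rightarrow> complex) \<Rightarrow> complex" and K where \<Phi>: "K \<ge> 0"
    "\<forall>\<beta> g h a b. \<Phi> \<beta> (\<lambda>z. a * g z + b * h z) = a * \<Phi> \<beta> g + b * \<Phi> \<beta> h"
    "\<forall>\<beta>. \<forall>g\<in>linf B. cmod (\<Phi> \<beta> g) \<le> K * supn B g"
    "\<forall>I \<beta> c. I \<subseteq> Lambda (m - 1) n \<longrightarrow> \<beta> \<in> I \<longrightarrow> \<Phi> \<beta> (\<lambda>z. if z \<in> B then poly_eval n I c z else 0) = c \<beta>"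
    using coefficient_functional[of "m - 1"] by (elim exE conjE) (rule that)
  have PY: "P g \<in> polyspace N n I'" if "g \<in> linf B" for g
    using P that unfolding projection_onto_def I'_def by blast
  have Plin: "P (\<lambda>z. a * g z + b * h z) = (\<lambda>z. a * P g z + b * P h z)" if "g \<in> linf B" "h \<in> linf B" for g h a b
    using P that unfolding projection_onto_def by blast
  have Pfix: "P y = y" if "y \<in> polyspace N n I'" for y
    using P that unfolding projection_onto_def I'_def by blast
  have Plinf: "P g \<in> linf B" if "g \<in> linf B" for g
    using PY[OF that] polyspace_in_linf[OF fI'] by blast
  have Pcoef: "P g z = poly_eval n I' (\<lambda>\<beta>. \<Phi> \<beta> (P g)) z" if g: "g \<in> linf B" and z: "z \<in> B" for g z
  proof -
    obtain c where c: "P g = (\<lambda>z. if z \<in> B then poly_eval n I' c z else 0)"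
      using PY[OF g] by (auto simp: polyspace_def)
    have "\<Phi> \<beta> (P g) = c \<beta>" if "\<beta> \<in> I'" for \<beta> unfolding c using \<Phi>(4)[rule_format, OF I' that] .
    then have "poly_eval n I' (\<lambda>\<beta>. \<Phi> \<beta> (P g)) z = poly_eval n I' c z"
      unfolding poly_eval_def by (intro sum.cong) auto
    then show ?thesis using z by (simp add: c)
  qed
  define pred where "pred \<alpha> k = \<alpha>(k := \<alpha> k - 1)" for \<alpha> :: "nat \<Rightarrow> nat" and k
  \<comment> \<open>Multiplication by \<open>z_k\<close> moves the coefficient at
    \<open>pred \<alpha> k\<close> to \<open>\<alpha>\<close>. For \<open>\<alpha> k = 0\<close>
    truncated subtraction would return \<open>\<alpha>\<close> itself, and outside \<open>I'\<close>
    the functional \<open>\<Phi>\<close> has no specified value on \<open>P g\<close>; both cases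
    are set to 0.\<close>
  define E where "E \<alpha> k g = (if \<alpha> k > 0 \<and> pred \<alpha> k \<in> I' then \<Phi> (pred \<alpha> k) (P g) else 0)" for \<alpha> k g
  have predI: "pred \<alpha> k \<in> I'" if "\<alpha> \<in> I" "k < n" "\<alpha> k > 0" for \<alpha> k
    unfolding pred_def I'_def by (rule pred_in_flat[OF I that])
  have E1: "E \<alpha> k (\<lambda>z. a * g z + b * h z) = a * E \<alpha> k g + b * E \<alpha> k h" if "g \<in> linf B" "h \<in> linf B" for \<alpha> k g h a b
    using \<Phi>(2) by (simp add: E_def Plin[OF that])
  have E2: "cmod (E \<alpha> k g) \<le> (K * \<bar>L\<bar>) * supn B g" if g: "g \<in> linf B" for \<alpha> k g
  proof -
    have s: "0 \<le> supn B g" by (rule supn_nonneg[OF ball_nonempty g])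
    have "cmod (\<Phi> \<beta> (P g)) \<le> (K * \<bar>L\<bar>) * supn B g" for \<beta>
    proof -
      have "cmod (\<Phi> \<beta> (P g)) \<le> K * supn B (P g)" using \<Phi>(3) Plinf[OF g] by blast
      also have "\<dots> \<le> K * (\<bar>L\<bar> * supn B g)"
        by (intro mult_left_mono \<Phi>(1) order.trans[OF L[rule_format, OF g]] mult_right_mono s) simp
      finally show ?thesis by (simp add: mult.assoc)
    qed
    moreover have "0 \<le> (K * \<bar>L\<bar>) * supn B g" using \<Phi>(1) s by simp
    ultimately show ?thesis by (simp add: E_def)
  qed
  have E3: "E \<alpha> k (\<lambda>w. if w \<in> B then mono n (\<alpha>(k := \<alpha> k - 1)) w else 0) = (if \<alpha> k = 0 then 0 else 1)"
    if "\<alpha> \<in> I" "k < n" for \<alpha> k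
  proof (cases "\<alpha> k = 0")
    case False
    define c :: "(nat \<Rightarrow> nat) \<Rightarrow> complex" where "c \<beta> = (if \<beta> = pred \<alpha> k then 1 else 0)" for \<beta>
    have pI: "pred \<alpha> k \<in> I'" using predI that False by simp
    have "poly_eval n I' c w = mono n (\<alpha>(k := \<alpha> k - 1)) w" for w
      using pI fI' unfolding poly_eval_def c_def
      by (simp add: pred_def if_distrib[of "\<lambda>x. x * _"] sum.delta cong: if_cong)
    then have eq: "(\<lambda>w. if w \<in> B then mono n (\<alpha>(k := \<alpha> k - 1)) w else 0) = (\<lambda>w. if w \<in> B then poly_eval n I' c w else 0)"
      by auto
    have "P (\<lambda>w. if w \<in> B then poly_eval n I' c w else 0) = (\<lambda>w. if w \<in> B then poly_eval n I' c w else 0)"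
      by (rule Pfix) (auto simp: polyspace_def)
    then show ?thesis unfolding eq E_def using False pI \<Phi>(4)[rule_format, OF I' pI, of c] by (simp add: c_def)
  qed (simp add: E_def)
  have E4: "poly_eval n (Lambda m n) (\<lambda>\<alpha>. \<Sum>k<n. E \<alpha> k (G k)) u = P (\<lambda>w. \<Sum>k<n. u k * G k w) u"
    if G: "\<And>k. k < n \<Longrightarrow> G k \<in> linf B" and u: "u \<in> B" for G u
  proof -
    have inner: "(\<Sum>\<alpha>\<in>Lambda m n. E \<alpha> k (G k) * mono n \<alpha> u) = u k * P (G k) u" if k: "k < n" for k
    proof -
      define up where "up \<beta> = \<beta>(k := Suc (\<beta> k))" for \<beta> :: "nat \<Rightarrow> nat"
      have pu: "pred (up \<beta>) k = \<beta>" for \<beta> by (auto simp: pred_def up_def)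
      have up: "up (pred \<alpha> k) = \<alpha>" if "\<alpha> k > 0" for \<alpha> using that by (auto simp: pred_def up_def)
      have monoup: "mono n (up \<beta>) u = u k * mono n \<beta> u" for \<beta>
        using mono_upd[OF k, of \<beta> "Suc (\<beta> k)" u] mono_upd[OF k, of \<beta> "\<beta> k" u] by (simp add: up_def)
      \<comment> \<open>Membership in \<open>flat\<close> provides an index in \<open>I\<close> for
        some coordinate, not for this \<open>k\<close>, so \<open>up \<beta>\<close> may leave
        \<open>I\<close>. This is why the coefficient projection has to enter afterwards.\<close>
      have upL: "up \<beta> \<in> Lambda m n" if "\<beta> \<in> I'" for \<beta>
      proof -
        have b: "\<beta> \<in> multi n" "deg n \<beta> = m - 1" using that I' by (auto simp: Lambda_def)
        have "deg n (up \<beta>) = Suc (deg n \<beta>)"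
          using deg_upd[OF k, of \<beta> "Suc (\<beta> k)"] by (simp add: up_def)
        then show ?thesis using b m k by (auto simp: Lambda_def multi_def up_def)
      qed
      have "(\<Sum>\<alpha>\<in>Lambda m n. E \<alpha> k (G k) * mono n \<alpha> u) = (\<Sum>\<alpha>\<in>up ` I'. E \<alpha> k (G k) * mono n \<alpha> u)"
      proof (rule sum.mono_neutral_right)
        show "up ` I' \<subseteq> Lambda m n" using upL by blast
        show "\<forall>\<alpha>\<in>Lambda m n - up ` I'. E \<alpha> k (G k) * mono n \<alpha> u = 0"
        proof
          fix \<alpha> assume a: "\<alpha> \<in> Lambda m n - up ` I'"
          have "\<not> (\<alpha> k > 0 \<and> pred \<alpha> k \<in> I')" using a up[of \<alpha>] by (metis DiffD2 imageI)
          then show "E \<alpha> k (G k) * mono n \<alpha> u = 0" unfolding E_def by (simp only: if_False mult_zero_left)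
        qed
      qed simp
      also have "\<dots> = (\<Sum>\<beta>\<in>I'. E (up \<beta>) k (G k) * mono n (up \<beta>) u)"
      proof (subst sum.reindex)
        show "inj_on up I'" by (rule inj_on_inverseI[of _ "\<lambda>\<alpha>. pred \<alpha> k"]) (rule pu)
      qed (simp add: o_def)
      also have "\<dots> = (\<Sum>\<beta>\<in>I'. u k * (\<Phi> \<beta> (P (G k)) * mono n \<beta> u))"
        by (rule sum.cong) (auto simp: E_def pu monoup, auto simp: up_def)
      also have "\<dots> = u k * P (G k) u"
        unfolding Pcoef[OF G[OF k] u] poly_eval_def by (simp add: sum_distrib_left)
      finally show ?thesis .
    qed
    \<comment> \<open>By linearity the numbers \<open>u k\<close> pass through \<open>P\<close> as
      constants before the result is evaluated at the same \<open>u\<close>. Hence one application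
      of the bound \<open>L\<close> suffices for all coordinates together.\<close>
    have "P (\<lambda>w. \<Sum>k<n. u k * G k w) u = (\<Sum>k<n. u k * P (G k) u)"
      using linear_functional_sum[of B "\<lambda>g. P g u" "{..<n}" G u] Plin G by simp
    also have "\<dots> = (\<Sum>k<n. \<Sum>\<alpha>\<in>Lambda m n. E \<alpha> k (G k) * mono n \<alpha> u)"
      using inner by simp
    also have "\<dots> = poly_eval n (Lambda m n) (\<lambda>\<alpha>. \<Sum>k<n. E \<alpha> k (G k)) u"
      unfolding poly_eval_def by (subst sum.swap) (simp add: sum_distrib_right)
    finally show ?thesis by simp
  qed
  have K': "0 \<le> K * \<bar>L\<bar>" using \<Phi>(1) by simp
  show ?thesis
    by (rule exI[of _ E], rule exI[of _ "K * \<bar>L\<bar>"], intro conjI ballI allI impI K' E1 E2 E3 E4) auto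
qed

text \<open>A Gordon--Lewis argument: writing the polynomial through the lattice of functions
  \<open>w \<mapsto> (\<partial>\<^sub>k P(w) / m)\<^sub>k\<close>, the diagonal pairing is bounded pointwise by
  hypercontractivity, and the resulting pairing of absolute values is an evaluation of the lifted
  polynomial at one point, up to a choice of phases.\<close>

lemma unconditional_estimate_aux:
  assumes I: "I \<subseteq> Lambda m n" and ne: "I \<noteq> {}" and m: "m \<ge> 1" and z: "z \<in> B"
    and P: "projection_onto B (polyspace N n (flat n m I)) P"
    and L: "\<forall>g\<in>linf B. supn B (P g) \<le> L * supn B g" and L0: "L \<ge> 0"
    and M: "M > 0" and C: "C \<ge> 0"
    and H: "\<And>a. bergman m a \<le> C * ((\<Sum>w\<in>unit_roots M. cmod (\<Sum>i\<le>m. a i * w ^ i)) / real M)"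
    and e: "e > 0"
  shows "(\<Sum>\<alpha>\<in>I. cmod (c \<alpha> * mono n \<alpha> z))
    \<le> 2 ^ m * C ^ (2 * n) * (exp 1 * Qnorm N n (Lambda m n) I * L * polynorm N n I c) + e"
proof -
  have fI: "finite I" using I by (rule finite_subset) simp
  obtain E :: "(nat \<Rightarrow> nat) \<Rightarrow> nat \<Rightarrow> ((nat \<Rightarrow> complex) \<Rightarrow> complex) \<Rightarrow> complex" and K where K: "K \<ge> 0"
    and E1: "\<forall>\<alpha> k. \<forall>g\<in>linf B. \<forall>h\<in>linf B. \<forall>a b. E \<alpha> k (\<lambda>z. a * g z + b * h z) = a * E \<alpha> k g + b * E \<alpha> k h"
    and E2: "\<forall>\<alpha> k. \<forall>g\<in>linf B. cmod (E \<alpha> k g) \<le> K * supn B g"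
    and E3: "\<forall>\<alpha>\<in>I. \<forall>k<n. E \<alpha> k (\<lambda>w. if w \<in> B then mono n (\<alpha>(k := \<alpha> k - 1)) w else 0) = (if \<alpha> k = 0 then 0 else 1)"
    and E4: "\<forall>G u. (\<forall>k<n. G k \<in> linf B) \<longrightarrow> u \<in> B \<longrightarrow>
         poly_eval n (Lambda m n) (\<lambda>\<alpha>. \<Sum>k<n. E \<alpha> k (G k)) u = P (\<lambda>w. \<Sum>k<n. u k * G k w) u"
    using shifted_coefficient_functional[OF I m P L] by (elim exE conjE) (rule that)
  obtain R where R: "R \<ge> 1" "\<And>z k. z \<in> B \<Longrightarrow> cmod (z k) \<le> R" using ball_coordinate_le by metis
  define F where "F \<alpha> k w = c \<alpha> * of_nat (\<alpha> k) * mono n (\<alpha>(k := \<alpha> k - 1)) w / of_nat m" for \<alpha> k w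
  have Fbd: "\<exists>K. \<forall>i\<in>I \<times> {..<n}. \<forall>w\<in>B. cmod (F (fst i) (snd i) w) \<le> K"
  proof (intro exI ballI)
    fix i w assume i: "i \<in> I \<times> {..<n}" and w: "w \<in> B"
    let ?h = "\<lambda>i. cmod (c (fst i)) * real (fst i (snd i)) * R ^ deg n ((fst i)((snd i) := fst i (snd i) - 1)) / real m"
    have "cmod (F (fst i) (snd i) w) \<le> ?h i"
      unfolding F_def norm_mult norm_divide norm_of_nat
      by (intro divide_right_mono mult_left_mono mono_le_power) (use R(2)[OF w] in auto)
    also have "\<dots> \<le> sum ?h (I \<times> {..<n})"
      using R i fI by (intro member_le_sum) auto
    finally show "cmod (F (fst i) (snd i) w) \<le> sum ?h (I \<times> {..<n})" .
  qed
  then obtain KF where KF: "\<forall>i\<in>I \<times> {..<n}. \<forall>w\<in>B. cmod (F (fst i) (snd i) w) \<le> KF" by blast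
  \<comment> \<open>The total discretization error collects \<open>card I\<close> terms, each with a
    monomial of size at most \<open>R ^ m\<close> and \<open>n\<close> coordinates with error
    \<open>K * \<eta>\<close>; the summand 1 prevents division by zero.\<close>
  define \<eta> where "\<eta> = e / (real (card I) * R ^ m * real n * K + 1)"
  have den: "real (card I) * R ^ m * real n * K \<ge> 0" using K R by simp
  have \<eta>: "\<eta> > 0" "real (card I) * (R ^ m * (real n * (K * \<eta>))) \<le> e"
  proof -
    show "\<eta> > 0" using e den by (simp add: \<eta>_def)
    have "(real (card I) * R ^ m * real n * K + 1) * \<eta> = e" using den by (simp add: \<eta>_def)
    then show "real (card I) * (R ^ m * (real n * (K * \<eta>))) \<le> e" using \<open>\<eta> > 0\<close> by (simp add: algebra_simps)
  qed
  have fA: "finite (I \<times> {..<n})" using fI by simp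
  obtain \<tau> where \<tau>: "finite (\<tau> ` B)" "\<And>w. w \<in> B \<Longrightarrow> \<tau> w \<in> B"
    "\<And>i w. i \<in> I \<times> {..<n} \<Longrightarrow> w \<in> B \<Longrightarrow> cmod (F (fst i) (snd i) w - F (fst i) (snd i) (\<tau> w)) \<le> \<eta>"
    using ball_discretization[OF fA KF \<eta>(1)] by blast
  define W where "W = \<tau> ` B"
  have fW: "finite W" using \<tau>(1) by (simp add: W_def)
  define ind where "ind a = (\<lambda>w. if w \<in> B \<and> \<tau> w = a then 1 else (0::complex))" for a
  have ind: "ind a \<in> linf B" for a unfolding linf_def ind_def by (auto intro!: exI[of _ 1])
  have step: "(\<Sum>a\<in>W. s a * ind a w) = (if w \<in> B then s (\<tau> w) else 0)" for s w
    using fW unfolding ind_def by (auto simp: W_def if_distrib[of "\<lambda>x. _ * x"] sum.delta cong: if_cong)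
  have Estep: "E \<alpha> k (\<lambda>w. if w \<in> B then s (\<tau> w) else 0) = (\<Sum>a\<in>W. s a * E \<alpha> k (ind a))" for \<alpha> k s
    unfolding step[symmetric] using E1 by (intro linear_functional_sum[of B] fW ind) auto
  have steplinf: "(\<lambda>w. if w \<in> B then s (\<tau> w) else 0) \<in> linf B" for s
    unfolding step[symmetric] by (rule linf_sum[OF fW ind])
  \<comment> \<open>\<open>F \<alpha> k a\<close> is the embedding applied to the term at
    \<open>\<alpha>\<close>, and \<open>r \<alpha> a k\<close> is the left inverse read off at the
    same \<open>\<alpha>\<close> and evaluated at \<open>z\<close>. Paired over \<open>a\<close> and
    \<open>k\<close> they form the diagonal entry at \<open>\<alpha>\<close>, which
    \<open>key1\<close> identifies with the term itself up to a small error.\<close>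
  define r where "r \<alpha> a k = mono n \<alpha> z * E \<alpha> k (ind a)" for \<alpha> a k
  have key1: "cmod (c \<alpha> * mono n \<alpha> z - (\<Sum>a\<in>W. \<Sum>k<n. r \<alpha> a k * F \<alpha> k a)) \<le> R ^ m * (real n * (K * \<eta>))"
    if \<alpha>: "\<alpha> \<in> I" for \<alpha>
  proof -
    define F0 where "F0 k = (\<lambda>w. if w \<in> B then F \<alpha> k w else 0)" for k
    define F1 where "F1 k = (\<lambda>w. if w \<in> B then F \<alpha> k (\<tau> w) else 0)" for k
    have mlinf: "(\<lambda>w. if w \<in> B then mono n \<beta> w else 0) \<in> linf B" for \<beta>
      unfolding linf_def using mono_le_power[of _ R \<beta>] R(2) by (auto intro!: exI[of _ "R ^ deg n \<beta>"])
    \<comment> \<open>The zero summand gives \<open>F0 k\<close> the two-term shape in which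
      linearity is available.\<close>
    have F0e: "F0 k = (\<lambda>w. (c \<alpha> * of_nat (\<alpha> k) / of_nat m) * (if w \<in> B then mono n (\<alpha>(k := \<alpha> k - 1)) w else 0)
        + 0 * (if w \<in> B then mono n (\<alpha>(k := \<alpha> k - 1)) w else 0))" for k
      by (auto simp: F0_def F_def)
    have F0l: "F0 k \<in> linf B" for k unfolding F0e by (intro linf_lincomb mlinf)
    have F1l: "F1 k \<in> linf B" for k unfolding F1_def by (rule steplinf)
    have EF0: "E \<alpha> k (F0 k) = c \<alpha> * of_nat (\<alpha> k) / of_nat m" if "k < n" for k
    proof -
      have "E \<alpha> k (F0 k) = c \<alpha> * of_nat (\<alpha> k) / of_nat m * E \<alpha> k (\<lambda>w. if w \<in> B then mono n (\<alpha>(k := \<alpha> k - 1)) w else 0)"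
        unfolding F0e E1[rule_format, OF mlinf mlinf] by simp
      then show ?thesis using E3 \<alpha> that by auto
    qed
    have diff: "cmod (E \<alpha> k (F0 k) - E \<alpha> k (F1 k)) \<le> K * \<eta>" if k: "k < n" for k
    proof -
      have "E \<alpha> k (F0 k) - E \<alpha> k (F1 k) = E \<alpha> k (\<lambda>w. 1 * F0 k w + (- 1) * F1 k w)"
        by (simp only: E1[rule_format, OF F0l F1l]) simp
      also have "cmod \<dots> \<le> K * supn B (\<lambda>w. 1 * F0 k w + (- 1) * F1 k w)"
        using E2 linf_lincomb[OF F0l F1l] by blast
      also have "\<dots> \<le> K * \<eta>"
        by (intro mult_left_mono supn_least ball_nonempty K) (use \<tau>(3)[of "(\<alpha>, k)"] \<alpha> k in \<open>auto simp: F0_def F1_def\<close>)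
      finally show ?thesis .
    qed
    \<comment> \<open>Euler's identity for homogeneous polynomials in terms of exponents; with the
      division by \<open>m\<close> in \<open>F\<close>, the sum over \<open>k\<close> returns
      \<open>c \<alpha>\<close>.\<close>
    have sum\<alpha>: "(\<Sum>k<n. complex_of_nat (\<alpha> k)) = of_nat m"
    proof -
      have "(\<Sum>k<n. \<alpha> k) = m" using I \<alpha> by (auto simp: Lambda_def deg_def)
      then show ?thesis by (metis of_nat_sum)
    qed
    have "(\<Sum>a\<in>W. \<Sum>k<n. r \<alpha> a k * F \<alpha> k a) = mono n \<alpha> z * (\<Sum>k<n. \<Sum>a\<in>W. F \<alpha> k a * E \<alpha> k (ind a))"
      unfolding r_def by (subst sum.swap) (simp add: sum_distrib_left mult_ac)
    also have "\<dots> = mono n \<alpha> z * (\<Sum>k<n. E \<alpha> k (F1 k))"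
      unfolding F1_def Estep ..
    finally have s1: "(\<Sum>a\<in>W. \<Sum>k<n. r \<alpha> a k * F \<alpha> k a) = mono n \<alpha> z * (\<Sum>k<n. E \<alpha> k (F1 k))" .
    have "(\<Sum>k<n. E \<alpha> k (F0 k)) = (\<Sum>k<n. c \<alpha> / of_nat m * of_nat (\<alpha> k))" using EF0 by simp
    also have "\<dots> = c \<alpha>" unfolding sum_distrib_left[symmetric] sum\<alpha> using m by simp
    finally have s0: "c \<alpha> * mono n \<alpha> z = mono n \<alpha> z * (\<Sum>k<n. E \<alpha> k (F0 k))" by simp
    have "cmod (c \<alpha> * mono n \<alpha> z - (\<Sum>a\<in>W. \<Sum>k<n. r \<alpha> a k * F \<alpha> k a))
        = cmod (mono n \<alpha> z) * cmod (\<Sum>k<n. E \<alpha> k (F0 k) - E \<alpha> k (F1 k))"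
      unfolding s0 s1 by (simp only: right_diff_distrib[symmetric] norm_mult sum_subtractf)
    also have "\<dots> \<le> R ^ m * (\<Sum>k<n. K * \<eta>)"
    proof (intro mult_mono sum_norm_le)
      show "cmod (mono n \<alpha> z) \<le> R ^ m" using mono_le_power[of z R \<alpha>] R(2)[OF z] I \<alpha> by (auto simp: Lambda_def)
    qed (use diff R in auto)
    finally show ?thesis by simp
  qed
  have "(\<Sum>\<alpha>\<in>I. cmod (c \<alpha> * mono n \<alpha> z))
      \<le> (\<Sum>\<alpha>\<in>I. (\<Sum>a\<in>W. \<Sum>k<n. cmod (r \<alpha> a k) * cmod (F \<alpha> k a)) + R ^ m * (real n * (K * \<eta>)))"
  proof (rule sum_mono)
    fix \<alpha> assume \<alpha>: "\<alpha> \<in> I"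
    have "cmod (\<Sum>a\<in>W. \<Sum>k<n. r \<alpha> a k * F \<alpha> k a) \<le> (\<Sum>a\<in>W. \<Sum>k<n. cmod (r \<alpha> a k) * cmod (F \<alpha> k a))"
      by (intro sum_norm_le) (simp add: norm_mult)
    then show "cmod (c \<alpha> * mono n \<alpha> z) \<le> (\<Sum>a\<in>W. \<Sum>k<n. cmod (r \<alpha> a k) * cmod (F \<alpha> k a)) + R ^ m * (real n * (K * \<eta>))"
      using key1[OF \<alpha>] norm_triangle_ineq2[of "c \<alpha> * mono n \<alpha> z" "\<Sum>a\<in>W. \<Sum>k<n. r \<alpha> a k * F \<alpha> k a"] by linarith
  qed
  also have "\<dots> = (\<Sum>\<alpha>\<in>I. \<Sum>a\<in>W. \<Sum>k<n. cmod (r \<alpha> a k) * cmod (F \<alpha> k a)) + real (card I) * (R ^ m * (real n * (K * \<eta>)))"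
    by (simp add: sum.distrib)
  also have "\<dots> \<le> (\<Sum>\<alpha>\<in>I. \<Sum>a\<in>W. \<Sum>k<n. cmod (r \<alpha> a k) * cmod (F \<alpha> k a)) + e"
    using \<eta>(2) by simp
  also have "(\<Sum>\<alpha>\<in>I. \<Sum>a\<in>W. \<Sum>k<n. cmod (r \<alpha> a k) * cmod (F \<alpha> k a))
      = (\<Sum>a\<in>W. \<Sum>k<n. \<Sum>\<alpha>\<in>I. cmod (r \<alpha> a k) * cmod (F \<alpha> k a))"
    by (subst sum.swap, rule sum.cong[OF refl], rule sum.swap)
  also have "\<dots> \<le> 2 ^ m * C ^ (2 * n) * (exp 1 * Qnorm N n (Lambda m n) I * L * polynorm N n I c)"
  proof -
    define x where "x t a k = poly_eval n I (\<lambda>\<alpha>. r \<alpha> a k) t" for t a k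
    define D where "D s a k = poly_eval n I (\<lambda>\<alpha>. F \<alpha> k a) s" for s a k
    define T where "T = torus M n"
    define S where "S = exp 1 * Qnorm N n (Lambda m n) I * L * polynorm N n I c"
    have key3: "(\<Sum>a\<in>W. \<Sum>k<n. cmod (x t a k) * cmod (D s a k)) \<le> S" if t: "t \<in> T" and s: "s \<in> T" for t s
    proof -
      \<comment> \<open>The phase of \<open>\<theta>\<close> cancels that of \<open>x\<close>, so
        the pairing of absolute values becomes a genuine evaluation; its modulus is at most that of
        \<open>D\<close>, so the function built from it is dominated by the embedded
        polynomial.\<close>
      define \<theta> where "\<theta> a k = cnj (sgn (x t a k)) * of_real (cmod (D s a k))" for a k
      have x\<theta>: "\<theta> a k * x t a k = of_real (cmod (x t a k) * cmod (D s a k))" for a k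
        using cnj_sgn_mult[of "x t a k"] by (simp add: \<theta>_def mult_ac)
      define G where "G k = (\<lambda>w. if w \<in> B then \<theta> (\<tau> w) k else 0)" for k
      have G: "G k \<in> linf B" for k unfolding G_def by (rule steplinf)
      have EG: "E \<alpha> k (G k) = (\<Sum>a\<in>W. \<theta> a k * E \<alpha> k (ind a))" for \<alpha> k
        unfolding G_def by (rule Estep[of \<alpha> k "\<lambda>a. \<theta> a k"])
      define d where "d \<alpha> = (\<Sum>k<n. E \<alpha> k (G k))" for \<alpha>
      have tz: "(\<lambda>k. t k * z k) \<in> B" using t M z by (auto simp: T_def intro: rotate_in_ball)
      have "of_real (\<Sum>a\<in>W. \<Sum>k<n. cmod (x t a k) * cmod (D s a k)) = (\<Sum>a\<in>W. \<Sum>k<n. \<theta> a k * x t a k)"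
        unfolding x\<theta> by (simp only: of_real_sum)
      also have "\<dots> = (\<Sum>a\<in>W. \<Sum>k<n. \<Sum>\<alpha>\<in>I. (\<theta> a k * E \<alpha> k (ind a)) * (mono n \<alpha> t * mono n \<alpha> z))"
        unfolding x_def poly_eval_def r_def by (simp add: sum_distrib_left mult_ac)
      also have "\<dots> = (\<Sum>\<alpha>\<in>I. \<Sum>k<n. \<Sum>a\<in>W. (\<theta> a k * E \<alpha> k (ind a)) * (mono n \<alpha> t * mono n \<alpha> z))"
        unfolding sum.swap[of _ I "{..<n}"] by (subst sum.swap) (intro sum.cong refl sum.swap)
      also have "\<dots> = (\<Sum>\<alpha>\<in>I. d \<alpha> * mono n \<alpha> (\<lambda>k. t k * z k))"
        unfolding d_def EG mono_mult by (simp add: sum_distrib_right)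
      also have "\<dots> = poly_eval n I d (\<lambda>k. t k * z k)" by (simp add: poly_eval_def)
      finally have eq: "of_real (\<Sum>a\<in>W. \<Sum>k<n. cmod (x t a k) * cmod (D s a k)) = poly_eval n I d (\<lambda>k. t k * z k)" .
      have "(\<Sum>a\<in>W. \<Sum>k<n. cmod (x t a k) * cmod (D s a k)) \<le> cmod (poly_eval n I d (\<lambda>k. t k * z k))"
        unfolding eq[symmetric] norm_of_real by (rule abs_ge_self)
      also have "\<dots> \<le> polynorm N n I d" by (rule poly_eval_le_polynorm[OF fI tz])
      also have "\<dots> \<le> Qnorm N n (Lambda m n) I * polynorm N n (Lambda m n) d" by (rule polynorm_le_Qnorm[OF I])
      also have "\<dots> \<le> Qnorm N n (Lambda m n) I * (L * (exp 1 * polynorm N n I c))"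
      proof (rule mult_left_mono)
        show "0 \<le> Qnorm N n (Lambda m n) I" using Qnorm_ge_1[OF I ne] by simp
        show "polynorm N n (Lambda m n) d \<le> L * (exp 1 * polynorm N n I c)"
        proof (rule polynorm_least)
          fix u assume u: "u \<in> B"
          define g where "g = (\<lambda>w. \<Sum>k<n. u k * G k w)"
          have g: "g \<in> linf B" unfolding g_def by (rule linf_sum) (auto simp: G)
          have Pg: "P g \<in> linf B"
            using P g polyspace_in_linf[of "flat n m I"] unfolding projection_onto_def by auto
          have "poly_eval n (Lambda m n) d u = P g u"
            unfolding d_def g_def using E4 G u by auto
          also have "cmod \<dots> \<le> supn B (P g)" by (rule supn_upper[OF Pg u])
          also have "\<dots> \<le> L * supn B g" using L g by blast
          also have "\<dots> \<le> L * (exp 1 * polynorm N n I c)"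
          proof (intro mult_left_mono L0 supn_least ball_nonempty)
            fix w assume w: "w \<in> B"
            \<comment> \<open>\<open>c'\<close> are the coefficients of the polynomial rotated by
              \<open>s\<close>. The ball is invariant under rotations, so its norm is no larger, and
              \<open>D s\<close> is its gradient divided by \<open>m\<close>.\<close>
            define c' where "c' \<alpha> = c \<alpha> * mono n \<alpha> s" for \<alpha>
            have c'n: "polynorm N n I c' \<le> polynorm N n I c"
            proof (rule polynorm_least)
              fix v assume v: "v \<in> B"
              have "poly_eval n I c' v = poly_eval n I c (\<lambda>k. s k * v k)"
                unfolding poly_eval_def c'_def mono_mult by (simp add: mult_ac)
              then show "cmod (poly_eval n I c' v) \<le> polynorm N n I c"
                using poly_eval_le_polynorm[OF fI rotate_in_ball[OF M _ v]] s by (simp add: T_def)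
            qed
            have Dd: "D s a k = poly_partial n I c' k a / of_nat m" for a k
              unfolding D_def poly_eval_def F_def c'_def poly_partial_def sum_divide_distrib by (simp add: mult_ac)
            have "cmod (g w) \<le> (\<Sum>k<n. cmod (u k) * cmod (D s (\<tau> w) k))"
              unfolding g_def
            proof (rule sum_norm_le)
              fix k
              have "cmod (\<theta> (\<tau> w) k) \<le> cmod (D s (\<tau> w) k)"
                by (simp add: \<theta>_def norm_mult norm_sgn)
              then show "cmod (u k * G k w) \<le> cmod (u k) * cmod (D s (\<tau> w) k)"
                using w by (simp add: G_def norm_mult mult_left_mono)
            qed
            also have "\<dots> = (\<Sum>k<n. cmod (u k) * cmod (poly_partial n I c' k (\<tau> w))) / real m"
              unfolding Dd norm_divide norm_of_nat by (simp add: sum_divide_distrib)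
            also have "\<dots> \<le> (real m * exp 1 * polynorm N n I c') / real m"
              by (intro divide_right_mono sum_abs_deriv_le_polynorm[OF I m \<tau>(2)[OF w] u]) simp
            also have "\<dots> = exp 1 * polynorm N n I c'" using m by simp
            also have "\<dots> \<le> exp 1 * polynorm N n I c" using c'n by simp
            finally show "cmod (g w) \<le> exp 1 * polynorm N n I c" .
          qed
          finally show "cmod (poly_eval n (Lambda m n) d u) \<le> L * (exp 1 * polynorm N n I c)" .
        qed
      qed
      finally show ?thesis by (simp add: S_def mult_ac)
    qed
    have cT: "real (card T) = real (M ^ n)" "card T > 0" using M by (auto simp: T_def)
    have "(\<Sum>a\<in>W. \<Sum>k<n. \<Sum>\<alpha>\<in>I. cmod (r \<alpha> a k) * cmod (F \<alpha> k a))
       \<le> (\<Sum>a\<in>W. \<Sum>k<n. 2 ^ m * C ^ (2 * n) * ((\<Sum>t\<in>T. cmod (x t a k)) / real (card T)) * ((\<Sum>s\<in>T. cmod (D s a k)) / real (card T)))"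
      unfolding x_def D_def cT unfolding T_def
      by (intro sum_mono homogeneous_pairing_le[OF M C H I])
    \<comment> \<open>A product of two averages is a double average over independent rotations
      \<open>t\<close> and \<open>s\<close>; bringing it outermost leaves, for each pair, the sum
      bounded by \<open>key3\<close>.\<close>
    also have "\<dots> = 2 ^ m * C ^ (2 * n) * ((\<Sum>a\<in>W. \<Sum>k<n. \<Sum>t\<in>T. \<Sum>s\<in>T. cmod (x t a k) * cmod (D s a k)) / (real (card T) * real (card T)))"
      by (simp add: sum_product sum_distrib_left sum_divide_distrib mult_ac)
    also have "(\<Sum>a\<in>W. \<Sum>k<n. \<Sum>t\<in>T. \<Sum>s\<in>T. cmod (x t a k) * cmod (D s a k))
        = (\<Sum>a\<in>W. \<Sum>t\<in>T. \<Sum>s\<in>T. \<Sum>k<n. cmod (x t a k) * cmod (D s a k))"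
      by (rule sum.cong[OF refl], subst sum.swap, rule sum.cong[OF refl], rule sum.swap)
    also have "\<dots> = (\<Sum>t\<in>T. \<Sum>s\<in>T. \<Sum>a\<in>W. \<Sum>k<n. cmod (x t a k) * cmod (D s a k))"
      by (subst sum.swap, rule sum.cong[OF refl], rule sum.swap)
    also have "2 ^ m * C ^ (2 * n) * (\<dots> / (real (card T) * real (card T)))
        \<le> 2 ^ m * C ^ (2 * n) * ((\<Sum>t\<in>T. \<Sum>s\<in>T. S) / (real (card T) * real (card T)))"
      using C by (intro mult_left_mono divide_right_mono sum_mono key3) auto
    also have "\<dots> = 2 ^ m * C ^ (2 * n) * S" using cT(2) by simp
    finally show ?thesis by (simp add: S_def)
  qed
  finally show ?thesis by simp
qed

text \<open>The auxiliary bound no longer refers to the number of roots, the chosen projection or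
  the cells, so \<open>e\<close>, the excess of \<open>C\<close> over 1 and the excess of
  \<open>L\<close> over the projection constant can tend to 0. The last two are both set to
  \<open>1 / real (Suc j)\<close>.\<close>

lemma unconditional_estimate:
  assumes I: "I \<subseteq> Lambda m n" and ne: "I \<noteq> {}" and m: "m \<ge> 1" and z: "z \<in> B"
  shows "(\<Sum>\<alpha>\<in>I. cmod (c \<alpha> * mono n \<alpha> z))
    \<le> 2 ^ m * (exp 1 * Qnorm N n (Lambda m n) I * poly_proj_const N n (flat n m I) * polynorm N n I c)"
    (is "?lhs \<le> ?rhs (poly_proj_const N n (flat n m I))")
proof -
  define l where "l = poly_proj_const N n (flat n m I)"
  have est: "?lhs \<le> (1 + 1 / real (Suc j)) ^ (2 * n) * ?rhs (l + 1 / real (Suc j))" if "l \<ge> 0" for j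
  proof (rule field_le_epsilon)
    fix e :: real assume e: "e > 0"
    define C where "C = 1 + 1 / real (Suc j)"
    define L where "L = l + 1 / real (Suc j)"
    have C: "C > 1" by (simp add: C_def)
    obtain M where M: "M > 0" "\<And>a. bergman m a \<le> C * ((\<Sum>w\<in>unit_roots M. cmod (\<Sum>i\<le>m. a i * w ^ i)) / real M)"
      using carleman_discrete[OF C, of 0 m] by blast
    have "l < L" by (simp add: L_def)
    then obtain P where P: "projection_onto B (polyspace N n (flat n m I)) P"
      "\<forall>g\<in>linf B. supn B (P g) \<le> L * supn B g"
      using near_optimal_projection[OF flat_subset_Lambda] unfolding l_def by metis
    have "?lhs \<le> 2 ^ m * C ^ (2 * n) * (exp 1 * Qnorm N n (Lambda m n) I * L * polynorm N n I c) + e"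
      by (rule unconditional_estimate_aux[OF I ne m z P(1) P(2) _ M(1) _ M(2) e]) (use C that in \<open>auto simp: L_def\<close>)
    then show "?lhs \<le> (1 + 1 / real (Suc j)) ^ (2 * n) * ?rhs (l + 1 / real (Suc j)) + e"
      unfolding C_def L_def by (simp add: mult_ac)
  qed
  have "flat n m I \<noteq> {}" by (rule flat_nonempty[OF I ne m])
  then have "l \<ge> 1" unfolding l_def by (rule poly_proj_const_ge_1[OF flat_subset_Lambda])
  then have le: "\<forall>j. ?lhs \<le> (1 + 1 / real (Suc j)) ^ (2 * n) * ?rhs (l + 1 / real (Suc j))"
    using est by simp
  have inv: "(\<lambda>j. 1 / real (Suc j)) \<longlonglongrightarrow> 0" using LIMSEQ_inverse_real_of_nat by (simp add: inverse_eq_divide)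
  have "(\<lambda>j. (1 + 1 / real (Suc j)) ^ (2 * n) * ?rhs (l + 1 / real (Suc j)))
      \<longlonglongrightarrow> (1 + 0) ^ (2 * n) * ?rhs (l + 0)"
    by (intro tendsto_intros inv)
  then have "?lhs \<le> (1 + 0) ^ (2 * n) * ?rhs (l + 0)" by (rule LIMSEQ_le_const) (use le in blast)
  then show ?thesis by (simp add: l_def)
qed

end

section \<open>Taylor coefficients\<close>

text \<open>A finite substitute for Cauchy's integral formula: the Taylor polynomial of degree below
  \<open>M\<close> is recovered exactly, and the tail contributes a geometric error because it is
  bounded on the larger circle of radius \<open>\<sigma>\<close>.\<close>

lemma unit_roots_coeff_approx:
  fixes f :: "complex \<Rightarrow> complex"
  assumes hol: "f holomorphic_on ball 0 R" and bd: "\<And>s. s \<in> ball 0 R \<Longrightarrow> cmod (f s) \<le> K"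
    and \<rho>: "0 < \<rho>" "\<rho> < \<sigma>" "\<sigma> < R" and a: "a < M"
  shows "cmod ((\<Sum>w\<in>unit_roots M. cnj w ^ a * f (of_real \<rho> * w)) / of_nat M - (deriv ^^ a) f 0 / fact a * of_real \<rho> ^ a)
      \<le> K * (\<rho> / \<sigma>) ^ M / (1 - \<rho> / \<sigma>)"
    and "cmod ((deriv ^^ i) f 0 / fact i) \<le> K / \<sigma> ^ i"
proof -
  define c where "c i = (deriv ^^ i) f 0 / fact i" for i
  define q where "q = \<rho> / \<sigma>"
  define p where "p w = (\<Sum>i\<le>M - 1. (c i * of_real \<rho> ^ i) * w ^ i)" for w
  have q: "0 \<le> q" "q < 1" using \<rho> by (auto simp: q_def)
  have M: "M > 0" using a by simp
  have K: "K \<ge> 0" using bd[of 0] \<rho> norm_ge_zero order.trans by (metis centre_in_ball less_trans)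
  have c: "cmod (c i) \<le> K / \<sigma> ^ i" for i
  proof -
    have "cmod ((deriv ^^ i) f 0) \<le> fact i * K / \<sigma> ^ i"
    proof (rule Cauchy_inequality)
      have sub: "cball 0 \<sigma> \<subseteq> ball (0::complex) R" using \<rho> by auto
      show "f holomorphic_on ball 0 \<sigma>" using hol sub ball_subset_cball holomorphic_on_subset by blast
      show "continuous_on (cball 0 \<sigma>) f"
        using hol sub holomorphic_on_imp_continuous_on holomorphic_on_subset by blast
      show "cmod (f x) \<le> K" if "cmod (0 - x) = \<sigma>" for x using that \<rho> by (intro bd) auto
    qed (use \<rho> in auto)
    then show ?thesis by (simp add: c_def norm_divide field_simps)
  qed
  show "cmod ((deriv ^^ i) f 0 / fact i) \<le> K / \<sigma> ^ i" using c by (simp add: c_def)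
  have tail: "cmod (f (of_real \<rho> * w) - p w) \<le> K * q ^ M / (1 - q)"
    if w: "cmod w = 1" for w
  proof -
    have "of_real \<rho> * w \<in> ball 0 R" using w \<rho> by (simp add: norm_mult)
    from holomorphic_power_series[OF hol this]
    have s: "(\<lambda>i. (c i * of_real \<rho> ^ i) * w ^ i) sums f (of_real \<rho> * w)"
      by (simp add: c_def power_mult_distrib mult.assoc)
    have s2: "(\<lambda>i. (c (i + M) * of_real \<rho> ^ (i + M)) * w ^ (i + M)) sums
        (f (of_real \<rho> * w) - (\<Sum>i<M. (c i * of_real \<rho> ^ i) * w ^ i))"
      using sums_split_initial_segment[OF s, of M] by simp
    have summand: "cmod ((c (i + M) * of_real \<rho> ^ (i + M)) * w ^ (i + M)) \<le> K * q ^ M * q ^ i" for i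
    proof -
      have "cmod ((c (i + M) * of_real \<rho> ^ (i + M)) * w ^ (i + M)) = cmod (c (i + M)) * \<rho> ^ (i + M)"
        using w \<rho> by (simp add: norm_mult norm_power)
      also have "\<dots> \<le> K / \<sigma> ^ (i + M) * \<rho> ^ (i + M)" using c \<rho> by (intro mult_right_mono) auto
      also have "\<dots> = K * q ^ M * q ^ i" by (simp add: q_def power_divide power_add mult_ac)
      finally show ?thesis .
    qed
    have geo: "(\<lambda>i. K * q ^ M * q ^ i) sums (K * q ^ M * (1 / (1 - q)))"
      using q by (intro sums_mult geometric_sums) auto
    have "cmod (\<Sum>i. (c (i + M) * of_real \<rho> ^ (i + M)) * w ^ (i + M)) \<le> (\<Sum>i. K * q ^ M * q ^ i)"
      using summand geo by (intro norm_suminf_le) (auto simp: sums_iff)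
    then have "cmod (f (of_real \<rho> * w) - (\<Sum>i<M. (c i * of_real \<rho> ^ i) * w ^ i)) \<le> K * q ^ M / (1 - q)"
      using s2 geo by (simp add: sums_iff)
    moreover have "{..<M} = {..M - 1}" using M by auto
    ultimately show ?thesis by (simp add: p_def)
  qed
  have "(\<Sum>w\<in>unit_roots M. cnj w ^ a * f (of_real \<rho> * w)) - of_nat M * (c a * of_real \<rho> ^ a)
     = (\<Sum>w\<in>unit_roots M. cnj w ^ a * f (of_real \<rho> * w))
       - (\<Sum>w\<in>unit_roots M. cnj w ^ a * p w)"
    unfolding p_def using a by (subst unit_roots_coeff) auto
  also have "\<dots> = (\<Sum>w\<in>unit_roots M. cnj w ^ a * (f (of_real \<rho> * w) - p w))"
    by (simp add: sum_subtractf right_diff_distrib)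
  finally have eq: "(\<Sum>w\<in>unit_roots M. cnj w ^ a * f (of_real \<rho> * w)) / of_nat M - c a * of_real \<rho> ^ a
     = (\<Sum>w\<in>unit_roots M. cnj w ^ a * (f (of_real \<rho> * w) - p w)) / of_nat M"
    using M by (simp add: field_simps)
  have "cmod (\<Sum>w\<in>unit_roots M. cnj w ^ a * (f (of_real \<rho> * w) - p w))
      \<le> (\<Sum>w\<in>unit_roots M. K * q ^ M / (1 - q))"
    by (rule sum_norm_le) (use tail norm_unit_roots[OF M] in \<open>simp add: norm_mult norm_power\<close>)
  then have "cmod ((\<Sum>w\<in>unit_roots M. cnj w ^ a * f (of_real \<rho> * w)) / of_nat M - c a * of_real \<rho> ^ a) \<le> K * q ^ M / (1 - q)"
    unfolding eq using M by (simp add: norm_divide field_simps)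
  then show "cmod ((\<Sum>w\<in>unit_roots M. cnj w ^ a * f (of_real \<rho> * w)) / of_nat M - (deriv ^^ a) f 0 / fact a * of_real \<rho> ^ a)
      \<le> K * (\<rho> / \<sigma>) ^ M / (1 - \<rho> / \<sigma>)"
    by (simp add: c_def q_def)
qed

text \<open>Caratheodory's argument: \<open>Re (K - u f) \<ge> 0\<close> for every unimodular \<open>u\<close>, and the coefficients of a function with
  nonnegative real part are at most twice its value at the centre.\<close>

lemma coeff_le_twice_gap:
  fixes f :: "complex \<Rightarrow> complex"
  assumes hol: "f holomorphic_on ball 0 1" and bd: "\<And>s. s \<in> ball 0 1 \<Longrightarrow> cmod (f s) \<le> K" and m: "m \<ge> 1"
  shows "cmod ((deriv ^^ m) f 0 / fact m) \<le> 2 * (K - cmod (f 0))"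
proof -
  define c where "c i = (deriv ^^ i) f 0 / fact i" for i
  \<comment> \<open>A unimodular factor turning \<open>f 0\<close> into its modulus; since
    \<open>sgn 0 = 0\<close>, the value at a zero has to be chosen separately.\<close>
  define u where "u = (if f 0 = 0 then 1 else cnj (sgn (f 0)))"
  have u1: "cmod u = 1" by (simp add: u_def norm_sgn)
  have u2: "u * f 0 = of_real (cmod (f 0))" by (simp add: u_def cnj_sgn_mult)
  note u = u1 u2
  have K: "K \<ge> 0" using bd[of 0] norm_ge_zero order.trans by (metis centre_in_ball zero_less_one)
  have main: "cmod (c m) * \<rho> ^ m \<le> 2 * (K - cmod (f 0))" if \<rho>: "0 < \<rho>" "\<rho> < 1" for \<rho>
  proof -
    define \<sigma> where "\<sigma> = (1 + \<rho>) / 2"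
    define q where "q = \<rho> / \<sigma>"
    have \<sigma>: "\<rho> < \<sigma>" "\<sigma> < 1" using \<rho> by (auto simp: \<sigma>_def)
    have q: "0 < q" "q < 1" using \<rho> \<sigma> by (auto simp: q_def)
    define err where "err M = K * q ^ M / (1 - q)" for M
    define A where "A M a = (\<Sum>w\<in>unit_roots M. cnj w ^ a * f (of_real \<rho> * w)) / of_nat M" for M a
    have A: "cmod (A M a - c a * of_real \<rho> ^ a) \<le> err M" if "a < M" for M a
      using unit_roots_coeff_approx(1)[OF hol bd \<rho>(1) \<sigma> that] by (simp add: A_def c_def err_def q_def)
    have cb: "cmod (c i) * \<rho> ^ i \<le> K * q ^ i" for i
    proof -
      have "cmod (c i) \<le> K / \<sigma> ^ i" unfolding c_def by (rule unit_roots_coeff_approx(2)[OF hol bd \<rho>(1) \<sigma>, of 0 1]) auto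
      then have "cmod (c i) * \<rho> ^ i \<le> K / \<sigma> ^ i * \<rho> ^ i" using \<rho> by (intro mult_right_mono) auto
      then show ?thesis by (simp add: q_def power_divide)
    qed
    \<comment> \<open>The error \<open>err M\<close> is paid four times: once each at the orders
      \<open>m\<close> and \<open>M - m\<close>, and twice at order 0, where the bound carries the
      factor 2.\<close>
    have est: "cmod (c m) * \<rho> ^ m \<le> 2 * (K - cmod (f 0)) + 4 * err M + K * q ^ (M - m)" if M: "M > m" for M
    proof -
      have M0: "M > 0" using M by simp
      define h where "h w = of_real K - u * f (of_real \<rho> * w)" for w
      define S where "S = (\<Sum>w\<in>unit_roots M. cnj w ^ m * (h w + cnj (h w)))"
      have Re_h: "Re (h w) \<ge> 0" if "w \<in> unit_roots M" for w
      proof -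
        have "cmod (f (of_real \<rho> * w)) \<le> K"
          using norm_unit_roots[OF M0 that] \<rho> by (intro bd) (simp add: norm_mult)
        then show ?thesis using complex_Re_le_cmod[of "u * f (of_real \<rho> * w)"] u by (simp add: h_def norm_mult)
      qed
      have S0: "(\<Sum>w\<in>unit_roots M. cnj w ^ a) = 0" if "0 < a" "a < M" for a
        using unit_roots_orthogonal[of 0 M a] that by simp
      have H: "(\<Sum>w\<in>unit_roots M. cnj w ^ a * h w) = - u * (of_nat M * A M a)" if "0 < a" "a < M" for a
      proof -
        have "(\<Sum>w\<in>unit_roots M. cnj w ^ a * h w)
            = of_real K * (\<Sum>w\<in>unit_roots M. cnj w ^ a) - u * (\<Sum>w\<in>unit_roots M. cnj w ^ a * f (of_real \<rho> * w))"
          by (simp add: h_def right_diff_distrib sum_subtractf sum_distrib_left mult_ac)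
        then show ?thesis using S0[OF that] M0 by (simp add: A_def)
      qed
      have H0: "(\<Sum>w\<in>unit_roots M. h w) = of_nat M * (of_real K - u * A M 0)"
        using M0 by (simp add: h_def sum_subtractf sum_distrib_left[symmetric] A_def field_simps)
      \<comment> \<open>On roots of unity the conjugate half of \<open>S\<close> aliases to the
        coefficient of order \<open>M - m\<close>. It would vanish for an integral; here it is of
        size \<open>K * q ^ (M - m)\<close> and disappears in the limit.\<close>
      have cn: "w ^ m = cnj w ^ (M - m)" if w: "w \<in> unit_roots M" for w
      proof -
        have "w ^ m * cnj w ^ m = 1"
          using norm_unit_roots[OF M0 w] complex_norm_square[of w] by (simp flip: power_mult_distrib)
        moreover have "cnj w ^ (M - m) * cnj w ^ m = 1"
        proof -
          have "cnj w ^ (M - m) * cnj w ^ m = cnj (w ^ M)" using M by (simp flip: power_add)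
          moreover have "w ^ M = 1" using w by (simp add: unit_roots_def)
          ultimately show ?thesis by (simp only: complex_cnj_one)
        qed
        ultimately have "w ^ m * cnj w ^ m = cnj w ^ (M - m) * cnj w ^ m" "cnj w ^ m \<noteq> 0"
          using norm_unit_roots[OF M0 w] by auto
        then show ?thesis by (simp only: mult_cancel_right) simp
      qed
      have "cmod S \<le> (\<Sum>w\<in>unit_roots M. 2 * Re (h w))"
        unfolding S_def by (rule sum_norm_le)
          (use Re_h norm_unit_roots[OF M0] in \<open>simp add: norm_mult norm_power complex_add_cnj\<close>)
      also have "\<dots> = 2 * Re (\<Sum>w\<in>unit_roots M. h w)" by (simp add: sum_distrib_left)
      also have "\<dots> = real M * (2 * Re (of_real K - u * A M 0))" unfolding H0 by simp
      finally have 1: "cmod S \<le> real M * (2 * Re (of_real K - u * A M 0))" .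
      have "S
          = (\<Sum>w\<in>unit_roots M. cnj w ^ m * h w) + cnj (\<Sum>w\<in>unit_roots M. w ^ m * h w)"
        by (simp add: S_def distrib_left sum.distrib)
      also have "(\<Sum>w\<in>unit_roots M. w ^ m * h w) = (\<Sum>w\<in>unit_roots M. cnj w ^ (M - m) * h w)"
        by (rule sum.cong) (auto simp: cn)
      also have "\<dots> = - u * (of_nat M * A M (M - m))" using m M by (intro H) auto
      also have "(\<Sum>w\<in>unit_roots M. cnj w ^ m * h w) = - u * (of_nat M * A M m)" using m M by (intro H) auto
      finally have 2: "S
          = - of_nat M * (u * A M m + cnj (u * A M (M - m)))"
        by (simp add: algebra_simps)
      have "real M * cmod (u * A M m + cnj (u * A M (M - m))) \<le> real M * (2 * Re (of_real K - u * A M 0))"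
        using 1 unfolding 2 by (simp add: norm_mult)
      then have 3: "cmod (u * A M m + cnj (u * A M (M - m))) \<le> 2 * Re (of_real K - u * A M 0)" using M0 by simp
      have "cmod (u * A M m) \<le> cmod (u * A M m + cnj (u * A M (M - m))) + cmod (cnj (u * A M (M - m)))"
        by (metis add_diff_cancel_right' norm_triangle_ineq4)
      also have "\<dots> = cmod (u * A M m + cnj (u * A M (M - m))) + cmod (A M (M - m))"
        using u by (simp only: complex_mod_cnj norm_mult mult_1)
      finally have 4: "cmod (A M m) \<le> 2 * Re (of_real K - u * A M 0) + cmod (A M (M - m))"
        using 3 u by (simp add: norm_mult)
      have 5: "cmod (c m) * \<rho> ^ m \<le> cmod (A M m) + err M"
        using A[OF M] norm_triangle_ineq3[of "A M m" "c m * of_real \<rho> ^ m"] \<rho>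
        by (simp add: norm_mult norm_power)
      have 6: "cmod (A M (M - m)) \<le> K * q ^ (M - m) + err M"
      proof -
        have "cmod (c (M - m) * of_real \<rho> ^ (M - m)) \<le> K * q ^ (M - m)"
          using cb[of "M - m"] \<rho> by (simp add: norm_mult norm_power)
        moreover have "cmod (A M (M - m) - c (M - m) * of_real \<rho> ^ (M - m)) \<le> err M" using m M by (intro A) auto
        ultimately show ?thesis
          using norm_triangle_ineq2[of "A M (M - m)" "c (M - m) * of_real \<rho> ^ (M - m)"] by linarith
      qed
      have 7: "Re (of_real K - u * A M 0) \<le> K - cmod (f 0) + err M"
      proof -
        have "cmod (u * (A M 0 - f 0)) \<le> err M" using A[of 0 M] M0 u by (simp add: norm_mult c_def)
        then have "- Re (u * (A M 0 - f 0)) \<le> err M"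
          using abs_Re_le_cmod[of "u * (A M 0 - f 0)"] by linarith
        then show ?thesis using u(2) by (simp add: right_diff_distrib)
      qed
      have "x \<le> 2 * k + 4 * d + y"
        if "p \<le> 2 * v + p'" "x \<le> p + d" "p' \<le> y + d" "v \<le> k + d" for x k d y p v p' :: real
        using that by linarith
      from this[OF 4 5 6 7] show ?thesis .
    qed
    have z: "(\<lambda>M. q ^ M) \<longlonglongrightarrow> 0" using q by (intro LIMSEQ_realpow_zero) auto
    have lim: "(\<lambda>j. 2 * (K - cmod (f 0)) + 4 * (K * q ^ (j + Suc m) / (1 - q)) + K * q ^ (j + 1))
        \<longlonglongrightarrow> 2 * (K - cmod (f 0)) + 4 * (K * 0 / (1 - q)) + K * 0"
      using q by (intro tendsto_intros LIMSEQ_ignore_initial_segment[OF z]) auto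
    have "cmod (c m) * \<rho> ^ m \<le> 2 * (K - cmod (f 0)) + 4 * (K * q ^ (j + Suc m) / (1 - q)) + K * q ^ (j + 1)" for j
      using est[of "j + Suc m"] by (simp add: err_def Suc_diff_le)
    then have "cmod (c m) * \<rho> ^ m \<le> 2 * (K - cmod (f 0)) + 4 * (K * 0 / (1 - q)) + K * 0"
      by (intro LIMSEQ_le_const[OF lim]) blast
    then show ?thesis by simp
  qed
  \<comment> \<open>Radii tending to 1; the shift by 2 makes even the first of them positive, as
    \<open>main\<close> demands.\<close>
  have "(\<lambda>j. 1 - 1 / real (j + 2)) \<longlonglongrightarrow> 1 - 0"
    using LIMSEQ_ignore_initial_segment[OF lim_1_over_n, of 2] by (intro tendsto_intros) (simp add: add.commute)
  then have "(\<lambda>j. cmod (c m) * (1 - 1 / real (j + 2)) ^ m) \<longlonglongrightarrow> cmod (c m) * (1 - 0) ^ m"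
    by (intro tendsto_mult tendsto_const tendsto_power)
  then have "cmod (c m) * (1 - 0) ^ m \<le> 2 * (K - cmod (f 0))"
    by (rule LIMSEQ_le_const2) (use main in \<open>auto intro!: exI[of _ 0]\<close>)
  then show ?thesis by (simp add: c_def)
qed

section \<open>Iterated Taylor expansion of separately holomorphic functions\<close>

definition polydisc :: "nat \<Rightarrow> real \<Rightarrow> (nat \<Rightarrow> complex) set" where
  "polydisc n R = {z \<in> cvec n. \<forall>k<n. cmod (z k) < R}"

text \<open>Separate holomorphy with a uniform bound is what the iterated expansion uses, and
  \<open>coord_deriv\<close> preserves it on the same polydisc.\<close>

definition sep_holo :: "nat \<Rightarrow> real \<Rightarrow> real \<Rightarrow> ((nat \<Rightarrow> complex) \<Rightarrow> complex) \<Rightarrow> bool" where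
  "sep_holo n R K g \<longleftrightarrow> (\<forall>z\<in>polydisc n R. cmod (g z) \<le> K)
     \<and> (\<forall>z\<in>polydisc n R. \<forall>k<n. (\<lambda>t. g (z(k := t))) holomorphic_on ball 0 R)"

definition coord_deriv :: "nat \<Rightarrow> nat \<Rightarrow> ((nat \<Rightarrow> complex) \<Rightarrow> complex) \<Rightarrow> (nat \<Rightarrow> complex) \<Rightarrow> complex" where
  "coord_deriv k a g z = (deriv ^^ a) (\<lambda>t. g (z(k := t))) 0"

lemma polydisc_upd: "z \<in> polydisc n R \<Longrightarrow> k < n \<Longrightarrow> cmod t < R \<Longrightarrow> z(k := t) \<in> polydisc n R"
  by (auto simp: polydisc_def cvec_def)

text \<open>In coordinate \<open>k\<close> the result is constant. In any other coordinate it is a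
  locally uniform limit of averages over roots of unity, each holomorphic in that coordinate; this
  replaces differentiation under an integral. The bound is Cauchy's inequality.\<close>

lemma sep_holo_coord_deriv:
  assumes g: "sep_holo n R K g" and k: "k < n" and \<rho>: "0 < \<rho>" "\<rho> < R"
  shows "sep_holo n R (fact a * K / \<rho> ^ a) (coord_deriv k a g)"
proof -
  define \<sigma> where "\<sigma> = (\<rho> + R) / 2"
  have \<sigma>: "\<rho> < \<sigma>" "\<sigma> < R" using \<rho> by (auto simp: \<sigma>_def)
  have hol: "(\<lambda>t. g (z(k := t))) holomorphic_on ball 0 R" if "z \<in> polydisc n R" "k < n" for z k
    using g that by (simp add: sep_holo_def)
  have bd: "cmod (g (z(k := t))) \<le> K" if "z \<in> polydisc n R" "t \<in> ball 0 R" for z t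
    using g polydisc_upd[OF that(1) k, of t] that by (simp add: sep_holo_def)
  show ?thesis unfolding sep_holo_def
  proof (intro conjI ballI allI impI)
    fix z assume z: "z \<in> polydisc n R"
    obtain \<rho>' where \<rho>': "0 < \<rho>'" "\<rho>' < \<rho>" using \<rho> dense by blast
    have "cmod (coord_deriv k a g z / fact a) \<le> K / \<rho> ^ a"
      unfolding coord_deriv_def
      by (rule unit_roots_coeff_approx(2)[OF hol[OF z k] bd[OF z] \<rho>' \<rho>(2), of 0 1]) auto
    then show "cmod (coord_deriv k a g z) \<le> fact a * K / \<rho> ^ a" by (simp add: norm_divide field_simps)
  next
    fix z j assume z: "z \<in> polydisc n R" and j: "j < n"
    show "(\<lambda>t. coord_deriv k a g (z(j := t))) holomorphic_on ball 0 R"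
    proof (cases "j = k")
      case True
      then show ?thesis by (simp add: coord_deriv_def)
    next
      case False
      define A where "A M t = fact a / of_real \<rho> ^ a * ((\<Sum>w\<in>unit_roots (M + Suc a). cnj w ^ a * g ((z(k := of_real \<rho> * w))(j := t))) / of_nat (M + Suc a))" for M t
      have Ahol: "A M holomorphic_on ball 0 R" for M
        unfolding A_def
      proof (intro holomorphic_intros)
        show "complex_of_nat (M + Suc a) \<noteq> 0" by (simp only: of_nat_eq_0_iff)
        fix w assume "w \<in> unit_roots (M + Suc a)"
        then have "cmod w = 1" using norm_unit_roots[of "M + Suc a" w] by simp
        then have "z(k := of_real \<rho> * w) \<in> polydisc n R" using polydisc_upd[OF z k] \<rho> by (simp add: norm_mult)
        then show "(\<lambda>t. g ((z(k := of_real \<rho> * w))(j := t))) holomorphic_on ball 0 R" using hol j by blast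
      qed
      define E where "E M = fact a / \<rho> ^ a * (K * (\<rho> / \<sigma>) ^ (M + Suc a) / (1 - \<rho> / \<sigma>))" for M
      have close: "cmod (A M t - coord_deriv k a g (z(j := t))) \<le> E M" if t: "t \<in> ball 0 R" for M t
      proof -
        have zt: "z(j := t) \<in> polydisc n R" using polydisc_upd[OF z j] t by simp
        have "A M t - coord_deriv k a g (z(j := t)) = fact a / of_real \<rho> ^ a *
          ((\<Sum>w\<in>unit_roots (M + Suc a). cnj w ^ a * g ((z(j := t))(k := of_real \<rho> * w))) / of_nat (M + Suc a)
           - coord_deriv k a g (z(j := t)) / fact a * of_real \<rho> ^ a)"
          using \<rho> False by (simp add: A_def right_diff_distrib fun_upd_twist)
        also have "cmod \<dots> \<le> E M"
          unfolding E_def norm_mult coord_deriv_def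
          using \<rho> by (intro mult_mono unit_roots_coeff_approx(1)[OF hol[OF zt k] bd[OF zt] \<rho>(1) \<sigma>])
            (auto simp: norm_divide norm_power)
        finally show ?thesis .
      qed
      have "E \<longlonglongrightarrow> fact a / \<rho> ^ a * (K * 0 / (1 - \<rho> / \<sigma>))"
        unfolding E_def
      proof (intro tendsto_intros)
        show "(\<lambda>M. (\<rho> / \<sigma>) ^ (M + Suc a)) \<longlonglongrightarrow> 0"
          by (rule LIMSEQ_ignore_initial_segment, rule LIMSEQ_realpow_zero) (use \<rho> \<sigma> in auto)
      qed (use \<rho> \<sigma> in auto)
      then have E0: "E \<longlonglongrightarrow> 0" by simp
      show ?thesis
      proof (rule holomorphic_uniform_sequence[OF open_ball Ahol])
        fix x :: complex assume "x \<in> ball 0 R"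
        then obtain d where d: "d > 0" "cball x d \<subseteq> ball 0 R" using open_contains_cball open_ball by metis
        have "uniform_limit (cball x d) A (\<lambda>t. coord_deriv k a g (z(j := t))) sequentially"
        proof (rule uniform_limitI)
          fix e :: real assume "e > 0"
          then have "\<forall>\<^sub>F M in sequentially. E M < e" using E0 by (rule order_tendstoD(2)[rotated])
          then show "\<forall>\<^sub>F M in sequentially. \<forall>t\<in>cball x d. dist (A M t) (coord_deriv k a g (z(j := t))) < e"
          proof eventually_elim
            case (elim M)
            have "cmod (A M t - coord_deriv k a g (z(j := t))) < e" if "t \<in> cball x d" for t
              using close[of t M] d(2) that elim by (meson le_less_trans subsetD)
            then show ?case by (simp only: dist_norm) blast
          qed
        qed
        then show "\<exists>d>0. cball x d \<subseteq> ball 0 R \<and> uniform_limit (cball x d) A (\<lambda>t. coord_deriv k a g (z(j := t))) sequentially"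
          using d by blast
      qed
    qed
  qed
qed

text \<open>The derivatives of \<open>hder\<close>, except that each coordinate is put to 0 as soon
  as it has been differentiated. Derivatives at a general point would require a smaller polydisc at
  every stage.\<close>

fun zero_deriv :: "nat \<Rightarrow> (nat \<Rightarrow> nat) \<Rightarrow> ((nat \<Rightarrow> complex) \<Rightarrow> complex) \<Rightarrow> ((nat \<Rightarrow> complex) \<Rightarrow> complex)" where
  "zero_deriv 0 \<alpha> f = f"
| "zero_deriv (Suc k) \<alpha> f = coord_deriv k (\<alpha> k) (zero_deriv k \<alpha> f)"

lemma zero_deriv_cong: "(\<And>j. j < k \<Longrightarrow> \<alpha> j = \<beta> j) \<Longrightarrow> zero_deriv k \<alpha> f = zero_deriv k \<beta> f"
  by (induction k) auto

lemma deriv_shift: "deriv (\<lambda>t. F (c + t)) 0 = deriv F (c::complex)"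
proof -
  have "(F has_field_derivative D) (at c) \<longleftrightarrow> ((\<lambda>t. F (c + t)) has_field_derivative D) (at 0)" for D
    using DERIV_shift[of F D 0 c] by (simp add: add.commute)
  then show ?thesis by (simp add: deriv_def)
qed

lemma cpartial_funpow: "(cpartial k ^^ a) g z = (deriv ^^ a) (\<lambda>t. g (z(k := t))) (z k)"
proof (induction a arbitrary: z)
  case (Suc a)
  have "(cpartial k ^^ Suc a) g z = deriv (\<lambda>t. (deriv ^^ a) (\<lambda>s. g (z(k := s))) (z k + t)) 0"
    by (simp only: funpow.simps o_apply cpartial_def Suc fun_upd_upd fun_upd_same)
  also have "\<dots> = deriv ((deriv ^^ a) (\<lambda>s. g (z(k := s)))) (z k)" by (rule deriv_shift)
  finally show ?case by (simp only: funpow.simps o_apply)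
qed simp

lemma hder_eq_zero_deriv: "(\<And>j. j < k \<Longrightarrow> z j = 0) \<Longrightarrow> hder k \<alpha> f z = zero_deriv k \<alpha> f z"
proof (induction k arbitrary: z)
  case (Suc k)
  have "(\<lambda>t. hder k \<alpha> f (z(k := t))) = (\<lambda>t. zero_deriv k \<alpha> f (z(k := t)))"
    using Suc by (intro ext Suc.IH) auto
  then show ?case using Suc.prems[of k] by (simp add: cpartial_funpow coord_deriv_def)
qed simp

lemma sep_holo_zero_deriv:
  assumes "sep_holo n R K f" "k \<le> n" "0 < \<rho>" "\<rho> < R"
  shows "sep_holo n R ((\<Prod>j<k. fact (\<alpha> j)) * K / \<rho> ^ deg k \<alpha>) (zero_deriv k \<alpha> f)"
  using assms(2)
proof (induction k)
  case 0
  then show ?case using assms by (simp add: deg_def)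
next
  case (Suc k)
  then have "sep_holo n R (fact (\<alpha> k) * ((\<Prod>j<k. fact (\<alpha> j)) * K / \<rho> ^ deg k \<alpha>) / \<rho> ^ \<alpha> k) (zero_deriv (Suc k) \<alpha> f)"
    using sep_holo_coord_deriv[OF Suc.IH _ assms(3,4)] by simp
  then show ?case by (simp add: deg_def power_add mult_ac)
qed

lemma multi_Suc: "multi (Suc k) = (\<lambda>(\<alpha>, a). \<alpha>(k := a)) ` (multi k \<times> UNIV)"
proof (intro equalityI subsetI)
  fix \<alpha> assume a: "\<alpha> \<in> multi (Suc k)"
  have "\<alpha> = (\<lambda>(\<alpha>, a). \<alpha>(k := a)) (\<alpha>(k := 0), \<alpha> k)" by auto
  moreover have "(\<alpha>(k := 0), \<alpha> k) \<in> multi k \<times> UNIV" using a by (auto simp: multi_def)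
  ultimately show "\<alpha> \<in> (\<lambda>(\<alpha>, a). \<alpha>(k := a)) ` (multi k \<times> UNIV)" by (rule image_eqI)
qed (auto simp: multi_def)

lemma inj_on_multi_Suc: "inj_on (\<lambda>(\<alpha>, a). \<alpha>(k := a)) (multi k \<times> UNIV)"
proof (rule inj_onI, clarify)
  fix a \<alpha> b \<beta> assume "\<alpha> \<in> multi k" "\<beta> \<in> multi k" and eq: "\<alpha>(k := a) = \<beta>(k := b)"
  then have z: "\<alpha> k = 0" "\<beta> k = 0" by (auto simp: multi_def)
  have "a = b" using fun_cong[OF eq, of k] by simp
  moreover have "\<alpha> i = \<beta> i" for i using fun_cong[OF eq, of i] z by (cases "i = k") auto
  ultimately show "\<alpha> = \<beta> \<and> a = b" by auto
qed

lemma has_sum_multi_Suc: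
  "(F has_sum S) (multi (Suc k)) \<longleftrightarrow> ((\<lambda>(\<alpha>, a). F (\<alpha>(k := a))) has_sum S) (multi k \<times> UNIV)"
  unfolding multi_Suc has_sum_reindex[OF inj_on_multi_Suc] by (simp add: o_def case_prod_unfold)

lemma deg_Suc_upd: "deg (Suc k) (\<alpha>(k := a)) = deg k \<alpha> + a"
proof -
  have "(\<Sum>j<k. (\<alpha>(k := a)) j) = (\<Sum>j<k. \<alpha> j)" by (rule sum.cong) auto
  then show ?thesis by (simp add: deg_def)
qed

lemma geometric_has_sum:
  fixes q :: real
  assumes "0 \<le> q" "q < 1"
  shows "((\<lambda>a. C * q ^ a) has_sum (C * (1 / (1 - q)))) UNIV"
proof (rule norm_summable_imp_has_sum)
  show "(\<lambda>a. C * q ^ a) sums (C * (1 / (1 - q)))"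
    using assms by (intro sums_mult geometric_sums) auto
  show "summable (\<lambda>a. norm (C * q ^ a))"
    using assms by (auto simp: abs_mult power_abs intro!: summable_mult summable_geometric)
qed

lemma summable_deg_power:
  fixes q :: real
  assumes q: "0 \<le> q" "q < 1"
  shows "(\<lambda>\<alpha>. q ^ deg k \<alpha>) summable_on multi k"
proof (induction k)
  case 0
  have "multi 0 = {\<lambda>_. 0}" by (auto simp: multi_def)
  then show ?case by simp
next
  case (Suc k)
  have "(\<lambda>(\<alpha>, a). q ^ deg k \<alpha> * q ^ a) summable_on multi k \<times> UNIV"
  proof (rule summable_on_SigmaI)
    show "((\<lambda>a. case (\<alpha>, a) of (\<alpha>, a) \<Rightarrow> q ^ deg k \<alpha> * q ^ a) has_sum (q ^ deg k \<alpha> * (1 / (1 - q)))) UNIV" for \<alpha>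
      using geometric_has_sum[OF q, of "q ^ deg k \<alpha>"] by simp
    show "(\<lambda>\<alpha>. q ^ deg k \<alpha> * (1 / (1 - q))) summable_on multi k"
      by (rule summable_on_cmult_left[OF Suc])
  qed (use q in auto)
  then have "\<exists>S. ((\<lambda>(\<alpha>, a). q ^ deg (Suc k) (\<alpha>(k := a))) has_sum S) (multi k \<times> UNIV)"
    unfolding deg_Suc_upd power_add summable_on_def .
  then show ?case unfolding summable_on_def has_sum_multi_Suc .
qed

text \<open>After \<open>k\<close> coordinates have been expanded, the coefficients still depend on
  the later coordinates of \<open>z\<close>; the step expands each coefficient in coordinate
  \<open>k\<close>. Cauchy's bounds give a geometric majorant, and the resulting absolute
  summability allows the iterated sum to be read as one over multi-indices.\<close>

lemma partial_taylor_has_sum: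
  assumes f: "sep_holo n R K f" and k: "k \<le> n" and \<rho>: "0 < \<rho>" "\<rho> < R"
    and z: "z \<in> cvec n" "\<And>j. j < n \<Longrightarrow> cmod (z j) \<le> \<rho>'" "0 \<le> \<rho>'" "\<rho>' < \<rho>"
  shows "((\<lambda>\<alpha>. zero_deriv k \<alpha> f z / (\<Prod>j<k. fact (\<alpha> j)) * mono k \<alpha> z) has_sum f z) (multi k)"
  using k
proof (induction k)
  case 0
  have "multi 0 = {\<lambda>_. 0}" by (auto simp: multi_def)
  then show ?case by (simp add: mono_def has_sum_finite_iff)
next
  case (Suc k)
  define q where "q = \<rho>' / \<rho>"
  have q: "0 \<le> q" "q < 1" using z \<rho> by (auto simp: q_def)
  have zp: "z \<in> polydisc n R" using z \<rho> by (force simp: polydisc_def)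
  have K: "K \<ge> 0" using f zp norm_ge_zero order.trans unfolding sep_holo_def by blast
  define T where "T \<alpha> = zero_deriv (Suc k) \<alpha> f z / (\<Prod>j<Suc k. fact (\<alpha> j)) * mono (Suc k) \<alpha> z" for \<alpha>
  have bound: "cmod (T \<alpha>) \<le> K * q ^ deg (Suc k) \<alpha>" for \<alpha>
  proof -
    have "cmod (zero_deriv (Suc k) \<alpha> f z) \<le> (\<Prod>j<Suc k. fact (\<alpha> j)) * K / \<rho> ^ deg (Suc k) \<alpha>"
      using sep_holo_zero_deriv[OF f Suc.prems \<rho>, of \<alpha>] zp unfolding sep_holo_def by blast
    moreover have pos: "(\<Prod>j<Suc k. fact (\<alpha> j) :: real) > 0" by (intro prod_pos) auto
    ultimately have "cmod (zero_deriv (Suc k) \<alpha> f z) / (\<Prod>j<Suc k. fact (\<alpha> j)) \<le> K / \<rho> ^ deg (Suc k) \<alpha>"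
      by (simp add: field_simps del: prod.lessThan_Suc)
    moreover have "cmod (mono (Suc k) \<alpha> z) \<le> \<rho>' ^ deg (Suc k) \<alpha>"
    proof -
      have "cmod (mono (Suc k) \<alpha> z) = (\<Prod>j<Suc k. cmod (z j) ^ \<alpha> j)"
        by (simp only: mono_def prod_norm[symmetric] norm_power)
      also have "\<dots> \<le> (\<Prod>j<Suc k. \<rho>' ^ \<alpha> j)"
        using z(2) Suc.prems by (intro prod_mono) (auto intro!: power_mono)
      also have "\<dots> = \<rho>' ^ deg (Suc k) \<alpha>" unfolding deg_def by (rule power_sum[symmetric])
      finally show ?thesis .
    qed
    ultimately have "cmod (zero_deriv (Suc k) \<alpha> f z) / (\<Prod>j<Suc k. fact (\<alpha> j)) * cmod (mono (Suc k) \<alpha> z)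
        \<le> K / \<rho> ^ deg (Suc k) \<alpha> * \<rho>' ^ deg (Suc k) \<alpha>"
      using K \<rho> by (intro mult_mono) (auto intro!: divide_nonneg_nonneg prod_nonneg)
    also have "\<dots> = K * q ^ deg (Suc k) \<alpha>" by (simp add: q_def power_divide)
    finally show ?thesis unfolding T_def norm_mult norm_divide prod_norm[symmetric] norm_fact .
  qed
  have summ: "(\<lambda>(\<alpha>, a). T (\<alpha>(k := a))) summable_on multi k \<times> UNIV"
  proof -
    have "(\<lambda>\<alpha>. K * q ^ deg (Suc k) \<alpha>) summable_on multi (Suc k)"
      by (rule summable_on_cmult_right[OF summable_deg_power[OF q]])
    then have "(\<lambda>\<alpha>. norm (T \<alpha>)) summable_on multi (Suc k)"
      by (rule summable_on_comparison_test) (use bound in auto)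
    then have "T summable_on multi (Suc k)" by (rule abs_summable_summable)
    then show ?thesis unfolding summable_on_def has_sum_multi_Suc .
  qed
  have "((\<lambda>(\<alpha>, a). T (\<alpha>(k := a))) has_sum f z) (multi k \<times> UNIV)"
  proof (rule has_sum_SigmaI[OF _ Suc.IH summ])
    show "k \<le> n" using Suc.prems by simp
    fix \<alpha> assume \<alpha>: "\<alpha> \<in> multi k"
    define g where "g = zero_deriv k \<alpha> f"
    have g: "sep_holo n R ((\<Prod>j<k. fact (\<alpha> j)) * K / \<rho> ^ deg k \<alpha>) g"
      unfolding g_def using Suc.prems by (intro sep_holo_zero_deriv f \<rho>) simp
    have hol: "(\<lambda>t. g (z(k := t))) holomorphic_on ball 0 R"
      using g zp Suc.prems unfolding sep_holo_def by auto
    have zk: "z k \<in> ball 0 R" using zp Suc.prems by (simp add: polydisc_def)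
    have summand: "T (\<alpha>(k := a)) = (deriv ^^ a) (\<lambda>t. g (z(k := t))) 0 / fact a * z k ^ a * (mono k \<alpha> z / (\<Prod>j<k. fact (\<alpha> j)))" for a
    proof -
      have 1: "zero_deriv (Suc k) (\<alpha>(k := a)) f z = (deriv ^^ a) (\<lambda>t. g (z(k := t))) 0"
        using zero_deriv_cong[of k "\<alpha>(k := a)" \<alpha> f] by (simp add: coord_deriv_def g_def)
      have 2: "(\<Prod>j<Suc k. fact ((\<alpha>(k := a)) j)) = (\<Prod>j<k. fact (\<alpha> j)) * (fact a :: complex)"
        by (simp cong: prod.cong_simp)
      have 3: "mono (Suc k) (\<alpha>(k := a)) z = mono k \<alpha> z * z k ^ a"
        using mono_Suc_upd[of k \<alpha> a z "z k"] by simp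
      show ?thesis unfolding T_def 1 2 3 by (simp add: mult_ac)
    qed
    have "(\<lambda>a. (deriv ^^ a) (\<lambda>t. g (z(k := t))) 0 / fact a * z k ^ a) sums g z"
      using holomorphic_power_series[OF hol zk] by simp
    then have "(\<lambda>a. T (\<alpha>(k := a))) sums (g z * (mono k \<alpha> z / (\<Prod>j<k. fact (\<alpha> j))))"
      unfolding summand by (rule sums_mult2)
    moreover have "summable (\<lambda>a. norm (T (\<alpha>(k := a))))"
    proof (rule summable_comparison_test'[where g = "\<lambda>a. K * q ^ deg k \<alpha> * q ^ a"])
      show "summable (\<lambda>a. K * q ^ deg k \<alpha> * q ^ a)" using q by (intro summable_mult summable_geometric) auto
      show "norm (norm (T (\<alpha>(k := a)))) \<le> K * q ^ deg k \<alpha> * q ^ a" for a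
        using bound[of "\<alpha>(k := a)"] by (simp add: deg_Suc_upd power_add mult.assoc)
    qed
    ultimately have "((\<lambda>a. T (\<alpha>(k := a))) has_sum (g z * (mono k \<alpha> z / (\<Prod>j<k. fact (\<alpha> j))))) UNIV"
      by (intro norm_summable_imp_has_sum)
    then show "((\<lambda>a. case (\<alpha>, a) of (\<alpha>, a) \<Rightarrow> T (\<alpha>(k := a))) has_sum zero_deriv k \<alpha> f z / (\<Prod>j<k. fact (\<alpha> j)) * mono k \<alpha> z) UNIV"
      by (simp add: g_def)
  qed
  then have "(T has_sum f z) (multi (Suc k))" by (simp only: has_sum_multi_Suc)
  then show ?case unfolding T_def .
qed

section \<open>The Bohr radius\<close>

lemma holo_on_line_derivative:
  assumes f: "holo_on n f U" and z: "z \<in> U" and v: "v \<in> cvec n"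
  obtains D where "((\<lambda>s. f (\<lambda>k. z k + s * v k)) has_field_derivative D) (at 0)"
proof -
  obtain a where a: "\<And>e. e > 0 \<Longrightarrow> \<exists>d>0. \<forall>h\<in>cvec n. l1n n h < d \<longrightarrow>
       cmod (f (\<lambda>k. z k + h k) - f z - (\<Sum>k<n. a k * h k)) \<le> e * l1n n h"
    using f z unfolding holo_on_def by metis
  define S where "S = l1n n v"
  have S: "S \<ge> 0" by (simp add: S_def l1n_def sum_nonneg)
  define D where "D = (\<Sum>k<n. a k * v k)"
  have "((\<lambda>s. f (\<lambda>k. z k + s * v k)) has_derivative (*) D) (at 0)"
    unfolding has_derivative_at_alt
  proof (intro conjI allI impI)
    show "bounded_linear ((*) D)" by (rule bounded_linear_mult_right)
    fix e :: real assume e: "e > 0"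
    \<comment> \<open>\<open>S + 1\<close> in place of \<open>S\<close> admits the direction
      \<open>v = 0\<close>.\<close>
    define e' where "e' = e / (S + 1)"
    have e': "e' > 0" using e S by (simp add: e'_def)
    obtain d where d: "d > 0" "\<forall>h\<in>cvec n. l1n n h < d \<longrightarrow>
       cmod (f (\<lambda>k. z k + h k) - f z - (\<Sum>k<n. a k * h k)) \<le> e' * l1n n h" using a[OF e'] by blast
    show "\<exists>d>0. \<forall>s. cmod (s - 0) < d \<longrightarrow>
        cmod (f (\<lambda>k. z k + s * v k) - f (\<lambda>k. z k + 0 * v k) - D * (s - 0)) \<le> e * cmod (s - 0)"
    proof (intro exI[of _ "d / (S + 1)"] conjI allI impI)
      show "d / (S + 1) > 0" using d S by simp
      fix s :: complex assume s: "cmod (s - 0) < d / (S + 1)"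
      define h where "h k = s * v k" for k
      have l: "l1n n h = cmod s * S" by (simp add: h_def l1n_def S_def norm_mult sum_distrib_left)
      have "cmod s * S \<le> cmod s * (S + 1)" by (intro mult_left_mono) auto
      also have "\<dots> < d" using s S by (simp add: field_simps)
      finally have "l1n n h < d" by (simp add: l)
      moreover have "h \<in> cvec n" using v by (simp add: h_def cvec_def)
      ultimately have "cmod (f (\<lambda>k. z k + h k) - f z - (\<Sum>k<n. a k * h k)) \<le> e' * l1n n h" using d(2) by blast
      also have "\<dots> = e' * S * cmod s" by (simp add: l)
      also have "\<dots> \<le> e * cmod s"
      proof (rule mult_right_mono)
        have "e' * S \<le> e' * (S + 1)" using e' by simp
        then show "e' * S \<le> e" using S by (simp add: e'_def)
      qed simp
      finally show "cmod (f (\<lambda>k. z k + s * v k) - f (\<lambda>k. z k + 0 * v k) - D * (s - 0)) \<le> e * cmod (s - 0)"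
        by (simp add: h_def D_def sum_distrib_left mult_ac)
    qed
  qed
  then have "((\<lambda>s. f (\<lambda>k. z k + s * v k)) has_field_derivative D) (at 0)"
    by (simp add: has_field_derivative_def)
  then show thesis by (rule that)
qed

lemma holo_on_line_holomorphic:
  assumes f: "holo_on n f U" and v: "v \<in> cvec n" and A: "open A"
    and sub: "\<And>s. s \<in> A \<Longrightarrow> (\<lambda>k. z k + s * v k) \<in> U"
  shows "(\<lambda>s. f (\<lambda>k. z k + s * v k)) holomorphic_on A"
  unfolding holomorphic_on_open[OF A]
proof
  fix s assume s: "s \<in> A"
  obtain D where D: "((\<lambda>t. f (\<lambda>k. (z k + s * v k) + t * v k)) has_field_derivative D) (at 0)"
    using holo_on_line_derivative[OF f sub[OF s] v] by blast
  have "((\<lambda>t. f (\<lambda>k. z k + (t + s) * v k)) has_field_derivative D) (at 0)"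
    using D by (simp add: algebra_simps)
  then have "((\<lambda>t. f (\<lambda>k. z k + t * v k)) has_field_derivative D) (at s)"
    using DERIV_shift[of "\<lambda>t. f (\<lambda>k. z k + t * v k)" D 0 s] by simp
  then show "\<exists>D. ((\<lambda>t. f (\<lambda>k. z k + t * v k)) has_field_derivative D) (at s)" by blast
qed

context seq_lattice
begin

lemma ball_scale: "w \<in> B \<Longrightarrow> cmod s \<le> 1 \<Longrightarrow> (\<lambda>k. s * w k) \<in> B"
  by (rule ball_solid[of w]) (auto simp: XBall_def cvec_def norm_mult mult_left_le_one_le)

text \<open>Near the origin the absolutely convergent Taylor series can be grouped by degree, which
  gives a power series for the slice through \<open>w\<close>. Uniqueness of power series then
  identifies its coefficients for every \<open>w\<close> in the ball, although the grouping was
  justified only for small \<open>s\<close>.\<close>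

lemma homogeneous_part_eq:
  assumes f: "holo_on n f B" and bd: "\<And>z. z \<in> B \<Longrightarrow> cmod (f z) \<le> K" and w: "w \<in> B"
  shows "poly_eval n (Lambda m n) (taylor_coeff n f) w = (deriv ^^ m) (\<lambda>s. f (\<lambda>k. s * w k)) 0 / fact m"
proof -
  obtain R where R: "R > 0" "\<And>z. z \<in> cvec n \<Longrightarrow> (\<And>k. k < n \<Longrightarrow> cmod (z k) \<le> R) \<Longrightarrow> z \<in> B"
    using polydisc_in_ball by metis
  have pB: "z \<in> B" if "z \<in> polydisc n R" for z
    using that by (intro R(2)) (auto simp: polydisc_def less_imp_le)
  have sep: "sep_holo n R K f"
    unfolding sep_holo_def
  proof (intro conjI ballI allI impI)
    show "cmod (f z) \<le> K" if "z \<in> polydisc n R" for z using bd pB that by blast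
    fix z k assume z: "z \<in> polydisc n R" and k: "k < n"
    \<comment> \<open>Varying one coordinate is moving along a line in direction
      \<open>unit_seq k\<close>, which brings in the Frechet derivative.\<close>
    have upd: "z(k := t) = (\<lambda>j. (z(k := 0)) j + t * unit_seq k j)" for t by (auto simp: unit_seq_def)
    have hol: "(\<lambda>t. f (\<lambda>j. (z(k := 0)) j + t * unit_seq k j)) holomorphic_on ball 0 R"
    proof (rule holo_on_line_holomorphic[OF f])
      show "unit_seq k \<in> cvec n" using k by (auto simp: unit_seq_def cvec_def)
      show "(\<lambda>j. (z(k := 0)) j + t * unit_seq k j) \<in> B" if "t \<in> ball 0 R" for t
        unfolding upd[symmetric] using that by (intro pB polydisc_upd[OF z k]) simp
    qed simp
    have eq: "(\<lambda>t. f (z(k := t))) = (\<lambda>t. f (\<lambda>j. (z(k := 0)) j + t * unit_seq k j))"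
      by (intro ext arg_cong[where f = f] upd)
    show "(\<lambda>t. f (z(k := t))) holomorphic_on ball 0 R" unfolding eq by (rule hol)
  qed
  define \<rho> where "\<rho> = R / 2"
  have \<rho>: "0 < \<rho>" "\<rho> < R" using R by (auto simp: \<rho>_def)
  obtain Q where Q: "Q \<ge> 1" "\<And>z k. z \<in> B \<Longrightarrow> cmod (z k) \<le> Q" using ball_coordinate_le by metis
  define c where "c = taylor_coeff n f"
  have zd: "zero_deriv n \<alpha> f z = hder n \<alpha> f (\<lambda>_. 0)" if "z \<in> cvec n" for \<alpha> z
  proof -
    have ind: "zero_deriv k \<alpha> f z = zero_deriv k \<alpha> f z'" if "\<And>j. j \<ge> k \<Longrightarrow> z j = z' j" for k z z'
      using that
    proof (induction k arbitrary: z z')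
      case 0
      then have "z = z'" by auto
      then show ?case by simp
    next
      case (Suc k)
      have "(\<lambda>t. zero_deriv k \<alpha> f (z(k := t))) = (\<lambda>t. zero_deriv k \<alpha> f (z'(k := t)))"
        using Suc.prems by (intro ext Suc.IH) auto
      then show ?case by (simp add: coord_deriv_def)
    qed
    have "zero_deriv n \<alpha> f z = zero_deriv n \<alpha> f (\<lambda>_. 0)" using that by (intro ind) (auto simp: cvec_def)
    then show ?thesis by (simp add: hder_eq_zero_deriv)
  qed
  have sums: "(\<lambda>m. poly_eval n (Lambda m n) c w * s ^ m) sums f (\<lambda>k. s * w k)" if s: "cmod s < \<rho> / (2 * Q)" for s
  proof -
    define z where "z k = s * w k" for k
    have zc: "z \<in> cvec n" using w by (simp add: z_def XBall_def cvec_def)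
    have zb: "cmod (z j) \<le> \<rho> / 2" for j
    proof -
      have "cmod (z j) \<le> \<rho> / (2 * Q) * Q" unfolding z_def norm_mult
        using s \<rho> Q(1) Q(2)[OF w] by (intro mult_mono) auto
      then show ?thesis using Q(1) by simp
    qed
    have "((\<lambda>\<alpha>. zero_deriv n \<alpha> f z / (\<Prod>j<n. fact (\<alpha> j)) * mono n \<alpha> z) has_sum f z) (multi n)"
      by (rule partial_taylor_has_sum[OF sep order.refl \<rho> zc, of "\<rho> / 2"]) (use zb \<rho> in auto)
    then have hs: "((\<lambda>\<alpha>. c \<alpha> * mono n \<alpha> z) has_sum f z) (multi n)"
      by (simp add: zd[OF zc] c_def taylor_coeff_def)
    have "bij_betw snd (SIGMA m:UNIV. Lambda m n) (multi n)"
      by (rule bij_betwI[where g = "\<lambda>\<alpha>. (deg n \<alpha>, \<alpha>)"]) (auto simp: Lambda_def)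
    from has_sum_reindex_bij_betw[OF this, of "\<lambda>\<alpha>. c \<alpha> * mono n \<alpha> z" "f z"] hs
    have "((\<lambda>x. c (snd x) * mono n (snd x) z) has_sum f z) (SIGMA m:UNIV. Lambda m n)" by simp
    then have "((\<lambda>m. poly_eval n (Lambda m n) c z) has_sum f z) UNIV"
      by (rule has_sum_SigmaD) (simp add: poly_eval_def)
    then have "(\<lambda>m. poly_eval n (Lambda m n) c z) sums f z" by (rule has_sum_imp_sums)
    moreover have "poly_eval n (Lambda m n) c z = poly_eval n (Lambda m n) c w * s ^ m" for m
    proof -
      have "mono n \<alpha> z = s ^ m * mono n \<alpha> w" if "\<alpha> \<in> Lambda m n" for \<alpha>
        unfolding z_def by (rule mono_scale[OF that])
      then show ?thesis unfolding poly_eval_def sum_distrib_right by (intro sum.cong) (auto simp: mult_ac)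
    qed
    ultimately show ?thesis by (simp add: z_def[abs_def])
  qed
  have "(\<lambda>s. f (\<lambda>k. s * w k)) has_fps_expansion Abs_fps (\<lambda>m. poly_eval n (Lambda m n) c w)"
  proof (rule has_fps_expansionI)
    have "\<forall>\<^sub>F s in nhds (0::complex). s \<in> ball 0 (\<rho> / (2 * Q))"
      using \<rho> Q by (intro eventually_nhds_in_open) auto
    then show "\<forall>\<^sub>F s in nhds 0. (\<lambda>m. fps_nth (Abs_fps (\<lambda>m. poly_eval n (Lambda m n) c w)) m * s ^ m) sums f (\<lambda>k. s * w k)"
      by eventually_elim (use sums in auto)
  qed
  from fps_nth_fps_expansion[OF this, of m] show ?thesis by (simp add: c_def)
qed

lemma homogeneous_part_le:
  assumes f: "holo_on n f B" and bd: "\<And>z. z \<in> B \<Longrightarrow> cmod (f z) \<le> K" and w: "w \<in> B" and m: "m \<ge> 1"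
  shows "cmod (poly_eval n (Lambda m n) (taylor_coeff n f) w) \<le> 2 * (K - cmod (f (\<lambda>_. 0)))"
proof -
  have sc: "(\<lambda>k. s * w k) \<in> B" if "s \<in> ball 0 1" for s using that by (intro ball_scale[OF w]) auto
  have "(\<lambda>s. f (\<lambda>k. 0 + s * w k)) holomorphic_on ball 0 1"
    by (rule holo_on_line_holomorphic[OF f]) (use w sc in \<open>auto simp: XBall_def\<close>)
  then have "cmod ((deriv ^^ m) (\<lambda>s. f (\<lambda>k. s * w k)) 0 / fact m) \<le> 2 * (K - cmod (f (\<lambda>k. 0 * w k)))"
    by (intro coeff_le_twice_gap m) (use bd sc in auto)
  moreover have "poly_eval n (Lambda m n) (taylor_coeff n f) w = (deriv ^^ m) (\<lambda>s. f (\<lambda>k. s * w k)) 0 / fact m"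
    by (rule homogeneous_part_eq[OF f _ w]) (rule bd)
  ultimately show ?thesis by simp
qed

text \<open>Bohr's argument: the homogeneous parts are bounded by \<open>2 (K - |f(0)|)\<close>, and \<open>2 \<Sum>\<^sub>m 3\<^sup>-\<^sup>m = 1\<close>.\<close>

lemma bohr_radius_ge:
  assumes J: "J \<subseteq> multi n" and r: "0 < r" "r < 1"
    and est: "\<And>m c w. m \<ge> 1 \<Longrightarrow> w \<in> B \<Longrightarrow>
      (3 * r) ^ m * (\<Sum>\<alpha>\<in>J \<inter> Lambda m n. cmod (c \<alpha> * mono n \<alpha> w)) \<le> polynorm N n (J \<inter> Lambda m n) c"
  shows "ereal r \<le> bohr_radius N n J"
  unfolding bohr_radius_def
proof (rule Sup_upper, rule imageI, safe)
  show "0 < r" "r < 1" by (rule r)+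
  fix f assume f: "holo_on n f B" and bf: "bounded_fun_on f B" and van: "\<forall>\<alpha>\<in>multi n - J. taylor_coeff n f \<alpha> = 0"
  define c where "c = taylor_coeff n f"
  define a0 where "a0 = cmod (f (\<lambda>_. 0))"
  define K where "K = (SUP z\<in>B. cmod (f z))"
  have bdd: "bdd_above ((\<lambda>z. cmod (f z)) ` B)"
    using bf by (auto simp: bounded_fun_on_def bdd_above_def)
  have bd: "cmod (f z) \<le> K" if "z \<in> B" for z unfolding K_def using bdd that by (intro cSUP_upper)
  have K0: "a0 \<le> K" unfolding a0_def by (rule bd[OF zero_in_ball])
  have part: "polynorm N n (J \<inter> Lambda m n) c \<le> 2 * (K - a0)" if "m \<ge> 1" for m
  proof (rule polynorm_least)
    fix w assume w: "w \<in> B"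
    have "poly_eval n (J \<inter> Lambda m n) c w = poly_eval n (Lambda m n) c w"
      unfolding poly_eval_def
    proof (rule sum.mono_neutral_left)
      show "\<forall>\<alpha>\<in>Lambda m n - J \<inter> Lambda m n. c \<alpha> * mono n \<alpha> w = 0"
        using van by (auto simp: c_def Lambda_def)
    qed auto
    moreover have "cmod (poly_eval n (Lambda m n) (taylor_coeff n f) w) \<le> 2 * (K - a0)"
      unfolding a0_def by (rule homogeneous_part_le[OF f _ w that]) (rule bd)
    ultimately show "cmod (poly_eval n (J \<inter> Lambda m n) c w) \<le> 2 * (K - a0)"
      by (simp add: c_def)
  qed
  have c0: "c (\<lambda>_. 0) = f (\<lambda>_. 0)"
  proof -
    have "hder k (\<lambda>_. 0) f = f" for k by (induction k) auto
    then show ?thesis by (simp add: c_def taylor_coeff_def)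
  qed
  show "(SUP z\<in>(\<lambda>w k. complex_of_real r * w k) ` B. \<Sum>\<^sub>\<infinity>\<alpha>\<in>J. ennreal (cmod (taylor_coeff n f \<alpha> * mono n \<alpha> z)))
      \<le> ennreal (SUP z\<in>B. cmod (f z))"
    unfolding K_def[symmetric] c_def[symmetric]
  proof (rule SUP_least)
    fix z assume "z \<in> (\<lambda>w k. complex_of_real r * w k) ` B"
    then obtain w where w: "w \<in> B" and z: "z = (\<lambda>k. of_real r * w k)" by auto
    have fin: "(\<Sum>\<alpha>\<in>F. cmod (c \<alpha> * mono n \<alpha> z)) \<le> K" if F: "finite F" "F \<subseteq> J" for F
    proof -
      define M where "M = Max (insert 0 (deg n ` F))"
      have sub: "F \<subseteq> (\<Union>m\<in>{..M}. J \<inter> Lambda m n)"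
      proof
        fix \<alpha> assume a: "\<alpha> \<in> F"
        then have "deg n \<alpha> \<le> M" unfolding M_def using F(1) by (intro Max_ge) auto
        then show "\<alpha> \<in> (\<Union>m\<in>{..M}. J \<inter> Lambda m n)" using a F(2) J by (auto simp: Lambda_def)
      qed
      define S where "S m = (\<Sum>\<alpha>\<in>J \<inter> Lambda m n. cmod (c \<alpha> * mono n \<alpha> z))" for m
      have "(\<Sum>\<alpha>\<in>F. cmod (c \<alpha> * mono n \<alpha> z)) \<le> (\<Sum>\<alpha>\<in>(\<Union>m\<in>{..M}. J \<inter> Lambda m n). cmod (c \<alpha> * mono n \<alpha> z))"
        using sub by (intro sum_mono2) auto
      also have "\<dots> = (\<Sum>m\<le>M. S m)"
        unfolding S_def
      proof (rule sum.UNION_disjoint)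
        show "\<forall>m\<in>{..M}. finite (J \<inter> Lambda m n)" by simp
      qed (auto simp: Lambda_def)
      also have "\<dots> = S 0 + (\<Sum>m<M. S (Suc m))" by (rule sum.atMost_shift)
      also have "\<dots> \<le> a0 + (\<Sum>m<M. 2 * (K - a0) * (1 / 3) ^ Suc m)"
      proof (intro add_mono sum_mono)
        have "\<alpha> = (\<lambda>_. 0)" if "\<alpha> \<in> Lambda 0 n" for \<alpha>
        proof
          fix k
          show "\<alpha> k = 0" using that by (cases "k < n") (auto simp: Lambda_def deg_def multi_def)
        qed
        then have "J \<inter> Lambda 0 n \<subseteq> {\<lambda>_. 0}" by auto
        then have "S 0 \<le> (\<Sum>\<alpha>\<in>{\<lambda>_. 0}. cmod (c \<alpha> * mono n \<alpha> z))"
          unfolding S_def by (intro sum_mono2) auto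
        then show "S 0 \<le> a0" by (simp add: c0 mono_def a0_def)
      next
        fix m
        have "S (Suc m) = (\<Sum>\<alpha>\<in>J \<inter> Lambda (Suc m) n. r ^ Suc m * cmod (c \<alpha> * mono n \<alpha> w))"
          unfolding S_def z
        proof (intro sum.cong refl)
          fix \<alpha> assume "\<alpha> \<in> J \<inter> Lambda (Suc m) n"
          then have "mono n \<alpha> (\<lambda>k. of_real r * w k) = of_real r ^ Suc m * mono n \<alpha> w" by (intro mono_scale) auto
          then show "cmod (c \<alpha> * mono n \<alpha> (\<lambda>k. of_real r * w k)) = r ^ Suc m * cmod (c \<alpha> * mono n \<alpha> w)"
            using r by (simp add: norm_mult norm_power)
        qed
        \<comment> \<open>Splitting \<open>r\<close> into \<open>1 / 3\<close> and
          \<open>3 * r\<close> leaves a geometric factor beside the quantity that \<open>est\<close>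
          controls.\<close>
        also have "\<dots> = (1 / 3) ^ Suc m * ((3 * r) ^ Suc m * (\<Sum>\<alpha>\<in>J \<inter> Lambda (Suc m) n. cmod (c \<alpha> * mono n \<alpha> w)))"
          by (simp only: sum_distrib_left[symmetric] mult.assoc[symmetric] power_mult_distrib[symmetric]) simp
        also have "\<dots> \<le> (1 / 3) ^ Suc m * (2 * (K - a0))"
          using est[of "Suc m" w c] part[of "Suc m"] w by (intro mult_left_mono) auto
        finally show "S (Suc m) \<le> 2 * (K - a0) * (1 / 3) ^ Suc m" by (simp only: mult.commute)
      qed
      also have "\<dots> = a0 + 2 * (K - a0) * (\<Sum>m<M. (1 / 3) ^ Suc m)"
        by (simp only: sum_distrib_left)
      also have "\<dots> \<le> a0 + 2 * (K - a0) * (1 / 2)"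
      proof (intro add_left_mono mult_left_mono)
        have "(\<Sum>m<M. (1 / 3) ^ Suc m) = (1 - (1 / 3 :: real) ^ M) / 2"
        proof (induction M)
          case (Suc M)
          have "s + 1 / 3 * x = (1 - 1 / 3 * x) / 2" if "s = (1 - x) / 2" for s x :: real
            using that by (simp add: field_simps)
          from this[OF Suc] show ?case by (simp only: sum.lessThan_Suc power_Suc)
        qed simp
        then show "(\<Sum>m<M. (1 / 3 :: real) ^ Suc m) \<le> 1 / 2" by simp
      qed (use K0 in auto)
      also have "\<dots> = K" by (simp add: field_simps)
      finally show ?thesis .
    qed
    have "(\<Sum>\<^sub>\<infinity>\<alpha>\<in>J. ennreal (cmod (c \<alpha> * mono n \<alpha> z)))
        = (SUP F\<in>{F. finite F \<and> F \<subseteq> J}. \<Sum>\<alpha>\<in>F. ennreal (cmod (c \<alpha> * mono n \<alpha> z)))"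
      by (rule nonneg_infsum_complete) simp
    also have "\<dots> \<le> ennreal K"
      by (rule SUP_least) (use fin in \<open>auto simp: sum_ennreal intro!: ennreal_leI\<close>)
    finally show "(\<Sum>\<^sub>\<infinity>\<alpha>\<in>J. ennreal (cmod (c \<alpha> * mono n \<alpha> z))) \<le> ennreal K" .
  qed
qed

text \<open>A crude count in the shape of an \<open>m\<close>-th power, so that a fixed radius can
  absorb it in all degrees at once.\<close>

lemma card_Lambda_le: "real (card (Lambda m n)) \<le> (2 ^ n) ^ m"
proof -
  have card: "card (ibox m j) = Suc m ^ j" for j
  proof (induction j)
    case 0
    have "ibox m 0 = {\<lambda>_. 0}" by (auto simp: ibox_def multi_def)
    then show ?case by simp
  next
    case (Suc j)
    then show ?case using sum_ibox_Suc[of "\<lambda>_. 1 :: nat" m j] by simp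
  qed
  have "card (Lambda m n) \<le> Suc m ^ n" using card_mono[OF finite_ibox Lambda_subset_ibox, of m n] by (simp add: card)
  also have "\<dots> \<le> (2 ^ m) ^ n"
    using Suc_leI[OF less_exp[of m]] by (intro power_mono) simp_all
  also have "\<dots> = (2 ^ n) ^ m" by (simp add: power_mult[symmetric] mult.commute)
  finally show ?thesis using of_nat_le_iff[of "card (Lambda m n)" "(2 ^ n) ^ m"] by simp
qed

text \<open>The supremum is taken in \<open>ereal\<close>, where the empty set yields
  \<open>-\<infinity>\<close>, so some admissible radius must be exhibited. Bounding each term of a
  homogeneous part by the norm and counting the terms shows that \<open>1 / (3 * 2 ^ n)\<close> is
  one.\<close>

lemma bohr_radius_nonneg:
  assumes J: "J \<subseteq> multi n"
  shows "0 \<le> bohr_radius N n J"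
proof -
  define r :: real where "r = 1 / (3 * 2 ^ n)"
  have "(1::real) \<le> 2 ^ n" by simp
  then have "(1::real) < 3 * 2 ^ n" by linarith
  then have r: "0 < r" "r < 1" by (auto simp: r_def)
  have "ereal r \<le> bohr_radius N n J"
  proof (rule bohr_radius_ge[OF J r])
    fix m :: nat and c w assume w: "w \<in> B"
    let ?I = "J \<inter> Lambda m n"
    have pn: "0 \<le> polynorm N n ?I c" by (rule polynorm_nonneg) simp
    have "(\<Sum>\<alpha>\<in>?I. cmod (c \<alpha> * mono n \<alpha> w)) \<le> real (card ?I) * polynorm N n ?I c"
      by (rule sum_coeff_mono_le_card[where m = m, OF _ w]) simp
    also have "\<dots> \<le> (2 ^ n) ^ m * polynorm N n ?I c"
    proof (rule mult_right_mono[OF _ pn])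
      have "real (card ?I) \<le> real (card (Lambda m n))" by (intro of_nat_mono card_mono) auto
      then show "real (card ?I) \<le> (2 ^ n) ^ m" using card_Lambda_le[of m] by linarith
    qed
    finally have "(3 * r) ^ m * (\<Sum>\<alpha>\<in>?I. cmod (c \<alpha> * mono n \<alpha> w)) \<le> (3 * r) ^ m * ((2 ^ n) ^ m * polynorm N n ?I c)"
      using r by (intro mult_left_mono) auto
    also have "\<dots> = polynorm N n ?I c"
      by (simp add: r_def mult.assoc[symmetric] power_mult_distrib[symmetric])
    finally show "(3 * r) ^ m * (\<Sum>\<alpha>\<in>?I. cmod (c \<alpha> * mono n \<alpha> w)) \<le> polynorm N n ?I c" .
  qed
  then show ?thesis using r by (metis ereal_less_eq(5) less_imp_le order.trans)
qed

end

theorem theorem2p30: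
  fixes X :: "(nat \<Rightarrow> complex) set" and N :: "(nat \<Rightarrow> complex) \<Rightarrow> real"
    and n :: nat and J :: "(nat \<Rightarrow> nat) set"
  assumes "banach_seq_lattice X N"
    and "J \<subseteq> multi n"
    and "\<exists>\<alpha>\<in>J. 1 \<le> deg n \<alpha>"
  shows "ereal (bohr_lower_bound N n J) \<le> bohr_radius N n J"
proof -
  interpret seq_lattice X N n by unfold_locales (rule assms)
  define Q where "Q m = Qnorm N n (Lambda m n) (J \<inter> Lambda m n)" for m
  define l where "l m = poly_proj_const N n (flat n m (J \<inter> Lambda m n))" for m
  define D where "D = {m. 1 \<le> m \<and> J \<inter> Lambda m n \<noteq> {}}"
  define b where "b m = (1 / (exp 1 * Q m) powr (1 / real m)) * (1 / l m powr (1 / real m))" for m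
  define r0 where "r0 = Inf (b ` D)"
  have lb: "bohr_lower_bound N n J = r0 / 6"
    by (simp add: bohr_lower_bound_def r0_def b_def[abs_def] D_def Q_def l_def)
  obtain \<alpha> where \<alpha>: "\<alpha> \<in> J" "1 \<le> deg n \<alpha>" using assms(3) by blast
  then have "deg n \<alpha> \<in> D" using assms(2) by (auto simp: D_def Lambda_def)
  then have D: "D \<noteq> {}" by auto
  have Q1: "Q m \<ge> 1" if "m \<in> D" for m
    unfolding Q_def by (rule Qnorm_ge_1) (use that in \<open>auto simp: D_def\<close>)
  have l1: "l m \<ge> 1" if "m \<in> D" for m
    unfolding l_def
    by (rule poly_proj_const_ge_1[OF flat_subset_Lambda], rule flat_nonempty) (use that in \<open>auto simp: D_def\<close>)
  have bm: "0 \<le> b m" "b m ^ m = 1 / (exp 1 * Q m * l m)" if m: "m \<in> D" for m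
  proof -
    have m1: "m \<ge> 1" using m by (simp add: D_def)
    have pos: "exp 1 * Q m > 0" "l m > 0" using Q1[OF m] l1[OF m] by auto
    show "0 \<le> b m" by (simp add: b_def)
    have "(x powr (1 / real m)) ^ m = x" if "x > 0" for x :: real
      using that m1 by (simp add: powr_realpow[symmetric] powr_powr)
    then show "b m ^ m = 1 / (exp 1 * Q m * l m)"
      using pos unfolding b_def power_mult_distrib power_divide by simp
  qed
  have bdd: "bdd_below (b ` D)" using bm(1) by (auto intro!: bdd_belowI[of _ 0])
  have r0b: "r0 \<le> b m" if "m \<in> D" for m unfolding r0_def using bdd that by (intro cInf_lower) auto
  have b1: "b m \<le> 1" if m: "m \<in> D" for m
  proof (rule ccontr)
    assume "\<not> b m \<le> 1"
    then have "1 < b m ^ m" using m by (intro one_less_power) (auto simp: D_def)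
    moreover have "1 * 1 * 1 \<le> exp 1 * Q m * l m" using Q1[OF m] l1[OF m] by (intro mult_mono) auto
    then have "b m ^ m \<le> 1" unfolding bm(2)[OF m] by simp
    ultimately show False by simp
  qed
  have r01: "r0 \<le> 1" using D r0b b1 by (metis all_not_in_conv order.trans)
  show ?thesis
  \<comment> \<open>Admissible radii are positive, and so far \<open>r0\<close> is known only as an
    infimum of nonnegative numbers; a nonpositive value is covered by
    \<open>bohr_radius_nonneg\<close>.\<close>
  proof (cases "r0 \<le> 0")
    case True
    then have "ereal (bohr_lower_bound N n J) \<le> 0" by (simp add: lb)
    then show ?thesis using bohr_radius_nonneg[OF assms(2)] by (rule order.trans)
  next
    case False
    have "ereal (r0 / 6) \<le> bohr_radius N n J"
    proof (rule bohr_radius_ge[OF assms(2)])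
      show "0 < r0 / 6" "r0 / 6 < 1" using False r01 by auto
      fix m :: nat and c w assume m: "m \<ge> 1" and w: "w \<in> B"
      let ?I = "J \<inter> Lambda m n"
      have pn: "0 \<le> polynorm N n ?I c" by (rule polynorm_nonneg) simp
      show "(3 * (r0 / 6)) ^ m * (\<Sum>\<alpha>\<in>?I. cmod (c \<alpha> * mono n \<alpha> w)) \<le> polynorm N n ?I c"
      proof (cases "?I = {}")
        case True
        then show ?thesis using pn by (simp only: sum.empty mult_zero_right)
      next
        case ne: False
        then have mD: "m \<in> D" using m by (simp add: D_def)
        define P where "P = exp 1 * Q m * l m"
        have P: "P > 0" using Q1[OF mD] l1[OF mD] by (simp add: P_def)
        \<comment> \<open>\<open>3 * (r0 / 6)\<close> is \<open>r0 / 2\<close>: the 3 is Bohr's, and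
          the remaining 2 meets the \<open>2 ^ m\<close> of the unconditional estimate, while the
          \<open>m\<close>-th power of \<open>b m\<close> is \<open>1 / P\<close>.\<close>
        have "(3 * (r0 / 6)) ^ m \<le> (b m / 2) ^ m"
          using False r0b[OF mD] by (intro power_mono) auto
        also have "\<dots> = 1 / (2 ^ m * P)" by (simp add: power_divide bm(2)[OF mD] P_def)
        finally have le: "(3 * (r0 / 6)) ^ m \<le> 1 / (2 ^ m * P)" .
        have "(\<Sum>\<alpha>\<in>?I. cmod (c \<alpha> * mono n \<alpha> w)) \<le> 2 ^ m * (P * polynorm N n ?I c)"
          using unconditional_estimate[OF _ ne m w, of c] by (simp add: P_def Q_def l_def)
        then have "(3 * (r0 / 6)) ^ m * (\<Sum>\<alpha>\<in>?I. cmod (c \<alpha> * mono n \<alpha> w))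
            \<le> 1 / (2 ^ m * P) * (2 ^ m * (P * polynorm N n ?I c))"
          using le P by (intro mult_mono) (auto intro!: sum_nonneg)
        also have "\<dots> = polynorm N n ?I c" using P by simp
        finally show ?thesis .
      qed
    qed
    then show ?thesis by (simp add: lb)
  qed
qed

end
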